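(* Let $V$ be a category, $(E,u,\sigma)$ a multitensor on $V$ and $(T,\eta,\mu)$ a monad on $V$. Then there is a bijection between the following types of data: (1) Morphisms $\tau_{X_i}:TE_iX_i\to E_iTX_i$ of $V$ providing the coherences making $T$ into an opmonoidal monad on $(V,E)$. (2) Morphisms $\sigma'_{X_{ij}}:E_iTE_jTX_{ij}\to E_{ij}TX_{ij}$ of $V$ providing the substitutions for a multitensor $(EM(T),u',\sigma')$, where $u'_X=u_{TX}\eta_X$, such that $E\eta:E\to EM(T)$ is a multitensor map, $uT:T\to E_1T$ is a monad map, and the composite $$E_iT\xrightarrow{\;E_i\eta uT\;}E_iTE_1T\xrightarrow{\;\sigma'\;}E_iT$$ is the identity. (3) Liftings of the multitensor $E$ to a multitensor $E'$ on $V^T$. And for any given instance of such data one has an isomorphism of categories $$EM(T)\text{-Cat}\cong E'\text{-Cat}$$ commuting with the forgetful functors into $\mathcal{G}V$. If in addition $V$ has (small) coproducts, $T$ preserves them and $E$ is distributive, then the data (1)-(2) are also in bijection with: (4) Identity-on-objects morphisms $\lambda_X:\mathcal{G}(T)\Gamma(E)(X)\to\Gamma(E)\mathcal{G}(T)(X)$ of $\mathcal{G}V$ providing a monad distributive law of $\Gamma(E)$ over $\mathcal{G}(T)$.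
   Context: Enriched graphs. A $V$-graph $X$ consists of a set $X_0$ and objects $X(a,b)$ of $V$ for $(a,b)\in X_0\times X_0$; a morphism $f:X\to Y$ is a function $f_0:X_0\to Y_0$ with maps $f_{a,b}:X(a,b)\to Y(fa,fb)$. They form $\mathcal{G}V$. For a functor or natural transformation $H$, $\mathcal{G}H$ leaves objects unchanged and applies $H$ on homs; so a monad $T$ on $V$ gives a monad $\mathcal{G}(T)$ on $\mathcal{G}V$. Multitensors. Let $MV=\coprod_nV^n$ be the category of finite sequences in $V$. A multitensor $(E,u,\sigma)$ is a functor $E:MV\to V$, $E(X_1,\dots,X_n)=E_iX_i$, unary part $E_1$, with natural families $u_X:X\to E_1X$, $\sigma:E_iE_jX_{ij}\to E_{ij}X_{ij}$ (target: $E$ of the concatenated sequence) with $\sigma\circ u_{E_iX_i}=1$, $\sigma\circ E_i(u_{X_i})=1$ and the two composites $E_iE_jE_kX_{ijk}\to E_{ijk}X_{ijk}$ equal. It is distributive when each $V^n\to V$ preserves coproducts in each variable. A multitensor map $\theta:(E,u,\sigma)\to(F,v,\rho)$ is a natural transformation with $\theta u=v$ and $\theta\sigma=\rho\circ(\theta\theta)$, where $\theta\theta:E_iE_j\to F_iF_j$. $EM(T)$ denotes the functor $(X_1,\dots,X_n)\mapsto E_iTX_i$; in (2), $E_1T$ is the monad given by the unary part of $(EM(T),u',\sigma')$. $E$-categories. An $E$-category is $X\in\mathcal{G}V$ with maps $\kappa_{x_i}:E_iX(x_{i-1},x_i)\to X(x_0,x_n)$ for all $n\in\mathbb{N}$ and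 sequences $(x_0,\dots,x_n)$ in $X_0$, such that $\kappa\circ u_{X(x_0,x_1)}=1$ and $\kappa\circ\sigma=\kappa\circ E_i(\kappa)$ on $E_iE_jX(x_{ij-1},x_{ij})$ for doubly nested composable sequences. $E$-functors are $V$-graph maps compatible with the $\kappa$'s. These form $E\text{-Cat}$, with forgetful functor to $\mathcal{G}V$. For a multitensor $E'$ on $V^T$ the forgetful functor to $\mathcal{G}V$ is the composite $E'\text{-Cat}\to\mathcal{G}(V^T)\to\mathcal{G}V$, where $U^T:V^T\to V$ is the forgetful functor from the category of $T$-algebras. Opmonoidal monads. $(T,\eta,\mu)$ with maps $\tau_{X_i}:TE_iX_i\to E_iTX_i$ natural in the $X_i$ is an opmonoidal monad on $(V,E)$ (a monad in the 2-category of lax monoidal categories, oplax monoidal functors and monoidal natural transformations) when: $\tau\circ T(u_X)=u_{TX}$; $\tau\circ T(\sigma)=\sigma_{TX_{ij}}\circ E_i(\tau)\circ\tau_{E_jX_{ij}}$ as maps $TE_iE_jX_{ij}\to E_{ij}TX_{ij}$; $\tau\circ\eta_{E_iX_i}=E_i(\eta_{X_i})$; $\tau\circ\mu_{E_iX_i}=E_i(\mu_{X_i})\circ\tau_{TX_i}\circ T(\tau)$. A lifting of $E$ to $V^T$ is a multitensor $(E',u',\sigma')$ on $V^T$ with $U^TE'=EM(U^T)$, $U^Tu'=uU^T$, $U^T\sigma'=\sigma M^2(U^T)$; i.e. $T$-algebra structures on $E_iX_i$ for all sequences of $T$-algebras $(X_i,x_i)$, functorial in $T$-algebra maps, such that the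 components of $u$ and $\sigma$ at $T$-algebras are $T$-algebra maps. $\Gamma E$ (for $V$ with coproducts, $E$ distributive) is the monad on $\mathcal{G}V$ with $\Gamma E(X)_0=X_0$ and $\Gamma E(X)(a,b)=\coprod_{a=x_0,\dots,x_n=b}E_iX(x_{i-1},x_i)$ (over all finite sequences of objects from $a$ to $b$), unit and multiplication the identity on objects and induced on homs by $u$ and $\sigma$ on summands (using distributivity to write $(\Gamma E)^2(X)(a,b)$ as the coproduct of the $E_iE_jX(x_{ij-1},x_{ij})$). A monad distributive law of a monad $R$ over a monad $S$ on the same category is a natural transformation $\lambda:SR\to RS$ with $\lambda\circ\eta^SR=R\eta^S$, $\lambda\circ S\eta^R=\eta^RS$, $\lambda\circ\mu^SR=R\mu^S\circ\lambda S\circ S\lambda$, $\lambda\circ S\mu^R=\mu^RS\circ R\lambda\circ\lambda R$. *)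

theory Defs
  imports "HOL-Library.FuncSet"
begin

section \<open>Categories, functors, natural transformations, monads\<close>

record ('o, 'a) category =
  Obj :: "'o set"
  Arr :: "'a set"
  Dom :: "'a \<Rightarrow> 'o"
  Cod :: "'a \<Rightarrow> 'o"
  Ident :: "'o \<Rightarrow> 'a"
  Comp :: "'a \<Rightarrow> 'a \<Rightarrow> 'a"  (infixl "\<cdot>\<index>" 70)

text \<open>Composition is written in diagrammatically reversed order: \<open>g \<cdot>\<^bsub>C\<^esub> f\<close> is ``\<open>g\<close> after \<open>f\<close>''.\<close>

definition hom :: "('o, 'a, 'z) category_scheme \<Rightarrow> 'o \<Rightarrow> 'o \<Rightarrow> 'a set" where
  "hom C a b = {f \<in> Arr C. Dom C f = a \<and> Cod C f = b}"

definition is_category :: "('o, 'a) category \<Rightarrow> bool" where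
  "is_category C \<longleftrightarrow>
     (\<forall>f\<in>Arr C. Dom C f \<in> Obj C \<and> Cod C f \<in> Obj C) \<and>
     (\<forall>a\<in>Obj C. Ident C a \<in> hom C a a) \<and>
     (\<forall>a b c f g. f \<in> hom C a b \<longrightarrow> g \<in> hom C b c \<longrightarrow> g \<cdot>\<^bsub>C\<^esub> f \<in> hom C a c) \<and>
     (\<forall>a b f. f \<in> hom C a b \<longrightarrow> f \<cdot>\<^bsub>C\<^esub> Ident C a = f \<and> Ident C b \<cdot>\<^bsub>C\<^esub> f = f) \<and>
     (\<forall>a b c d f g h. f \<in> hom C a b \<longrightarrow> g \<in> hom C b c \<longrightarrow> h \<in> hom C c d \<longrightarrow>
        (h \<cdot>\<^bsub>C\<^esub> g) \<cdot>\<^bsub>C\<^esub> f = h \<cdot>\<^bsub>C\<^esub> (g \<cdot>\<^bsub>C\<^esub> f))"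

record ('o, 'a, 'p, 'b) cfunctor =
  fobj :: "'o \<Rightarrow> 'p"
  farr :: "'a \<Rightarrow> 'b"

definition is_functor ::
  "('o, 'a) category \<Rightarrow> ('p, 'b) category \<Rightarrow> ('o, 'a, 'p, 'b) cfunctor \<Rightarrow> bool" where
  "is_functor C D F \<longleftrightarrow>
     (\<forall>a\<in>Obj C. fobj F a \<in> Obj D) \<and>
     (\<forall>a b f. f \<in> hom C a b \<longrightarrow> farr F f \<in> hom D (fobj F a) (fobj F b)) \<and>
     (\<forall>a\<in>Obj C. farr F (Ident C a) = Ident D (fobj F a)) \<and>
     (\<forall>a b c f g. f \<in> hom C a b \<longrightarrow> g \<in> hom C b c \<longrightarrow>
        farr F (g \<cdot>\<^bsub>C\<^esub> f) = farr F g \<cdot>\<^bsub>D\<^esub> farr F f)"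

text \<open>Functors are not required to be extensional; equality of functors with domain \<open>C\<close>
  is agreement on the objects and arrows of \<open>C\<close>.\<close>

definition functors_agree ::
  "('o, 'a) category \<Rightarrow> ('o, 'a, 'p, 'b) cfunctor \<Rightarrow> ('o, 'a, 'p, 'b) cfunctor \<Rightarrow> bool" where
  "functors_agree C F G \<longleftrightarrow>
     (\<forall>a\<in>Obj C. fobj F a = fobj G a) \<and> (\<forall>f\<in>Arr C. farr F f = farr G f)"

definition id_functor :: "('o, 'a, 'o, 'a) cfunctor" where
  "id_functor = \<lparr>fobj = (\<lambda>a. a), farr = (\<lambda>f. f)\<rparr>"

definition fcomp ::
  "('p, 'b, 'q, 'c) cfunctor \<Rightarrow> ('o, 'a, 'p, 'b) cfunctor \<Rightarrow> ('o, 'a, 'q, 'c) cfunctor"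
  (infixr "\<circ>\<circ>" 75) where
  "G \<circ>\<circ> F = \<lparr>fobj = (\<lambda>a. fobj G (fobj F a)), farr = (\<lambda>f. farr G (farr F f))\<rparr>"

definition is_iso_functor ::
  "('o, 'a) category \<Rightarrow> ('p, 'b) category \<Rightarrow> ('o, 'a, 'p, 'b) cfunctor \<Rightarrow> bool" where
  "is_iso_functor C D F \<longleftrightarrow> is_functor C D F \<and>
     bij_betw (fobj F) (Obj C) (Obj D) \<and> bij_betw (farr F) (Arr C) (Arr D)"

definition is_natural ::
  "('o, 'a) category \<Rightarrow> ('p, 'b) category \<Rightarrow> ('o, 'a, 'p, 'b) cfunctor \<Rightarrow>
     ('o, 'a, 'p, 'b) cfunctor \<Rightarrow> ('o \<Rightarrow> 'b) \<Rightarrow> bool" where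
  "is_natural C D F G \<alpha> \<longleftrightarrow>
     (\<forall>a\<in>Obj C. \<alpha> a \<in> hom D (fobj F a) (fobj G a)) \<and>
     (\<forall>a b f. f \<in> hom C a b \<longrightarrow> \<alpha> b \<cdot>\<^bsub>D\<^esub> farr F f = farr G f \<cdot>\<^bsub>D\<^esub> \<alpha> a)"

record ('o, 'a) monad =
  mfun :: "('o, 'a, 'o, 'a) cfunctor"
  munit :: "'o \<Rightarrow> 'a"
  mmult :: "'o \<Rightarrow> 'a"

definition is_monad :: "('o, 'a) category \<Rightarrow> ('o, 'a) monad \<Rightarrow> bool" where
  "is_monad C T \<longleftrightarrow>
     is_functor C C (mfun T) \<and>
     is_natural C C id_functor (mfun T) (munit T) \<and>
     is_natural C C (mfun T \<circ>\<circ> mfun T) (mfun T) (mmult T) \<and>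
     (\<forall>X\<in>Obj C.
        mmult T X \<cdot>\<^bsub>C\<^esub> munit T (fobj (mfun T) X) = Ident C (fobj (mfun T) X) \<and>
        mmult T X \<cdot>\<^bsub>C\<^esub> farr (mfun T) (munit T X) = Ident C (fobj (mfun T) X) \<and>
        mmult T X \<cdot>\<^bsub>C\<^esub> mmult T (fobj (mfun T) X) = mmult T X \<cdot>\<^bsub>C\<^esub> farr (mfun T) (mmult T X))"

definition is_monad_map ::
  "('o, 'a) category \<Rightarrow> ('o, 'a) monad \<Rightarrow> ('o, 'a) monad \<Rightarrow> ('o \<Rightarrow> 'a) \<Rightarrow> bool" where
  "is_monad_map C S R \<theta> \<longleftrightarrow>
     is_natural C C (mfun S) (mfun R) \<theta> \<and>
     (\<forall>X\<in>Obj C.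
        \<theta> X \<cdot>\<^bsub>C\<^esub> munit S X = munit R X \<and>
        \<theta> X \<cdot>\<^bsub>C\<^esub> mmult S X = mmult R X \<cdot>\<^bsub>C\<^esub> (\<theta> (fobj (mfun R) X) \<cdot>\<^bsub>C\<^esub> farr (mfun S) (\<theta> X)))"

text \<open>A distributive law of \<open>R\<close> over \<open>S\<close> is a transformation \<open>SR \<rightarrow> RS\<close>.\<close>

definition is_distributive_law ::
  "('o, 'a) category \<Rightarrow> ('o, 'a) monad \<Rightarrow> ('o, 'a) monad \<Rightarrow> ('o \<Rightarrow> 'a) \<Rightarrow> bool" where
  "is_distributive_law C R S l \<longleftrightarrow>
     is_natural C C (mfun S \<circ>\<circ> mfun R) (mfun R \<circ>\<circ> mfun S) l \<and>
     (\<forall>X\<in>Obj C.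
        l X \<cdot>\<^bsub>C\<^esub> munit S (fobj (mfun R) X) = farr (mfun R) (munit S X) \<and>
        l X \<cdot>\<^bsub>C\<^esub> farr (mfun S) (munit R X) = munit R (fobj (mfun S) X) \<and>
        l X \<cdot>\<^bsub>C\<^esub> mmult S (fobj (mfun R) X) =
          farr (mfun R) (mmult S X) \<cdot>\<^bsub>C\<^esub> l (fobj (mfun S) X) \<cdot>\<^bsub>C\<^esub> farr (mfun S) (l X) \<and>
        l X \<cdot>\<^bsub>C\<^esub> farr (mfun S) (mmult R X) =
          mmult R (fobj (mfun S) X) \<cdot>\<^bsub>C\<^esub> farr (mfun R) (l X) \<cdot>\<^bsub>C\<^esub> l (fobj (mfun R) X))"


section \<open>Algebras of a monad\<close>

definition algebras :: "('o, 'a) category \<Rightarrow> ('o, 'a) monad \<Rightarrow> ('o \<times> 'a) set" where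
  "algebras C T = {(X, x). X \<in> Obj C \<and> x \<in> hom C (fobj (mfun T) X) X \<and>
     x \<cdot>\<^bsub>C\<^esub> munit T X = Ident C X \<and>
     x \<cdot>\<^bsub>C\<^esub> mmult T X = x \<cdot>\<^bsub>C\<^esub> farr (mfun T) x}"

type_synonym ('o, 'a) alg_map = "('o \<times> 'a) \<times> 'a \<times> ('o \<times> 'a)"

text \<open>An algebra map is a triple (source, underlying arrow, target).\<close>

definition alg_cat ::
  "('o, 'a) category \<Rightarrow> ('o, 'a) monad \<Rightarrow> ('o \<times> 'a, ('o, 'a) alg_map) category" where
  "alg_cat C T = \<lparr>
     Obj = algebras C T,
     Arr = {((X, x), f, (Y, y)). (X, x) \<in> algebras C T \<and> (Y, y) \<in> algebras C T \<and>
              f \<in> hom C X Y \<and> f \<cdot>\<^bsub>C\<^esub> x = y \<cdot>\<^bsub>C\<^esub> farr (mfun T) f},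
     Dom = (\<lambda>(A, f, B). A),
     Cod = (\<lambda>(A, f, B). B),
     Ident = (\<lambda>A. (A, Ident C (fst A), A)),
     Comp = (\<lambda>(B', g, D) (A, f, B). (A, g \<cdot>\<^bsub>C\<^esub> f, D))\<rparr>"

definition alg_forget :: "('o \<times> 'a, ('o, 'a) alg_map, 'o, 'a) cfunctor" where
  "alg_forget = \<lparr>fobj = fst, farr = (\<lambda>(A, f, B). f)\<rparr>"


section \<open>Finite sequences and multitensors\<close>

text \<open>The category \<open>MC\<close> of finite sequences in \<open>C\<close>: there are arrows only between sequences
  of equal length.\<close>

definition seq_cat :: "('o, 'a) category \<Rightarrow> ('o list, 'a list) category" where
  "seq_cat C = \<lparr>Obj = lists (Obj C), Arr = lists (Arr C), Dom = map (Dom C), Cod = map (Cod C),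
     Ident = map (Ident C), Comp = map2 (Comp C)\<rparr>"

definition seq_functor ::
  "('o, 'a, 'p, 'b) cfunctor \<Rightarrow> ('o list, 'a list, 'p list, 'b list) cfunctor" where
  "seq_functor F = \<lparr>fobj = map (fobj F), farr = map (farr F)\<rparr>"

definition singleton_functor :: "('o, 'a, 'o list, 'a list) cfunctor" where
  "singleton_functor = \<lparr>fobj = (\<lambda>X. [X]), farr = (\<lambda>f. [f])\<rparr>"

definition concat_functor :: "('o list list, 'a list list, 'o list, 'a list) cfunctor" where
  "concat_functor = \<lparr>fobj = concat, farr = concat\<rparr>"

record ('o, 'a) multitensor =
  tensor :: "('o list, 'a list, 'o, 'a) cfunctor"
  tunit :: "'o \<Rightarrow> 'a"
  tsubst :: "'o list list \<Rightarrow> 'a"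

definition is_multitensor :: "('o, 'a) category \<Rightarrow> ('o, 'a) multitensor \<Rightarrow> bool" where
  "is_multitensor C E \<longleftrightarrow>
     is_functor (seq_cat C) C (tensor E) \<and>
     is_natural C C id_functor (tensor E \<circ>\<circ> singleton_functor) (tunit E) \<and>
     is_natural (seq_cat (seq_cat C)) C
       (tensor E \<circ>\<circ> seq_functor (tensor E)) (tensor E \<circ>\<circ> concat_functor) (tsubst E) \<and>
     (\<forall>Xs\<in>lists (Obj C).
        tsubst E [Xs] \<cdot>\<^bsub>C\<^esub> tunit E (fobj (tensor E) Xs) = Ident C (fobj (tensor E) Xs) \<and>
        tsubst E (map (\<lambda>X. [X]) Xs) \<cdot>\<^bsub>C\<^esub> farr (tensor E) (map (tunit E) Xs) =
          Ident C (fobj (tensor E) Xs)) \<and>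
     (\<forall>Xsss\<in>lists (lists (lists (Obj C))).
        tsubst E (map concat Xsss) \<cdot>\<^bsub>C\<^esub> farr (tensor E) (map (tsubst E) Xsss) =
        tsubst E (concat Xsss) \<cdot>\<^bsub>C\<^esub> tsubst E (map (map (fobj (tensor E))) Xsss))"

definition is_multitensor_map ::
  "('o, 'a) category \<Rightarrow> ('o, 'a) multitensor \<Rightarrow> ('o, 'a) multitensor \<Rightarrow>
     ('o list \<Rightarrow> 'a) \<Rightarrow> bool" where
  "is_multitensor_map C E F \<theta> \<longleftrightarrow>
     is_natural (seq_cat C) C (tensor E) (tensor F) \<theta> \<and>
     (\<forall>X\<in>Obj C. \<theta> [X] \<cdot>\<^bsub>C\<^esub> tunit E X = tunit F X) \<and>
     (\<forall>Xss\<in>lists (lists (Obj C)).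
        \<theta> (concat Xss) \<cdot>\<^bsub>C\<^esub> tsubst E Xss =
        tsubst F Xss \<cdot>\<^bsub>C\<^esub>
          (\<theta> (map (fobj (tensor F)) Xss) \<cdot>\<^bsub>C\<^esub> farr (tensor E) (map \<theta> Xss)))"

definition unary_monad :: "('o, 'a) multitensor \<Rightarrow> ('o, 'a) monad" where
  "unary_monad E = \<lparr>mfun = tensor E \<circ>\<circ> singleton_functor, munit = tunit E,
     mmult = (\<lambda>X. tsubst E [[X]])\<rparr>"


section \<open>Opmonoidal structures, substitutions and liftings\<close>

text \<open>Families of arrows that form a set of data are required to be extensional, so that two
  of them are equal iff all their components are.\<close>

definition opmonoidal_structures ::
  "('o, 'a) category \<Rightarrow> ('o, 'a) multitensor \<Rightarrow> ('o, 'a) monad \<Rightarrow> ('o list \<Rightarrow> 'a) set" where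
  "opmonoidal_structures C E T = {\<tau> \<in> extensional (lists (Obj C)).
     is_natural (seq_cat C) C
       (mfun T \<circ>\<circ> tensor E) (tensor E \<circ>\<circ> seq_functor (mfun T)) \<tau> \<and>
     (\<forall>X\<in>Obj C. \<tau> [X] \<cdot>\<^bsub>C\<^esub> farr (mfun T) (tunit E X) = tunit E (fobj (mfun T) X)) \<and>
     (\<forall>Xss\<in>lists (lists (Obj C)).
        \<tau> (concat Xss) \<cdot>\<^bsub>C\<^esub> farr (mfun T) (tsubst E Xss) =
        tsubst E (map (map (fobj (mfun T))) Xss) \<cdot>\<^bsub>C\<^esub>
          farr (tensor E) (map \<tau> Xss) \<cdot>\<^bsub>C\<^esub> \<tau> (map (fobj (tensor E)) Xss)) \<and>
     (\<forall>Xs\<in>lists (Obj C).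
        \<tau> Xs \<cdot>\<^bsub>C\<^esub> munit T (fobj (tensor E) Xs) = farr (tensor E) (map (munit T) Xs)) \<and>
     (\<forall>Xs\<in>lists (Obj C).
        \<tau> Xs \<cdot>\<^bsub>C\<^esub> mmult T (fobj (tensor E) Xs) =
        farr (tensor E) (map (mmult T) Xs) \<cdot>\<^bsub>C\<^esub>
          \<tau> (map (fobj (mfun T)) Xs) \<cdot>\<^bsub>C\<^esub> farr (mfun T) (\<tau> Xs))}"

text \<open>The multitensor \<open>(EM(T), u', \<sigma>')\<close> with \<open>u'\<^sub>X = u\<^sub>T\<^sub>X \<eta>\<^sub>X\<close>.\<close>

definition EM_multitensor ::
  "('o, 'a) category \<Rightarrow> ('o, 'a) multitensor \<Rightarrow> ('o, 'a) monad \<Rightarrow> ('o list list \<Rightarrow> 'a) \<Rightarrow>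
     ('o, 'a) multitensor" where
  "EM_multitensor C E T s = \<lparr>
     tensor = tensor E \<circ>\<circ> seq_functor (mfun T),
     tunit = (\<lambda>X. tunit E (fobj (mfun T) X) \<cdot>\<^bsub>C\<^esub> munit T X),
     tsubst = s\<rparr>"

definition EM_substitutions ::
  "('o, 'a) category \<Rightarrow> ('o, 'a) multitensor \<Rightarrow> ('o, 'a) monad \<Rightarrow> ('o list list \<Rightarrow> 'a) set" where
  "EM_substitutions C E T = {s \<in> extensional (lists (lists (Obj C))).
     is_multitensor C (EM_multitensor C E T s) \<and>
     is_multitensor_map C E (EM_multitensor C E T s)
       (\<lambda>Xs. farr (tensor E) (map (munit T) Xs)) \<and>
     is_monad_map C T (unary_monad (EM_multitensor C E T s))
       (\<lambda>X. tunit E (fobj (mfun T) X)) \<and>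
     (\<forall>Xs\<in>lists (Obj C).
        s (map (\<lambda>X. [X]) Xs) \<cdot>\<^bsub>C\<^esub>
          farr (tensor E)
            (map (\<lambda>X. munit T (fobj (tensor E) [fobj (mfun T) X]) \<cdot>\<^bsub>C\<^esub>
                       tunit E (fobj (mfun T) X)) Xs) =
        Ident C (fobj (tensor E) (map (fobj (mfun T)) Xs)))}"

definition liftings ::
  "('o, 'a) category \<Rightarrow> ('o, 'a) multitensor \<Rightarrow> ('o, 'a) monad \<Rightarrow>
     ('o \<times> 'a, ('o, 'a) alg_map) multitensor set" where
  "liftings C E T = {E'.
     is_multitensor (alg_cat C T) E' \<and>
     fobj (tensor E') \<in> extensional (lists (Obj (alg_cat C T))) \<and>
     farr (tensor E') \<in> extensional (lists (Arr (alg_cat C T))) \<and>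
     tunit E' \<in> extensional (Obj (alg_cat C T)) \<and>
     tsubst E' \<in> extensional (lists (lists (Obj (alg_cat C T)))) \<and>
     functors_agree (seq_cat (alg_cat C T))
       (alg_forget \<circ>\<circ> tensor E') (tensor E \<circ>\<circ> seq_functor alg_forget) \<and>
     (\<forall>A\<in>algebras C T. farr alg_forget (tunit E' A) = tunit E (fobj alg_forget A)) \<and>
     (\<forall>Ass\<in>lists (lists (algebras C T)).
        farr alg_forget (tsubst E' Ass) = tsubst E (map (map (fobj alg_forget)) Ass))}"

text \<open>The substitution corresponding to \<open>\<tau>\<close> is the composite
  \<open>E\<^sub>iTE\<^sub>jTX\<^sub>i\<^sub>j \<rightarrow> E\<^sub>iE\<^sub>jTTX\<^sub>i\<^sub>j \<rightarrow> E\<^sub>iE\<^sub>jTX\<^sub>i\<^sub>j \<rightarrow> E\<^sub>i\<^sub>jTX\<^sub>i\<^sub>j\<close> of \<open>\<tau>\<close>, \<open>\<mu>\<close> and \<open>\<sigma>\<close>.\<close>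

definition substitution_of ::
  "('o, 'a) category \<Rightarrow> ('o, 'a) multitensor \<Rightarrow> ('o, 'a) monad \<Rightarrow> ('o list \<Rightarrow> 'a) \<Rightarrow>
     'o list list \<Rightarrow> 'a" where
  "substitution_of C E T \<tau> = (\<lambda>Xss\<in>lists (lists (Obj C)).
     tsubst E (map (map (fobj (mfun T))) Xss) \<cdot>\<^bsub>C\<^esub>
       farr (tensor E) (map (\<lambda>Xs. farr (tensor E) (map (mmult T) Xs) \<cdot>\<^bsub>C\<^esub>
                                   \<tau> (map (fobj (mfun T)) Xs)) Xss))"

text \<open>In the lifting corresponding to \<open>\<tau>\<close> the tensor product of algebras \<open>(X\<^sub>i, x\<^sub>i)\<close> has the
  structure map \<open>TE\<^sub>iX\<^sub>i \<rightarrow> E\<^sub>iTX\<^sub>i \<rightarrow> E\<^sub>iX\<^sub>i\<close>.\<close>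

definition lifted_tensor ::
  "('o, 'a) category \<Rightarrow> ('o, 'a) multitensor \<Rightarrow> ('o list \<Rightarrow> 'a) \<Rightarrow> ('o \<times> 'a) list \<Rightarrow>
     'o \<times> 'a" where
  "lifted_tensor C E \<tau> As =
     (fobj (tensor E) (map fst As), farr (tensor E) (map snd As) \<cdot>\<^bsub>C\<^esub> \<tau> (map fst As))"

definition lifting_of ::
  "('o, 'a) category \<Rightarrow> ('o, 'a) multitensor \<Rightarrow> ('o, 'a) monad \<Rightarrow> ('o list \<Rightarrow> 'a) \<Rightarrow>
     ('o \<times> 'a, ('o, 'a) alg_map) multitensor" where
  "lifting_of C E T \<tau> = \<lparr>
     tensor = \<lparr>
       fobj = restrict (lifted_tensor C E \<tau>) (lists (Obj (alg_cat C T))),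
       farr = (\<lambda>fs\<in>lists (Arr (alg_cat C T)).
         (lifted_tensor C E \<tau> (map (Dom (alg_cat C T)) fs),
          farr (tensor E) (map (farr alg_forget) fs),
          lifted_tensor C E \<tau> (map (Cod (alg_cat C T)) fs)))\<rparr>,
     tunit = (\<lambda>A\<in>Obj (alg_cat C T). (A, tunit E (fst A), lifted_tensor C E \<tau> [A])),
     tsubst = (\<lambda>Ass\<in>lists (lists (Obj (alg_cat C T))).
       (lifted_tensor C E \<tau> (map (lifted_tensor C E \<tau>) Ass),
        tsubst E (map (map fst) Ass),
        lifted_tensor C E \<tau> (concat Ass)))\<rparr>"


section \<open>Enriched graphs\<close>

text \<open>Sets of vertices are small sets. Smallness is given by a collection \<open>U\<close> of sets of
  elements of a type \<open>'x\<close>; a set of any type is small if it is in bijection with a member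
  of \<open>U\<close>. Only the following closure properties are needed, and they hold in every
  universe containing the natural numbers.\<close>

definition small :: "'x set set \<Rightarrow> 'i set \<Rightarrow> bool" where
  "small U I \<longleftrightarrow> (\<exists>A\<in>U. \<exists>f. bij_betw f I A)"

definition is_universe :: "'x set set \<Rightarrow> bool" where
  "is_universe U \<longleftrightarrow>
     (\<forall>A. finite A \<longrightarrow> A \<in> U) \<and>
     (\<forall>A\<in>U. \<forall>B. B \<subseteq> A \<longrightarrow> B \<in> U) \<and>
     (\<forall>A\<in>U. small U (lists A))"

record ('x, 'o) graph =
  verts :: "'x set"
  ghom :: "'x \<times> 'x \<Rightarrow> 'o"

definition graphs :: "'x set set \<Rightarrow> ('o, 'a) category \<Rightarrow> ('x, 'o) graph set" where
  "graphs U C = {X. verts X \<in> U \<and> ghom X \<in> verts X \<times> verts X \<rightarrow>\<^sub>E Obj C}"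

record ('x, 'o, 'a) graph_map =
  gdom :: "('x, 'o) graph"
  gcod :: "('x, 'o) graph"
  gver :: "'x \<Rightarrow> 'x"
  garr :: "'x \<times> 'x \<Rightarrow> 'a"

definition graph_maps :: "'x set set \<Rightarrow> ('o, 'a) category \<Rightarrow> ('x, 'o, 'a) graph_map set" where
  "graph_maps U C = {f. gdom f \<in> graphs U C \<and> gcod f \<in> graphs U C \<and>
     gver f \<in> verts (gdom f) \<rightarrow>\<^sub>E verts (gcod f) \<and>
     garr f \<in> (\<Pi>\<^sub>E (a, b)\<in>verts (gdom f) \<times> verts (gdom f).
                 hom C (ghom (gdom f) (a, b)) (ghom (gcod f) (gver f a, gver f b)))}"

definition graph_cat ::
  "'x set set \<Rightarrow> ('o, 'a) category \<Rightarrow> (('x, 'o) graph, ('x, 'o, 'a) graph_map) category" where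
  "graph_cat U C = \<lparr>
     Obj = graphs U C,
     Arr = graph_maps U C,
     Dom = gdom,
     Cod = gcod,
     Ident = (\<lambda>X. \<lparr>gdom = X, gcod = X, gver = (\<lambda>a\<in>verts X. a),
                   garr = (\<lambda>p\<in>verts X \<times> verts X. Ident C (ghom X p))\<rparr>),
     Comp = (\<lambda>g f. \<lparr>gdom = gdom f, gcod = gcod g,
               gver = (\<lambda>a\<in>verts (gdom f). gver g (gver f a)),
               garr = (\<lambda>(a, b)\<in>verts (gdom f) \<times> verts (gdom f).
                         garr g (gver f a, gver f b) \<cdot>\<^bsub>C\<^esub> garr f (a, b))\<rparr>)\<rparr>"

definition graph_fobj ::
  "('o, 'a, 'p, 'b) cfunctor \<Rightarrow> ('x, 'o) graph \<Rightarrow> ('x, 'p) graph" where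
  "graph_fobj H X = \<lparr>verts = verts X, ghom = (\<lambda>p\<in>verts X \<times> verts X. fobj H (ghom X p))\<rparr>"

definition graph_functor ::
  "('o, 'a, 'p, 'b) cfunctor \<Rightarrow>
     (('x, 'o) graph, ('x, 'o, 'a) graph_map, ('x, 'p) graph, ('x, 'p, 'b) graph_map) cfunctor"
  where
  "graph_functor H = \<lparr>
     fobj = graph_fobj H,
     farr = (\<lambda>f. \<lparr>gdom = graph_fobj H (gdom f), gcod = graph_fobj H (gcod f), gver = gver f,
               garr = (\<lambda>p\<in>verts (gdom f) \<times> verts (gdom f). farr H (garr f p))\<rparr>)\<rparr>"

definition graph_nat ::
  "('o, 'a, 'p, 'b) cfunctor \<Rightarrow> ('o, 'a, 'p, 'b) cfunctor \<Rightarrow> ('o \<Rightarrow> 'b) \<Rightarrow>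
     ('x, 'o) graph \<Rightarrow> ('x, 'p, 'b) graph_map" where
  "graph_nat F G \<alpha> X = \<lparr>gdom = graph_fobj F X, gcod = graph_fobj G X, gver = (\<lambda>a\<in>verts X. a),
     garr = (\<lambda>p\<in>verts X \<times> verts X. \<alpha> (ghom X p))\<rparr>"

definition graph_monad ::
  "('o, 'a) monad \<Rightarrow> (('x, 'o) graph, ('x, 'o, 'a) graph_map) monad" where
  "graph_monad T = \<lparr>
     mfun = graph_functor (mfun T),
     munit = graph_nat id_functor (mfun T) (munit T),
     mmult = graph_nat (mfun T \<circ>\<circ> mfun T) (mfun T) (mmult T)\<rparr>"


section \<open>Categories enriched in a multitensor\<close>

text \<open>A sequence \<open>(x\<^sub>0, \<dots>, x\<^sub>n)\<close> with \<open>n \<ge> 0\<close> is a nonempty list; its list of consecutive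
  pairs has length \<open>n\<close>.\<close>

definition paths :: "'x set \<Rightarrow> 'x \<Rightarrow> 'x \<Rightarrow> 'x list set" where
  "paths A a b = {xs. xs \<noteq> [] \<and> set xs \<subseteq> A \<and> hd xs = a \<and> last xs = b}"

definition ends :: "'x list \<Rightarrow> 'x \<times> 'x" where
  "ends xs = (hd xs, last xs)"

definition steps :: "'x list \<Rightarrow> ('x \<times> 'x) list" where
  "steps xs = zip xs (tl xs)"

definition path_homs :: "('x, 'o) graph \<Rightarrow> 'x list \<Rightarrow> 'o list" where
  "path_homs X xs = map (ghom X) (steps xs)"

text \<open>A doubly nested composable sequence consists of an outer sequence \<open>(y\<^sub>0, \<dots>, y\<^sub>m)\<close> and
  sequences \<open>ps\<^sub>i\<close> from \<open>y\<^sub>i\<^sub>-\<^sub>1\<close> to \<open>y\<^sub>i\<close> for \<open>1 \<le> i \<le> m\<close>; it is joined to a single sequence by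
  identifying the shared end points.\<close>

definition nested_paths :: "'x set \<Rightarrow> ('x list \<times> 'x list list) set" where
  "nested_paths A = {(ys, pss). ys \<noteq> [] \<and> set ys \<subseteq> A \<and>
     list_all2 (\<lambda>(a, b) ps. ps \<in> paths A a b) (steps ys) pss}"

definition join :: "'x list \<Rightarrow> 'x list list \<Rightarrow> 'x list" where
  "join ys pss = hd ys # concat (map tl pss)"

type_synonym ('x, 'o, 'a) ecat = "('x, 'o) graph \<times> ('x list \<Rightarrow> 'a)"

definition ecategories ::
  "'x set set \<Rightarrow> ('o, 'a) category \<Rightarrow> ('o, 'a) multitensor \<Rightarrow> ('x, 'o, 'a) ecat set" where
  "ecategories U C E = {(X, k). X \<in> graphs U C \<and>
     k \<in> (\<Pi>\<^sub>E xs\<in>lists (verts X) - {[]}.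
            hom C (fobj (tensor E) (path_homs X xs)) (ghom X (ends xs))) \<and>
     (\<forall>x\<in>verts X. \<forall>y\<in>verts X.
        k [x, y] \<cdot>\<^bsub>C\<^esub> tunit E (ghom X (x, y)) = Ident C (ghom X (x, y))) \<and>
     (\<forall>(ys, pss)\<in>nested_paths (verts X).
        k (join ys pss) \<cdot>\<^bsub>C\<^esub> tsubst E (map (path_homs X) pss) =
        k ys \<cdot>\<^bsub>C\<^esub> farr (tensor E) (map k pss))}"

definition efunctors ::
  "'x set set \<Rightarrow> ('o, 'a) category \<Rightarrow> ('o, 'a) multitensor \<Rightarrow>
     (('x, 'o, 'a) ecat \<times> ('x, 'o, 'a) graph_map \<times> ('x, 'o, 'a) ecat) set" where
  "efunctors U C E = {((X, k), f, (Y, l)).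
     (X, k) \<in> ecategories U C E \<and> (Y, l) \<in> ecategories U C E \<and>
     f \<in> graph_maps U C \<and> gdom f = X \<and> gcod f = Y \<and>
     (\<forall>xs\<in>lists (verts X) - {[]}.
        garr f (ends xs) \<cdot>\<^bsub>C\<^esub> k xs =
        l (map (gver f) xs) \<cdot>\<^bsub>C\<^esub> farr (tensor E) (map (garr f) (steps xs)))}"

definition ecat_cat ::
  "'x set set \<Rightarrow> ('o, 'a) category \<Rightarrow> ('o, 'a) multitensor \<Rightarrow>
     (('x, 'o, 'a) ecat,
      ('x, 'o, 'a) ecat \<times> ('x, 'o, 'a) graph_map \<times> ('x, 'o, 'a) ecat) category" where
  "ecat_cat U C E = \<lparr>
     Obj = ecategories U C E,
     Arr = efunctors U C E,
     Dom = (\<lambda>(A, f, B). A),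
     Cod = (\<lambda>(A, f, B). B),
     Ident = (\<lambda>A. (A, Ident (graph_cat U C) (fst A), A)),
     Comp = (\<lambda>(B', g, D) (A, f, B). (A, g \<cdot>\<^bsub>graph_cat U C\<^esub> f, D))\<rparr>"

definition ecat_forget ::
  "(('x, 'o, 'a) ecat, ('x, 'o, 'a) ecat \<times> ('x, 'o, 'a) graph_map \<times> ('x, 'o, 'a) ecat,
    ('x, 'o) graph, ('x, 'o, 'a) graph_map) cfunctor" where
  "ecat_forget = \<lparr>fobj = fst, farr = (\<lambda>(A, f, B). f)\<rparr>"


section \<open>Coproducts and the monad \<open>\<Gamma>E\<close>\<close>

definition is_coproduct ::
  "('o, 'a) category \<Rightarrow> 'i set \<Rightarrow> ('i \<Rightarrow> 'o) \<Rightarrow> 'o \<Rightarrow> ('i \<Rightarrow> 'a) \<Rightarrow> bool" where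
  "is_coproduct C I X c \<iota> \<longleftrightarrow>
     c \<in> Obj C \<and> (\<forall>i\<in>I. X i \<in> Obj C \<and> \<iota> i \<in> hom C (X i) c) \<and>
     (\<forall>d\<in>Obj C. \<forall>g. (\<forall>i\<in>I. g i \<in> hom C (X i) d) \<longrightarrow>
        (\<exists>!h. h \<in> hom C c d \<and> (\<forall>i\<in>I. h \<cdot>\<^bsub>C\<^esub> \<iota> i = g i)))"

text \<open>Index sets are taken in \<open>'x list\<close>, where the sequences of vertices live. Every small set
  is in bijection with a small set of this type.\<close>

definition has_small_coproducts :: "'x set set \<Rightarrow> ('o, 'a) category \<Rightarrow> bool" where
  "has_small_coproducts U C \<longleftrightarrow>
     (\<forall>(I :: 'x list set) X. small U I \<longrightarrow> (\<forall>i\<in>I. X i \<in> Obj C) \<longrightarrow>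
        (\<exists>c \<iota>. is_coproduct C I X c \<iota>))"

definition preserves_small_coproducts ::
  "'x set set \<Rightarrow> ('o, 'a) category \<Rightarrow> ('p, 'b) category \<Rightarrow> ('o, 'a, 'p, 'b) cfunctor \<Rightarrow> bool"
  where
  "preserves_small_coproducts U C D F \<longleftrightarrow>
     (\<forall>(I :: 'x list set) X c \<iota>. small U I \<longrightarrow> is_coproduct C I X c \<iota> \<longrightarrow>
        is_coproduct D I (\<lambda>i. fobj F (X i)) (fobj F c) (\<lambda>i. farr F (\<iota> i)))"

definition slot_functor ::
  "('o, 'a) category \<Rightarrow> ('o, 'a) multitensor \<Rightarrow> 'o list \<Rightarrow> 'o list \<Rightarrow> ('o, 'a, 'o, 'a) cfunctor"
  where
  "slot_functor C E Ys Zs = \<lparr>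
     fobj = (\<lambda>X. fobj (tensor E) (Ys @ [X] @ Zs)),
     farr = (\<lambda>f. farr (tensor E) (map (Ident C) Ys @ [f] @ map (Ident C) Zs))\<rparr>"

definition is_distributive ::
  "'x set set \<Rightarrow> ('o, 'a) category \<Rightarrow> ('o, 'a) multitensor \<Rightarrow> bool" where
  "is_distributive U C E \<longleftrightarrow>
     (\<forall>Ys\<in>lists (Obj C). \<forall>Zs\<in>lists (Obj C).
        preserves_small_coproducts U C C (slot_functor C E Ys Zs))"

definition chosen_coproduct ::
  "('o, 'a) category \<Rightarrow> 'i set \<Rightarrow> ('i \<Rightarrow> 'o) \<Rightarrow> 'o \<times> ('i \<Rightarrow> 'a)" where
  "chosen_coproduct C I X = (SOME (c, \<iota>). is_coproduct C I X c \<iota>)"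

definition Gamma_coproduct ::
  "('o, 'a) category \<Rightarrow> ('o, 'a) multitensor \<Rightarrow> ('x, 'o) graph \<Rightarrow> 'x \<times> 'x \<Rightarrow>
     'o \<times> ('x list \<Rightarrow> 'a)" where
  "Gamma_coproduct C E X = (\<lambda>(a, b).
     chosen_coproduct C (paths (verts X) a b) (\<lambda>xs. fobj (tensor E) (path_homs X xs)))"

definition Gamma_fobj ::
  "('o, 'a) category \<Rightarrow> ('o, 'a) multitensor \<Rightarrow> ('x, 'o) graph \<Rightarrow> ('x, 'o) graph" where
  "Gamma_fobj C E X = \<lparr>verts = verts X,
     ghom = (\<lambda>p\<in>verts X \<times> verts X. fst (Gamma_coproduct C E X p))\<rparr>"

text \<open>The coproduct injection of the summand indexed by the sequence \<open>xs\<close>.\<close>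

definition Gamma_inj ::
  "('o, 'a) category \<Rightarrow> ('o, 'a) multitensor \<Rightarrow> ('x, 'o) graph \<Rightarrow> 'x list \<Rightarrow> 'a" where
  "Gamma_inj C E X xs = snd (Gamma_coproduct C E X (ends xs)) xs"

definition Gamma_farr ::
  "('o, 'a) category \<Rightarrow> ('o, 'a) multitensor \<Rightarrow> ('x, 'o, 'a) graph_map \<Rightarrow>
     ('x, 'o, 'a) graph_map" where
  "Gamma_farr C E f = \<lparr>
     gdom = Gamma_fobj C E (gdom f),
     gcod = Gamma_fobj C E (gcod f),
     gver = gver f,
     garr = (\<lambda>(a, b)\<in>verts (gdom f) \<times> verts (gdom f).
       THE h. h \<in> hom C (ghom (Gamma_fobj C E (gdom f)) (a, b))
                        (ghom (Gamma_fobj C E (gcod f)) (gver f a, gver f b)) \<and>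
         (\<forall>xs\<in>paths (verts (gdom f)) a b.
            h \<cdot>\<^bsub>C\<^esub> Gamma_inj C E (gdom f) xs =
            Gamma_inj C E (gcod f) (map (gver f) xs) \<cdot>\<^bsub>C\<^esub>
              farr (tensor E) (map (garr f) (steps xs))))\<rparr>"

definition Gamma_unit ::
  "('o, 'a) category \<Rightarrow> ('o, 'a) multitensor \<Rightarrow> ('x, 'o) graph \<Rightarrow> ('x, 'o, 'a) graph_map" where
  "Gamma_unit C E X = \<lparr>
     gdom = X,
     gcod = Gamma_fobj C E X,
     gver = (\<lambda>a\<in>verts X. a),
     garr = (\<lambda>(a, b)\<in>verts X \<times> verts X.
       Gamma_inj C E X [a, b] \<cdot>\<^bsub>C\<^esub> tunit E (ghom X (a, b)))\<rparr>"

text \<open>By distributivity \<open>(\<Gamma>E)\<^sup>2(X)(a,b)\<close> is the coproduct of the \<open>E\<^sub>iE\<^sub>jX(x\<^sub>i\<^sub>j\<^sub>-\<^sub>1,x\<^sub>i\<^sub>j)\<close> over the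
  doubly nested sequences from \<open>a\<close> to \<open>b\<close>, with injections the composites of
  \<open>E\<^sub>i\<close> of injections into the inner coproducts with an injection into the outer one.\<close>

definition Gamma_mult ::
  "('o, 'a) category \<Rightarrow> ('o, 'a) multitensor \<Rightarrow> ('x, 'o) graph \<Rightarrow> ('x, 'o, 'a) graph_map" where
  "Gamma_mult C E X = \<lparr>
     gdom = Gamma_fobj C E (Gamma_fobj C E X),
     gcod = Gamma_fobj C E X,
     gver = (\<lambda>a\<in>verts X. a),
     garr = (\<lambda>(a, b)\<in>verts X \<times> verts X.
       THE h. h \<in> hom C (ghom (Gamma_fobj C E (Gamma_fobj C E X)) (a, b))
                        (ghom (Gamma_fobj C E X) (a, b)) \<and>
         (\<forall>(ys, pss)\<in>nested_paths (verts X). ends ys = (a, b) \<longrightarrow>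
            h \<cdot>\<^bsub>C\<^esub> (Gamma_inj C E (Gamma_fobj C E X) ys \<cdot>\<^bsub>C\<^esub>
                    farr (tensor E) (map (Gamma_inj C E X) pss)) =
            Gamma_inj C E X (join ys pss) \<cdot>\<^bsub>C\<^esub> tsubst E (map (path_homs X) pss)))\<rparr>"

definition Gamma_monad ::
  "('o, 'a) category \<Rightarrow> ('o, 'a) multitensor \<Rightarrow>
     (('x, 'o) graph, ('x, 'o, 'a) graph_map) monad" where
  "Gamma_monad C E = \<lparr>
     mfun = \<lparr>fobj = Gamma_fobj C E, farr = Gamma_farr C E\<rparr>,
     munit = Gamma_unit C E,
     mmult = Gamma_mult C E\<rparr>"


section \<open>Distributive laws on enriched graphs\<close>

definition graph_distributive_laws ::
  "'x set set \<Rightarrow> ('o, 'a) category \<Rightarrow> ('o, 'a) multitensor \<Rightarrow> ('o, 'a) monad \<Rightarrow>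
     (('x, 'o) graph \<Rightarrow> ('x, 'o, 'a) graph_map) set" where
  "graph_distributive_laws U C E T = {l \<in> extensional (graphs U C).
     (\<forall>X\<in>graphs U C. \<forall>a\<in>verts X. gver (l X) a = a) \<and>
     is_distributive_law (graph_cat U C) (Gamma_monad C E) (graph_monad T) l}"

text \<open>On the summand indexed by a sequence \<open>xs\<close>, the distributive law corresponding to \<open>\<tau>\<close>
  is \<open>\<tau>\<close> followed by the injection; this determines it as \<open>T\<close> preserves coproducts.\<close>

definition distributive_law_of ::
  "'x set set \<Rightarrow> ('o, 'a) category \<Rightarrow> ('o, 'a) multitensor \<Rightarrow> ('o, 'a) monad \<Rightarrow>
     ('o list \<Rightarrow> 'a) \<Rightarrow> ('x, 'o) graph \<Rightarrow> ('x, 'o, 'a) graph_map" where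
  "distributive_law_of U C E T \<tau> = (\<lambda>X\<in>graphs U C. \<lparr>
     gdom = graph_fobj (mfun T) (Gamma_fobj C E X),
     gcod = Gamma_fobj C E (graph_fobj (mfun T) X),
     gver = (\<lambda>a\<in>verts X. a),
     garr = (\<lambda>(a, b)\<in>verts X \<times> verts X.
       THE h. h \<in> hom C (ghom (graph_fobj (mfun T) (Gamma_fobj C E X)) (a, b))
                        (ghom (Gamma_fobj C E (graph_fobj (mfun T) X)) (a, b)) \<and>
         (\<forall>xs\<in>paths (verts X) a b.
            h \<cdot>\<^bsub>C\<^esub> farr (mfun T) (Gamma_inj C E X xs) =
            Gamma_inj C E (graph_fobj (mfun T) X) xs \<cdot>\<^bsub>C\<^esub> \<tau> (path_homs X xs)))\<rparr>)"

end

theory Submission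
  imports Defs
begin

text \<open>An opmonoidal structure \<open>\<tau>\<close> and a lifting determine each other through the algebra
  structures \<open>c = E\<^sub>i\<mu> \<circ> \<tau>\<close> on the objects \<open>E\<^sub>iTX\<^sub>i\<close>, from which \<open>\<tau> = c \<circ> TE\<^sub>i\<eta>\<close> is recovered: every algebra is
  a quotient of a free one, so \<open>c\<close> determines the structures on all tensor products of algebras.
  A substitution \<open>\<sigma>'\<close> is \<open>\<sigma> \<circ> E\<^sub>ic\<close>, and conversely \<open>c = \<sigma>' \<circ> uTET\<close>, as for the composite monad of a
  distributive law. An \<open>EM(T)\<close>-category with composition \<open>k\<close> has the homs \<open>X(a,b)\<close> as algebras through
  \<open>k \<circ> uT\<close>, and the composition \<open>k \<circ> E\<^sub>i\<eta>\<close> over \<open>E'\<close>; the inverse precomposes with the algebra structures.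
  On graphs, \<open>\<lambda>\<close> restricted to a summand is \<open>\<tau>\<close> followed by an injection. Conversely, \<open>\<tau>\<close> is read off
  from \<open>\<lambda>\<close> at graphs that are initial away from a line, where the injection of the straight path
  is invertible by distributivity.\<close>


section \<open>Composition in categories, monads and multitensors\<close>

text \<open>Both surjectivity proofs lead to the same list of properties of \<open>c\<close>, so
  \<tau> is rebuilt only once, in \<open>free_structures\<close>. For substitutions the obstacle is
  that the hypotheses tie \<sigma> to \<sigma>' only through \<open>E\<eta>\<close>, hence only
  after precomposition with \<eta>. The condition that \<open>E_i \<eta>uT\<close> followed by
  \<sigma>' is the identity removes this: it lets an identity be inserted to the left of \<sigma> or
  of \<open>E\<mu>\<close>, whose \<eta> and u then feed the conditions on the two maps, while
  associativity of \<sigma>' absorbs what was inserted. On graphs, a coproduct injection need not be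
  monic and a path may visit a vertex twice, so \<tau> cannot be read off at an arbitrary path. A
  line avoids both defects, and the graph map from the line on the homs of a path to the given graph
  carries the formula back by naturality of \<lambda>. Lines of every length require infinitely many
  vertices; these come from closure of the universe under lists.\<close>

lemma hom_iff [simp]: "f \<in> hom C a b \<longleftrightarrow> f \<in> Arr C \<and> Dom C f = a \<and> Cod C f = b"
  by (simp add: hom_def)

lemma seq_cat_simps [simp]:
  "Obj (seq_cat C) = lists (Obj C)" "Arr (seq_cat C) = lists (Arr C)"
  "Dom (seq_cat C) fs = map (Dom C) fs" "Cod (seq_cat C) fs = map (Cod C) fs"
  "Ident (seq_cat C) Xs = map (Ident C) Xs" "Comp (seq_cat C) gs fs = map2 (Comp C) gs fs"
  by (simp_all add: seq_cat_def)

lemma functor_simps [simp]: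
  "fobj (G \<circ>\<circ> F) a = fobj G (fobj F a)" "farr (G \<circ>\<circ> F) f = farr G (farr F f)"
  "fobj (seq_functor F) Xs = map (fobj F) Xs" "farr (seq_functor F) fs = map (farr F) fs"
  "fobj singleton_functor X = [X]" "farr singleton_functor f = [f]"
  "fobj concat_functor Xss = concat Xss" "farr concat_functor fss = concat fss"
  "fobj id_functor a = a" "farr id_functor f = f"
  by (simp_all add: fcomp_def seq_functor_def singleton_functor_def concat_functor_def
      id_functor_def)

text \<open>Fusion with a lambda in place of a composite, so that a family keeps the form
  \<open>map (\<lambda>i. ...) is\<close> and its entries can be rewritten knowing that i is in the
  list.\<close>

lemma map_fusion: "map f (map g xs) = map (\<lambda>x. f (g x)) xs"
  by simp

text \<open>Lists of arrows are normalised to families \<open>map f is\<close>; functoriality and naturality are stated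
  for these.\<close>

declare list.map_comp [simp del] map_map [simp del] map_fusion [simp]
declare list.map_cong_simp [cong]

lemma map2_map [simp]: "map2 h (map f xs) (map g xs) = map (\<lambda>x. h (f x) (g x)) xs"
  by (induction xs) auto

lemma map_concat' [simp]: "map f (concat xss) = concat (map (\<lambda>xs. map f xs) xss)"
  by (simp add: map_concat)

lemma concat_singletons [simp]: "concat (map (\<lambda>x. [f x]) xs) = map f xs"
  by (induction xs) auto

section \<open>Categories, monads and multitensors\<close>

locale cat =
  fixes C :: "('o, 'a) category" (structure)
  assumes is_category: "is_category C"
begin

abbreviation "objs Xs \<equiv> \<forall>X\<in>set Xs. X \<in> Obj C"

lemma dom_obj [simp]: "f \<in> Arr C \<Longrightarrow> Dom C f \<in> Obj C"
  and cod_obj [simp]: "f \<in> Arr C \<Longrightarrow> Cod C f \<in> Obj C"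
  using is_category by (auto simp: is_category_def)

lemma ident_simps [simp]:
  assumes "a \<in> Obj C"
  shows "Ident C a \<in> Arr C" "Dom C (Ident C a) = a" "Cod C (Ident C a) = a"
  using is_category assms by (auto simp: is_category_def)

lemma comp_simps [simp]:
  assumes "f \<in> Arr C" "g \<in> Arr C" "Dom C g = Cod C f"
  shows "g \<cdot> f \<in> Arr C" "Dom C (g \<cdot> f) = Dom C f" "Cod C (g \<cdot> f) = Cod C g"
  using is_category assms unfolding is_category_def hom_iff by metis+

lemma ident_left [simp]: "f \<in> Arr C \<Longrightarrow> Cod C f = b \<Longrightarrow> Ident C b \<cdot> f = f"
  and ident_right [simp]: "f \<in> Arr C \<Longrightarrow> Dom C f = a \<Longrightarrow> f \<cdot> Ident C a = f"
  using is_category by (auto simp: is_category_def)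

lemma assoc [simp]:
  assumes "f \<in> Arr C" "g \<in> Arr C" "h \<in> Arr C" "Dom C g = Cod C f" "Dom C h = Cod C g"
  shows "(h \<cdot> g) \<cdot> f = h \<cdot> (g \<cdot> f)"
proof -
  have "\<And>a b c d f g h. f \<in> hom C a b \<longrightarrow> g \<in> hom C b c \<longrightarrow> h \<in> hom C c d \<longrightarrow>
        (h \<cdot> g) \<cdot> f = h \<cdot> (g \<cdot> f)"
    using is_category unfolding is_category_def by blast
  then show ?thesis using assms by simp
qed

text \<open>Composites are kept nested to the right, which hides \<open>g \<cdot> f\<close> inside
  \<open>g \<cdot> (f \<cdot> h)\<close>; this form makes an equation for the pair applicable
  there.\<close>

lemma comp_tail:
  assumes "g \<cdot> f = k" "f \<in> Arr C" "g \<in> Arr C" "Dom C g = Cod C f" "h \<in> Arr C" "Dom C f = Cod C h"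
  shows "g \<cdot> (f \<cdot> h) = k \<cdot> h"
  using assms by (metis assoc)

end

locale monadic = cat C for C :: "('o, 'a) category" (structure) +
  fixes T :: "('o, 'a) monad"
  assumes is_monad: "is_monad C T"
begin

abbreviation "To \<equiv> fobj (mfun T)"
abbreviation "Ta \<equiv> farr (mfun T)"
abbreviation "\<eta> \<equiv> munit T"
abbreviation "\<mu> \<equiv> mmult T"

lemma T_functor: "is_functor C C (mfun T)"
  using is_monad by (simp add: is_monad_def)

lemma To_obj [simp]: "X \<in> Obj C \<Longrightarrow> To X \<in> Obj C"
  using T_functor by (simp add: is_functor_def)

lemma Ta_simps [simp]:
  assumes "f \<in> Arr C"
  shows "Ta f \<in> Arr C" "Dom C (Ta f) = To (Dom C f)" "Cod C (Ta f) = To (Cod C f)"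
  using T_functor assms by (simp_all add: is_functor_def)

lemma Ta_ident [simp]: "X \<in> Obj C \<Longrightarrow> Ta (Ident C X) = Ident C (To X)"
  using T_functor by (simp add: is_functor_def)

lemma Ta_comp [simp]:
  "f \<in> Arr C \<Longrightarrow> g \<in> Arr C \<Longrightarrow> Dom C g = Cod C f \<Longrightarrow> Ta (g \<cdot> f) = Ta g \<cdot> Ta f"
  using T_functor by (simp add: is_functor_def)

lemma unit_simps [simp]:
  assumes "X \<in> Obj C"
  shows "\<eta> X \<in> Arr C" "Dom C (\<eta> X) = X" "Cod C (\<eta> X) = To X"
    "\<mu> X \<in> Arr C" "Dom C (\<mu> X) = To (To X)" "Cod C (\<mu> X) = To X"
  using is_monad assms by (simp_all add: is_monad_def is_natural_def)

lemma \<eta>_nat: "f \<in> Arr C \<Longrightarrow> Dom C f = a \<Longrightarrow> Ta f \<cdot> \<eta> a = \<eta> (Cod C f) \<cdot> f"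
  using is_monad by (simp add: is_monad_def is_natural_def)

lemma \<mu>_nat: "f \<in> Arr C \<Longrightarrow> Dom C f = a \<Longrightarrow> Ta f \<cdot> \<mu> a = \<mu> (Cod C f) \<cdot> Ta (Ta f)"
  using is_monad by (simp add: is_monad_def is_natural_def)

lemma monad_unit_left: "X \<in> Obj C \<Longrightarrow> \<mu> X \<cdot> \<eta> (To X) = Ident C (To X)"
  and monad_unit_right: "X \<in> Obj C \<Longrightarrow> \<mu> X \<cdot> Ta (\<eta> X) = Ident C (To X)"
  and monad_assoc: "X \<in> Obj C \<Longrightarrow> \<mu> X \<cdot> \<mu> (To X) = \<mu> X \<cdot> Ta (\<mu> X)"
  using is_monad by (simp_all add: is_monad_def)

end

locale multi = cat C for C :: "('o, 'a) category" (structure) +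
  fixes E :: "('o, 'a) multitensor"
  assumes is_multitensor: "is_multitensor C E"
begin

abbreviation "Eo \<equiv> fobj (tensor E)"
abbreviation "Ea \<equiv> farr (tensor E)"
abbreviation "u \<equiv> tunit E"
abbreviation "\<sigma> \<equiv> tsubst E"

lemma E_functor: "is_functor (seq_cat C) C (tensor E)"
  using is_multitensor by (simp add: is_multitensor_def)

lemma Eo_obj [simp]: "objs Xs \<Longrightarrow> Eo Xs \<in> Obj C"
  using E_functor by (simp add: is_functor_def in_lists_conv_set)

lemma Ea_simps [simp]:
  assumes "\<forall>f\<in>set fs. f \<in> Arr C"
  shows "Ea fs \<in> Arr C" "Dom C (Ea fs) = Eo (map (Dom C) fs)" "Cod C (Ea fs) = Eo (map (Cod C) fs)"
  using E_functor assms by (simp_all add: is_functor_def in_lists_conv_set)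

lemma Ea_ident [simp]:
  "\<forall>i\<in>set is. X i \<in> Obj C \<Longrightarrow> Ea (map (\<lambda>i. Ident C (X i)) is) = Ident C (Eo (map X is))"
proof -
  assume "\<forall>i\<in>set is. X i \<in> Obj C"
  moreover from this have "Ea (map (Ident C) (map X is)) = Ident C (Eo (map X is))"
    using E_functor by (simp add: is_functor_def in_lists_conv_set del: map_fusion)
  ultimately show ?thesis by simp
qed

text \<open>Used in both directions: to split a family of composites when one factor must be moved,
  and to merge two families when they cancel entry by entry.\<close>

lemma Ea_comp:
  assumes "\<forall>i\<in>set is. f i \<in> Arr C \<and> g i \<in> Arr C \<and> Dom C (g i) = Cod C (f i)"
  shows "Ea (map (\<lambda>i. g i \<cdot> f i) is) = Ea (map g is) \<cdot> Ea (map f is)"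
proof -
  have "\<forall>a b c f g. f \<in> hom (seq_cat C) a b \<longrightarrow> g \<in> hom (seq_cat C) b c \<longrightarrow>
        Ea (map2 (Comp C) g f) = Ea g \<cdot> Ea f"
    using E_functor unfolding is_functor_def seq_cat_simps by blast
  from this[rule_format, of "map f is" "map (\<lambda>i. Dom C (f i)) is" "map (\<lambda>i. Cod C (f i)) is" "map g is"
      "map (\<lambda>i. Cod C (g i)) is"] show ?thesis using assms
    by (simp add: in_lists_conv_set)
qed

lemma u_simps [simp]:
  assumes "X \<in> Obj C"
  shows "u X \<in> Arr C" "Dom C (u X) = X" "Cod C (u X) = Eo [X]"
  using is_multitensor assms by (simp_all add: is_multitensor_def is_natural_def)

lemma u_nat: "f \<in> Arr C \<Longrightarrow> Dom C f = a \<Longrightarrow> Ea [f] \<cdot> u a = u (Cod C f) \<cdot> f"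
  using is_multitensor by (simp add: is_multitensor_def is_natural_def)

lemma \<sigma>_simps [simp]:
  assumes "\<forall>Xs\<in>set Xss. objs Xs"
  shows "\<sigma> Xss \<in> Arr C" "Dom C (\<sigma> Xss) = Eo (map Eo Xss)" "Cod C (\<sigma> Xss) = Eo (concat Xss)"
  using is_multitensor assms by (simp_all add: is_multitensor_def is_natural_def in_lists_conv_set)

text \<open>Sources and targets are separate families \<open>a\<close> and \<open>b\<close>, so that
  an instance such as \<open>f = \<eta>\<close> gives both sides directly in terms of
  objects.\<close>

lemma \<sigma>_nat:
  assumes "\<forall>is\<in>set iss. \<forall>i\<in>set is. f i \<in> Arr C \<and> Dom C (f i) = a i \<and> Cod C (f i) = b i"
  shows "Ea (concat (map (map f) iss)) \<cdot> \<sigma> (map (map a) iss) =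
    \<sigma> (map (map b) iss) \<cdot> Ea (map (\<lambda>is. Ea (map f is)) iss)"
proof -
  have "\<forall>f a b. f \<in> hom (seq_cat (seq_cat C)) a b \<longrightarrow>
        \<sigma> b \<cdot> Ea (map Ea f) = Ea (concat f) \<cdot> \<sigma> a"
    using is_multitensor by (simp add: is_multitensor_def is_natural_def del: hom_iff)
  from this[rule_format, of "map (map f) iss"] show ?thesis using assms
    by (simp add: in_lists_conv_set)
qed

lemma mult_unit_left:
    "objs Xs \<Longrightarrow> \<sigma> [Xs] \<cdot> u (Eo Xs) = Ident C (Eo Xs)"
  and mult_unit_right:
    "objs Xs \<Longrightarrow> \<sigma> (map (\<lambda>X. [X]) Xs) \<cdot> Ea (map u Xs) = Ident C (Eo Xs)"
  and mult_assoc: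
    "\<forall>Xss\<in>set Xsss. \<forall>Xs\<in>set Xss. objs Xs \<Longrightarrow>
      \<sigma> (map concat Xsss) \<cdot> Ea (map \<sigma> Xsss) = \<sigma> (concat Xsss) \<cdot> \<sigma> (map (map Eo) Xsss)"
  using is_multitensor by (simp_all add: is_multitensor_def in_lists_conv_set)

end

locale setting = monadic C T + multi C E
  for C :: "('o, 'a) category" (structure) and T E

section \<open>The tensor product of algebras\<close>

text \<open>Composability in the category of sequences equates a list of codomains with a list of
  domains; the two lists of arrows then become one family of composable pairs.\<close>

lemma list_pair:
  assumes "map f xs = map g ys"
  obtains ps where "xs = map fst ps" "ys = map snd ps"
proof
  have "length xs = length ys" using assms by (metis length_map)
  then show "xs = map fst (zip xs ys)" "ys = map snd (zip xs ys)" by simp_all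
qed

lemma alg_cat_simps [simp]:
  "Obj (alg_cat C T) = algebras C T" "Dom (alg_cat C T) = fst"
  "Cod (alg_cat C T) = (\<lambda>p. snd (snd p))"
  "Ident (alg_cat C T) A = (A, Ident C (fst A), A)"
  "Comp (alg_cat C T) q p = (fst p, Comp C (fst (snd q)) (fst (snd p)), snd (snd q))"
  by (auto simp: alg_cat_def split: prod.split)

lemma alg_arr_iff: "p \<in> Arr (alg_cat C T) \<longleftrightarrow> fst p \<in> algebras C T \<and> snd (snd p) \<in> algebras C T \<and>
    fst (snd p) \<in> Arr C \<and> Dom C (fst (snd p)) = fst (fst p) \<and>
    Cod C (fst (snd p)) = fst (snd (snd p)) \<and>
    Comp C (fst (snd p)) (snd (fst p)) = Comp C (snd (snd (snd p))) (farr (mfun T) (fst (snd p)))"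
  by (cases p) (auto simp: alg_cat_def)

lemma alg_forget_simps [simp]:
  "fobj alg_forget = fst" "farr alg_forget p = fst (snd p)"
  by (auto simp: alg_forget_def split: prod.split)

context monadic
begin

lemma alg_simps [simp]:
  assumes "A \<in> algebras C T"
  shows "fst A \<in> Obj C" "snd A \<in> Arr C" "Dom C (snd A) = To (fst A)" "Cod C (snd A) = fst A"
  using assms by (auto simp: algebras_def)

lemma alg_unit: "A \<in> algebras C T \<Longrightarrow> snd A \<cdot> \<eta> (fst A) = Ident C (fst A)"
  and alg_mult: "A \<in> algebras C T \<Longrightarrow> snd A \<cdot> \<mu> (fst A) = snd A \<cdot> Ta (snd A)"
  by (auto simp: algebras_def)

lemma alg_arrD [simp]:
  assumes "p \<in> Arr (alg_cat C T)"
  shows "fst p \<in> algebras C T" "snd (snd p) \<in> algebras C T" "fst (snd p) \<in> Arr C"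
    "Dom C (fst (snd p)) = fst (fst p)" "Cod C (fst (snd p)) = fst (snd (snd p))"
  using assms unfolding alg_arr_iff by blast+

lemma alg_arr_comm: "p \<in> Arr (alg_cat C T) \<Longrightarrow>
    fst (snd p) \<cdot> snd (fst p) = snd (snd (snd p)) \<cdot> Ta (fst (snd p))"
  unfolding alg_arr_iff by blast

lemma alg_arrI:
  assumes "A \<in> algebras C T" "B \<in> algebras C T" "f \<in> Arr C" "Dom C f = fst A" "Cod C f = fst B"
    "f \<cdot> snd A = snd B \<cdot> Ta f"
  shows "(A, f, B) \<in> Arr (alg_cat C T)"
  using assms by (simp add: alg_arr_iff)

lemma free_algebra: "X \<in> Obj C \<Longrightarrow> (To X, \<mu> X) \<in> algebras C T"
  by (auto simp: algebras_def monad_unit_left monad_assoc)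

lemma alg_comp_arr:
  assumes "p \<in> Arr (alg_cat C T)" "q \<in> Arr (alg_cat C T)" "fst q = snd (snd p)"
  shows "(fst p, fst (snd q) \<cdot> fst (snd p), snd (snd q)) \<in> Arr (alg_cat C T)"
proof -
  let ?f = "fst (snd p)" and ?g = "fst (snd q)"
  have "(?g \<cdot> ?f) \<cdot> snd (fst p) = ?g \<cdot> (?f \<cdot> snd (fst p))" using assms by simp
  also have "\<dots> = (?g \<cdot> snd (fst q)) \<cdot> Ta ?f"
    unfolding alg_arr_comm[OF assms(1)] using assms by (simp del: alg_arr_comm)
  also have "\<dots> = snd (snd (snd q)) \<cdot> Ta (?g \<cdot> ?f)"
    unfolding alg_arr_comm[OF assms(2)] using assms by simp
  finally show ?thesis using assms by (intro alg_arrI) simp_all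
qed

lemma alg_ident_arr: "A \<in> algebras C T \<Longrightarrow> (A, Ident C (fst A), A) \<in> Arr (alg_cat C T)"
  by (intro alg_arrI) simp_all

lemma alg_is_category: "is_category (alg_cat C T)"
  unfolding is_category_def
  by (intro conjI allI impI ballI) (simp_all add: alg_comp_arr alg_ident_arr)

end

sublocale monadic \<subseteq> alg: cat "alg_cat C T"
  by unfold_locales (rule alg_is_category)


section \<open>Algebra structures induced by an opmonoidal structure\<close>

locale opmon = setting C T E for C :: "('o, 'a) category" (structure) and T E +
  fixes \<tau> :: "'o list \<Rightarrow> 'a"
  assumes opmonoidal: "\<tau> \<in> opmonoidal_structures C E T"
begin

lemma \<tau>_simps [simp]:
  assumes "objs Xs"
  shows "\<tau> Xs \<in> Arr C" "Dom C (\<tau> Xs) = To (Eo Xs)" "Cod C (\<tau> Xs) = Eo (map To Xs)"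
  using opmonoidal assms
  by (simp_all add: opmonoidal_structures_def is_natural_def in_lists_conv_set)

lemma \<tau>_nat:
  assumes "\<forall>i\<in>set is. f i \<in> Arr C \<and> Dom C (f i) = a i \<and> Cod C (f i) = b i"
  shows "Ea (map (\<lambda>i. Ta (f i)) is) \<cdot> \<tau> (map a is) = \<tau> (map b is) \<cdot> Ta (Ea (map f is))"
proof -
  have "\<forall>f a b. f \<in> hom (seq_cat C) a b \<longrightarrow> \<tau> b \<cdot> Ta (Ea f) = Ea (map Ta f) \<cdot> \<tau> a"
    using opmonoidal by (simp add: opmonoidal_structures_def is_natural_def del: hom_iff)
  from this[rule_format, of "map f is"] show ?thesis using assms
    by (simp add: in_lists_conv_set)
qed

lemma \<tau>_u: "X \<in> Obj C \<Longrightarrow> \<tau> [X] \<cdot> Ta (u X) = u (To X)"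
  using opmonoidal by (simp add: opmonoidal_structures_def)

lemma \<tau>_\<sigma>:
  assumes "\<forall>Xs\<in>set Xss. objs Xs"
  shows "\<tau> (concat Xss) \<cdot> Ta (\<sigma> Xss) =
    \<sigma> (map (map To) Xss) \<cdot> (Ea (map \<tau> Xss) \<cdot> \<tau> (map Eo Xss))"
proof -
  have "\<tau> (concat Xss) \<cdot> Ta (\<sigma> Xss) =
    (\<sigma> (map (map To) Xss) \<cdot> Ea (map \<tau> Xss)) \<cdot> \<tau> (map Eo Xss)"
    using opmonoidal assms by (simp add: opmonoidal_structures_def in_lists_conv_set del: assoc)
  then show ?thesis using assms by simp
qed

lemma \<tau>_\<eta>: "objs Xs \<Longrightarrow> \<tau> Xs \<cdot> \<eta> (Eo Xs) = Ea (map \<eta> Xs)"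
  using opmonoidal by (simp add: opmonoidal_structures_def in_lists_conv_set)

lemma \<tau>_\<mu>:
  assumes "objs Xs"
  shows "\<tau> Xs \<cdot> \<mu> (Eo Xs) = Ea (map \<mu> Xs) \<cdot> (\<tau> (map To Xs) \<cdot> Ta (\<tau> Xs))"
proof -
  have "\<tau> Xs \<cdot> \<mu> (Eo Xs) = (Ea (map \<mu> Xs) \<cdot> \<tau> (map To Xs)) \<cdot> Ta (\<tau> Xs)"
    using opmonoidal assms by (simp add: opmonoidal_structures_def in_lists_conv_set del: assoc)
  then show ?thesis using assms by simp
qed

abbreviation "L \<equiv> lifted_tensor C E \<tau>"

lemma fst_L [simp]: "fst (L As) = Eo (map fst As)"
  and snd_L: "snd (L As) = Ea (map snd As) \<cdot> \<tau> (map fst As)"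
  by (simp_all add: lifted_tensor_def)

text \<open>The unit law combines \<open>\<tau>_\<eta>\<close> with the unit laws of the factors.
  The multiplication law combines \<open>\<tau>_\<mu>\<close> with theirs, once naturality of \<tau>
  has moved the structure maps to the other side of \<tau>.\<close>

lemma L_algebra [simp]:
  assumes As: "\<forall>A\<in>set As. A \<in> algebras C T"
  shows "L As \<in> algebras C T"
proof -
  let ?X = "map fst As" and ?a = "Ea (map snd As)"
  have nat: "Ea (map (\<lambda>A. Ta (snd A)) As) \<cdot> \<tau> (map (\<lambda>A. To (fst A)) As) = \<tau> ?X \<cdot> Ta ?a"
    by (rule \<tau>_nat) (use As in simp)
  have "(?a \<cdot> \<tau> ?X) \<cdot> \<eta> (Eo ?X) = ?a \<cdot> Ea (map (\<lambda>A. \<eta> (fst A)) As)"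
    using As by (simp add: \<tau>_\<eta>)
  also have "\<dots> = Ident C (Eo ?X)"
    using As by (simp add: Ea_comp[symmetric] alg_unit)
  finally have unit: "(?a \<cdot> \<tau> ?X) \<cdot> \<eta> (Eo ?X) = Ident C (Eo ?X)" .
  have "(?a \<cdot> \<tau> ?X) \<cdot> \<mu> (Eo ?X) =
      (?a \<cdot> Ea (map (\<lambda>A. \<mu> (fst A)) As)) \<cdot> (\<tau> (map (\<lambda>A. To (fst A)) As) \<cdot> Ta (\<tau> ?X))"
    using As by (simp add: \<tau>_\<mu>)
  also have "?a \<cdot> Ea (map (\<lambda>A. \<mu> (fst A)) As) = ?a \<cdot> Ea (map (\<lambda>A. Ta (snd A)) As)"
    using As by (simp add: Ea_comp[symmetric] alg_mult)
  also have "(?a \<cdot> Ea (map (\<lambda>A. Ta (snd A)) As)) \<cdot> (\<tau> (map (\<lambda>A. To (fst A)) As) \<cdot> Ta (\<tau> ?X)) =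
     ?a \<cdot> ((Ea (map (\<lambda>A. Ta (snd A)) As) \<cdot> \<tau> (map (\<lambda>A. To (fst A)) As)) \<cdot> Ta (\<tau> ?X))"
    using As by simp
  also have "\<dots> = (?a \<cdot> \<tau> ?X) \<cdot> Ta (?a \<cdot> \<tau> ?X)"
    unfolding nat using As by simp
  finally show ?thesis using unit As by (simp add: lifted_tensor_def algebras_def)
qed

text \<open>Naturality of \<tau> at the underlying arrows carries them past \<tau>; each of them
  then meets the structure maps of its own source and target.\<close>

lemma L_map:
  assumes ps: "\<forall>p\<in>set ps. p \<in> Arr (alg_cat C T)"
  shows "(L (map fst ps), Ea (map (\<lambda>p. fst (snd p)) ps), L (map (\<lambda>p. snd (snd p)) ps)) \<in> Arr (alg_cat C T)"
proof -
  let ?f = "\<lambda>p. fst (snd p)" and ?a = "\<lambda>p. snd (fst p)" and ?b = "\<lambda>p. snd (snd (snd p))"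
  let ?X = "map (\<lambda>p. fst (fst p)) ps" and ?Y = "map (\<lambda>p. fst (snd (snd p))) ps"
  have nat: "Ea (map (\<lambda>p. Ta (?f p)) ps) \<cdot> \<tau> ?X = \<tau> ?Y \<cdot> Ta (Ea (map ?f ps))"
    by (rule \<tau>_nat) (use ps in simp)
  have "Ea (map ?f ps) \<cdot> snd (L (map fst ps)) = (Ea (map ?f ps) \<cdot> Ea (map ?a ps)) \<cdot> \<tau> ?X"
    using ps by (simp add: snd_L)
  also have "Ea (map ?f ps) \<cdot> Ea (map ?a ps) = Ea (map ?b ps) \<cdot> Ea (map (\<lambda>p. Ta (?f p)) ps)"
    using ps by (simp add: Ea_comp[symmetric] alg_arr_comm)
  also have "(Ea (map ?b ps) \<cdot> Ea (map (\<lambda>p. Ta (?f p)) ps)) \<cdot> \<tau> ?X =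
      Ea (map ?b ps) \<cdot> (Ea (map (\<lambda>p. Ta (?f p)) ps) \<cdot> \<tau> ?X)"
    using ps by simp
  also have "\<dots> = snd (L (map (\<lambda>p. snd (snd p)) ps)) \<cdot> Ta (Ea (map ?f ps))"
    unfolding nat using ps by (simp add: snd_L)
  finally show ?thesis using ps by (intro alg_arrI) simp_all
qed

lemma L_u:
  assumes A: "A \<in> algebras C T"
  shows "(A, u (fst A), L [A]) \<in> Arr (alg_cat C T)"
proof -
  have "snd (L [A]) \<cdot> Ta (u (fst A)) = u (fst A) \<cdot> snd A"
    using A by (simp add: snd_L \<tau>_u u_nat)
  then show ?thesis using A by (intro alg_arrI) simp_all
qed

text \<open>This is \<open>\<tau>_\<sigma>\<close> followed by naturality of \<sigma> at the
  structure maps. The bare equation is kept because at free algebras it becomes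
  \<open>c_\<sigma>\<close>.\<close>

lemma L_\<sigma>_comm:
  assumes Ass: "\<forall>As\<in>set Ass. \<forall>A\<in>set As. A \<in> algebras C T"
  shows "\<sigma> (map (map fst) Ass) \<cdot> snd (L (map L Ass)) =
    snd (L (concat Ass)) \<cdot> Ta (\<sigma> (map (map fst) Ass))"
proof -
  let ?X = "map (map fst) Ass"
  let ?TX = "map (\<lambda>As. map (\<lambda>A. To (fst A)) As) Ass"
  let ?Ea = "Ea (map (\<lambda>As. Ea (map snd As)) Ass)"
  have nat: "Ea (concat (map (map snd) Ass)) \<cdot> \<sigma> ?TX = \<sigma> ?X \<cdot> ?Ea"
    by (rule \<sigma>_nat) (use Ass in simp)
  have "snd (L (concat Ass)) \<cdot> Ta (\<sigma> ?X) =
     Ea (concat (map (map snd) Ass)) \<cdot> (\<tau> (concat ?X) \<cdot> Ta (\<sigma> ?X))"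
    using Ass by (simp add: snd_L)
  also have "\<tau> (concat ?X) \<cdot> Ta (\<sigma> ?X) =
     \<sigma> ?TX \<cdot> (Ea (map (\<lambda>As. \<tau> (map fst As)) Ass) \<cdot> \<tau> (map Eo ?X))"
    using Ass by (simp add: \<tau>_\<sigma>)
  also have "Ea (concat (map (map snd) Ass)) \<cdot> \<dots> =
     (Ea (concat (map (map snd) Ass)) \<cdot> \<sigma> ?TX) \<cdot> (Ea (map (\<lambda>As. \<tau> (map fst As)) Ass) \<cdot> \<tau> (map Eo ?X))"
    using Ass by simp
  also have "\<dots> = \<sigma> ?X \<cdot> snd (L (map L Ass))"
    unfolding nat using Ass by (simp add: snd_L Ea_comp)
  finally show ?thesis ..
qed

lemma L_\<sigma>:
  assumes Ass: "\<forall>As\<in>set Ass. \<forall>A\<in>set As. A \<in> algebras C T"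
  shows "(L (map L Ass), \<sigma> (map (map fst) Ass), L (concat Ass)) \<in> Arr (alg_cat C T)"
  using Ass L_\<sigma>_comm[OF Ass] by (intro alg_arrI) simp_all

end

section \<open>Liftings\<close>

text \<open>Needed for associativity in the category of algebras, where equality of two maps
  includes equality of their targets.\<close>

lemma concat_concat: "concat (concat xsss) = concat (map concat xsss)"
  by (induction xsss) auto

context opmon
begin

abbreviation "E' \<equiv> lifting_of C E T \<tau>"

lemma lifting_fobj [simp]:
    "\<forall>A\<in>set As. A \<in> algebras C T \<Longrightarrow> fobj (tensor E') As = L As"
  and lifting_farr [simp]:
    "\<forall>p\<in>set ps. p \<in> Arr (alg_cat C T) \<Longrightarrow> farr (tensor E') ps =
      (L (map fst ps), Ea (map (\<lambda>p. fst (snd p)) ps), L (map (\<lambda>p. snd (snd p)) ps))"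
  and lifting_tunit [simp]: "A \<in> algebras C T \<Longrightarrow> tunit E' A = (A, u (fst A), L [A])"
  and lifting_tsubst [simp]:
    "\<forall>As\<in>set Ass. \<forall>A\<in>set As. A \<in> algebras C T \<Longrightarrow>
      tsubst E' Ass = (L (map L Ass), \<sigma> (map (map fst) Ass), L (concat Ass))"
  by (simp_all add: lifting_of_def in_lists_conv_set)

lemma lifting_functor: "is_functor (seq_cat (alg_cat C T)) (alg_cat C T) (tensor E')"
  unfolding is_functor_def
proof (intro conjI allI ballI impI)
  fix fs gs as bs cs
  assume f: "fs \<in> hom (seq_cat (alg_cat C T)) as bs"
    and g: "gs \<in> hom (seq_cat (alg_cat C T)) bs cs"
  then have m: "map (\<lambda>p. snd (snd p)) fs = map fst gs" by simp
  then obtain ps where ps: "fs = map fst ps" "gs = map snd ps" by (rule list_pair)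
  have "\<forall>p\<in>set ps. fst (snd p) = snd (snd (fst p))"
    using m unfolding ps by simp
  then have arr: "\<forall>p\<in>set ps. fst p \<in> Arr (alg_cat C T) \<and> snd p \<in> Arr (alg_cat C T) \<and>
      fst (snd p) = snd (snd (fst p))"
    using f g unfolding ps by (simp add: in_lists_conv_set)
  show "farr (tensor E') (gs \<cdot>\<^bsub>seq_cat (alg_cat C T)\<^esub> fs) =
      farr (tensor E') gs \<cdot>\<^bsub>alg_cat C T\<^esub> farr (tensor E') fs"
    using arr unfolding ps by (simp add: alg_comp_arr Ea_comp)
qed (simp_all add: in_lists_conv_set L_map alg_ident_arr)

text \<open>An algebra map is a source, an underlying arrow and a target, so once all components are
  known to be algebra maps every law is the corresponding law of \<open>E\<close> on underlying
  arrows.\<close>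

lemma lifting_multitensor: "is_multitensor (alg_cat C T) E'"
  unfolding is_multitensor_def
proof (intro conjI ballI)
  show "is_functor (seq_cat (alg_cat C T)) (alg_cat C T) (tensor E')" by (rule lifting_functor)
  show "is_natural (alg_cat C T) (alg_cat C T) id_functor (tensor E' \<circ>\<circ> singleton_functor)
      (tunit E')"
    unfolding is_natural_def
    by (intro conjI allI ballI impI) (simp_all add: L_u u_nat)
  show "is_natural (seq_cat (seq_cat (alg_cat C T))) (alg_cat C T)
      (tensor E' \<circ>\<circ> seq_functor (tensor E')) (tensor E' \<circ>\<circ> concat_functor) (tsubst E')"
    unfolding is_natural_def
  proof (intro conjI allI ballI impI)
    fix fss as bs assume "fss \<in> hom (seq_cat (seq_cat (alg_cat C T))) as bs"
    then have f: "\<forall>fs\<in>set fss. \<forall>f\<in>set fs. f \<in> Arr (alg_cat C T)"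
      and ab: "as = map (map fst) fss" "bs = map (map (\<lambda>p. snd (snd p))) fss"
      by (simp_all add: in_lists_conv_set)
    show "tsubst E' bs \<cdot>\<^bsub>alg_cat C T\<^esub> farr (tensor E' \<circ>\<circ> seq_functor (tensor E')) fss =
        farr (tensor E' \<circ>\<circ> concat_functor) fss \<cdot>\<^bsub>alg_cat C T\<^esub> tsubst E' as"
      unfolding ab using f \<sigma>_nat[of fss "\<lambda>p. fst (snd p)" "\<lambda>p. fst (fst p)" "\<lambda>p. fst (snd (snd p))"] by (simp add: L_map)
  qed (simp add: in_lists_conv_set L_\<sigma>)
  show "tsubst E' [As] \<cdot>\<^bsub>alg_cat C T\<^esub> tunit E' (fobj (tensor E') As) =
      Ident (alg_cat C T) (fobj (tensor E') As)" if "As \<in> lists (Obj (alg_cat C T))" for As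
    using that by (simp add: in_lists_conv_set mult_unit_left)
  show "tsubst E' (map (\<lambda>A. [A]) As) \<cdot>\<^bsub>alg_cat C T\<^esub> farr (tensor E') (map (tunit E') As) =
      Ident (alg_cat C T) (fobj (tensor E') As)" if "As \<in> lists (Obj (alg_cat C T))" for As
    using that mult_unit_right[of "map fst As"] by (simp add: in_lists_conv_set L_u)
  show "tsubst E' (map concat Asss) \<cdot>\<^bsub>alg_cat C T\<^esub> farr (tensor E') (map (tsubst E') Asss) =
      tsubst E' (concat Asss) \<cdot>\<^bsub>alg_cat C T\<^esub> tsubst E' (map (map (fobj (tensor E'))) Asss)"
    if "Asss \<in> lists (lists (lists (Obj (alg_cat C T))))" for Asss
    using that mult_assoc[of "map (\<lambda>Ass. map (map fst) Ass) Asss"]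
    by (simp add: in_lists_conv_set L_\<sigma> concat_concat)
qed

lemma lifting_of_lifting: "lifting_of C E T \<tau> \<in> liftings C E T"
  using lifting_multitensor unfolding liftings_def functors_agree_def
  by (simp add: in_lists_conv_set del: split_paired_All) (simp add: lifting_of_def)

text \<open>Naturality of \<tau> at \<eta> turns \<open>\<tau> \<circ> TE\<eta>\<close> into
  \<open>ET\<eta> \<circ> \<tau>\<close>, and \<open>E\<mu>\<close> cancels \<open>ET\<eta>\<close>
  by the monad unit law. Injectivity of both correspondences rests on this.\<close>

lemma \<tau>_eq_free:
  assumes "objs Xs"
  shows "\<tau> Xs = snd (L (map (\<lambda>X. (To X, \<mu> X)) Xs)) \<cdot> Ta (Ea (map \<eta> Xs))"
proof -
  have nat: "Ea (map (\<lambda>X. Ta (\<eta> X)) Xs) \<cdot> \<tau> Xs = \<tau> (map To Xs) \<cdot> Ta (Ea (map \<eta> Xs))"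
    using \<tau>_nat[of Xs \<eta> "\<lambda>X. X" To] assms by simp
  have "snd (L (map (\<lambda>X. (To X, \<mu> X)) Xs)) \<cdot> Ta (Ea (map \<eta> Xs)) =
      Ea (map \<mu> Xs) \<cdot> (\<tau> (map To Xs) \<cdot> Ta (Ea (map \<eta> Xs)))"
    using assms by (simp add: snd_L)
  also have "\<dots> = (Ea (map \<mu> Xs) \<cdot> Ea (map (\<lambda>X. Ta (\<eta> X)) Xs)) \<cdot> \<tau> Xs"
    unfolding nat[symmetric] using assms by simp
  also have "Ea (map \<mu> Xs) \<cdot> Ea (map (\<lambda>X. Ta (\<eta> X)) Xs) = Ident C (Eo (map To Xs))"
    using assms by (simp add: Ea_comp[symmetric] monad_unit_right)
  finally show ?thesis using assms by simp
qed

end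

text \<open>The algebra structures \<open>c\<close> on tensor products of free algebras, and the opmonoidal structure \<open>t\<close>
  recovered from them.\<close>

locale free_structures = setting C T E for C :: "('o, 'a) category" (structure) and T E +
  fixes c :: "'o list \<Rightarrow> 'a" and t :: "'o list \<Rightarrow> 'a"
  defines t_def: "t \<equiv> \<lambda>Xs. c Xs \<cdot> Ta (Ea (map \<eta> Xs))"
  assumes c_simps [simp]: "objs Xs \<Longrightarrow> c Xs \<in> Arr C"
      "objs Xs \<Longrightarrow> Dom C (c Xs) = To (Eo (map To Xs))"
      "objs Xs \<Longrightarrow> Cod C (c Xs) = Eo (map To Xs)"
    and c_nat: "\<forall>f\<in>set fs. f \<in> Arr C \<Longrightarrow>
      Ea (map Ta fs) \<cdot> c (map (Dom C) fs) = c (map (Cod C) fs) \<cdot> Ta (Ea (map Ta fs))"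
    and c_free: "objs Xs \<Longrightarrow>
      Ea (map \<mu> Xs) \<cdot> c (map To Xs) = c Xs \<cdot> Ta (Ea (map \<mu> Xs))"
    and c_unit: "objs Xs \<Longrightarrow>
      c Xs \<cdot> \<eta> (Eo (map To Xs)) = Ident C (Eo (map To Xs))"
    and c_mult: "objs Xs \<Longrightarrow> c Xs \<cdot> \<mu> (Eo (map To Xs)) = c Xs \<cdot> Ta (c Xs)"
    and c_u: "X \<in> Obj C \<Longrightarrow> c [X] \<cdot> Ta (u (To X)) = u (To X) \<cdot> \<mu> X"
    and c_\<sigma>: "\<forall>Xs\<in>set Xss. objs Xs \<Longrightarrow>
      c (concat Xss) \<cdot> Ta (\<sigma> (map (map To) Xss)) =
      \<sigma> (map (map To) Xss) \<cdot> (Ea (map c Xss) \<cdot> t (map (\<lambda>Xs. Eo (map To Xs)) Xss))"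
begin

lemma t_simps [simp]:
  assumes "objs Xs"
  shows "t Xs \<in> Arr C" "Dom C (t Xs) = To (Eo Xs)" "Cod C (t Xs) = Eo (map To Xs)"
  using assms by (simp_all add: t_def)

text \<open>By \<open>c_free\<close> the map \<open>E\<mu>\<close> passes through \<open>c\<close>,
  where it cancels the \<eta> in \<open>t\<close>. Hence \<open>t\<close> retains all of
  \<open>c\<close>.\<close>

lemma \<mu>_t:
  assumes "objs Xs"
  shows "Ea (map \<mu> Xs) \<cdot> t (map To Xs) = c Xs"
proof -
  have "Ea (map \<mu> Xs) \<cdot> t (map To Xs) = (Ea (map \<mu> Xs) \<cdot> c (map To Xs)) \<cdot> Ta (Ea (map (\<lambda>X. \<eta> (To X)) Xs))"
    using assms by (simp add: t_def)
  also have "\<dots> = c Xs \<cdot> Ta (Ea (map \<mu> Xs) \<cdot> Ea (map (\<lambda>X. \<eta> (To X)) Xs))"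
    unfolding c_free[OF assms] using assms by simp
  also have "Ea (map \<mu> Xs) \<cdot> Ea (map (\<lambda>X. \<eta> (To X)) Xs) = Ident C (Eo (map To Xs))"
    using assms by (simp add: Ea_comp[symmetric] monad_unit_left)
  finally show ?thesis using assms by simp
qed

text \<open>Naturality of \<eta> replaces an arbitrary arrow \<open>f\<close> by the map
  \<open>Tf\<close> of free algebras, for which \<open>c\<close> is natural.\<close>

lemma t_nat:
  assumes "\<forall>f\<in>set fs. f \<in> Arr C"
  shows "t (map (Cod C) fs) \<cdot> Ta (Ea fs) = Ea (map Ta fs) \<cdot> t (map (Dom C) fs)"
proof -
  have 1: "Ea (map (\<lambda>f. \<eta> (Cod C f)) fs) \<cdot> Ea fs = Ea (map Ta fs) \<cdot> Ea (map (\<lambda>f. \<eta> (Dom C f)) fs)"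
    using assms Ea_comp[of fs "\<lambda>f. f" "\<lambda>f. \<eta> (Cod C f)"]
      Ea_comp[of fs "\<lambda>f. \<eta> (Dom C f)" Ta] by (simp add: \<eta>_nat)
  have "t (map (Cod C) fs) \<cdot> Ta (Ea fs) = c (map (Cod C) fs) \<cdot> Ta (Ea (map (\<lambda>f. \<eta> (Cod C f)) fs) \<cdot> Ea fs)"
    using assms by (simp add: t_def)
  also have "\<dots> = (c (map (Cod C) fs) \<cdot> Ta (Ea (map Ta fs))) \<cdot> Ta (Ea (map (\<lambda>f. \<eta> (Dom C f)) fs))"
    unfolding 1 using assms by simp
  also have "\<dots> = Ea (map Ta fs) \<cdot> t (map (Dom C) fs)"
    unfolding c_nat[OF assms, symmetric] using assms by (simp add: t_def)
  finally show ?thesis .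
qed

lemma t_nat_family:
  assumes "\<forall>i\<in>set is. f i \<in> Arr C \<and> Dom C (f i) = a i \<and> Cod C (f i) = b i"
  shows "t (map b is) \<cdot> Ta (Ea (map f is)) = Ea (map (\<lambda>i. Ta (f i)) is) \<cdot> t (map a is)"
  using t_nat[of "map f is"] assms by simp

lemma t_u: "X \<in> Obj C \<Longrightarrow> t [X] \<cdot> Ta (u X) = u (To X)"
proof -
  assume X: "X \<in> Obj C"
  have "t [X] \<cdot> Ta (u X) = c [X] \<cdot> Ta (Ea [\<eta> X] \<cdot> u X)"
    using X by (simp add: t_def)
  also have "\<dots> = (c [X] \<cdot> Ta (u (To X))) \<cdot> Ta (\<eta> X)"
    using X by (simp add: u_nat)
  also have "\<dots> = u (To X)"
    unfolding c_u[OF X] using X by (simp add: monad_unit_right)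
  finally show ?thesis .
qed

lemma t_\<eta>:
  assumes "objs Xs"
  shows "t Xs \<cdot> \<eta> (Eo Xs) = Ea (map \<eta> Xs)"
proof -
  have "t Xs \<cdot> \<eta> (Eo Xs) = (c Xs \<cdot> \<eta> (Eo (map To Xs))) \<cdot> Ea (map \<eta> Xs)"
    using assms by (simp add: t_def \<eta>_nat)
  then show ?thesis using assms by (simp add: c_unit del: assoc)
qed

lemma t_\<mu>:
  assumes "objs Xs"
  shows "t Xs \<cdot> \<mu> (Eo Xs) = Ea (map \<mu> Xs) \<cdot> t (map To Xs) \<cdot> Ta (t Xs)"
proof -
  have "t Xs \<cdot> \<mu> (Eo Xs) = (c Xs \<cdot> \<mu> (Eo (map To Xs))) \<cdot> Ta (Ta (Ea (map \<eta> Xs)))"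
    using assms by (simp add: t_def \<mu>_nat)
  also have "\<dots> = c Xs \<cdot> Ta (t Xs)"
    using assms by (simp add: c_mult t_def)
  finally show ?thesis unfolding \<mu>_t[OF assms] .
qed

text \<open>The algebras on the objects \<open>ETX\<close> need not be free, so their tensor product
  carries \<open>Ec \<circ> t\<close>; this is why \<open>c_\<sigma>\<close> mentions
  \<open>t\<close>. Naturality of \<sigma> and of \<open>t\<close> at \<eta> reduces the claim to
  \<open>c_\<sigma>\<close>.\<close>

lemma t_\<sigma>:
  assumes X: "\<forall>Xs\<in>set Xss. objs Xs"
  shows "t (concat Xss) \<cdot> Ta (\<sigma> Xss) =
    \<sigma> (map (map To) Xss) \<cdot> Ea (map t Xss) \<cdot> t (map Eo Xss)"
proof -
  let ?TX = "map (map To) Xss" and ?\<eta> = "map (\<lambda>Xs. Ea (map \<eta> Xs)) Xss"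
  have 1: "Ea (map \<eta> (concat Xss)) \<cdot> \<sigma> Xss = \<sigma> ?TX \<cdot> Ea ?\<eta>"
    using \<sigma>_nat[of Xss \<eta> "\<lambda>X. X" To] X by simp
  have 2: "t (map (\<lambda>Xs. Eo (map To Xs)) Xss) \<cdot> Ta (Ea ?\<eta>) =
      Ea (map (\<lambda>Xs. Ta (Ea (map \<eta> Xs))) Xss) \<cdot> t (map Eo Xss)"
    using X by (intro t_nat_family) simp
  have "t (concat Xss) \<cdot> Ta (\<sigma> Xss) = c (concat Xss) \<cdot> Ta (Ea (map \<eta> (concat Xss)) \<cdot> \<sigma> Xss)"
    using X by (simp add: t_def)
  also have "\<dots> = (c (concat Xss) \<cdot> Ta (\<sigma> ?TX)) \<cdot> Ta (Ea ?\<eta>)"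
    unfolding 1 using X by simp
  also have "\<dots> = (\<sigma> ?TX \<cdot> Ea (map c Xss)) \<cdot> (t (map (\<lambda>Xs. Eo (map To Xs)) Xss) \<cdot> Ta (Ea ?\<eta>))"
    unfolding c_\<sigma>[OF X] using X by simp
  also have "\<dots> = \<sigma> ?TX \<cdot> (Ea (map c Xss) \<cdot> Ea (map (\<lambda>Xs. Ta (Ea (map \<eta> Xs))) Xss)) \<cdot> t (map Eo Xss)"
    unfolding 2 using X by simp
  also have "Ea (map c Xss) \<cdot> Ea (map (\<lambda>Xs. Ta (Ea (map \<eta> Xs))) Xss) = Ea (map t Xss)"
    unfolding t_def using X by (simp add: Ea_comp[symmetric])
  finally show ?thesis .
qed

lemma t_opmonoidal: "restrict t (lists (Obj C)) \<in> opmonoidal_structures C E T"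
proof -
  have [simp]: "restrict t (lists (Obj C)) Xs = t Xs" if "objs Xs" for Xs
    using that by (simp add: in_lists_conv_set)
  have "is_natural (seq_cat C) C (mfun T \<circ>\<circ> tensor E) (tensor E \<circ>\<circ> seq_functor (mfun T))
      (restrict t (lists (Obj C)))"
    unfolding is_natural_def
    by (intro conjI allI impI ballI) (auto simp: in_lists_conv_set t_nat simp del: restrict_apply)
  then show ?thesis unfolding opmonoidal_structures_def
    by (simp add: in_lists_conv_set t_u t_\<eta> t_\<mu> t_\<sigma> del: restrict_apply assoc)
qed

end

section \<open>Tensor products of free algebras\<close>

context opmon
begin

abbreviation "c Xs \<equiv> Ea (map \<mu> Xs) \<cdot> \<tau> (map To Xs)"

abbreviation "free \<equiv> \<lambda>X. (To X, \<mu> X)"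

text \<open>Since \<open>c\<close> is the structure map of a lifted tensor product of free algebras,
  its laws below are instances of \<open>L_map\<close>, \<open>L_algebra\<close>, \<open>L_u\<close>
  and \<open>L_\<sigma>_comm\<close>.\<close>

lemma snd_L_free: "snd (L (map free Xs)) = c Xs"
  by (simp add: snd_L)

lemma c_nat:
  assumes "\<forall>f\<in>set fs. f \<in> Arr C"
  shows "Ea (map Ta fs) \<cdot> c (map (Dom C) fs) = c (map (Cod C) fs) \<cdot> Ta (Ea (map Ta fs))"
proof -
  have "\<forall>f\<in>set fs. (free (Dom C f), Ta f, free (Cod C f)) \<in> Arr (alg_cat C T)"
    using assms by (intro ballI alg_arrI free_algebra) (simp_all add: \<mu>_nat)
  then show ?thesis
    using alg_arr_comm[OF L_map[of "map (\<lambda>f. (free (Dom C f), Ta f, free (Cod C f))) fs"]]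
    by (simp add: snd_L del: assoc)
qed

lemma c_unit:
  assumes "objs Xs"
  shows "c Xs \<cdot> \<eta> (Eo (map To Xs)) = Ident C (Eo (map To Xs))"
  using alg_unit[OF L_algebra, of "map free Xs"] assms
  by (simp add: snd_L free_algebra del: assoc)

lemma c_mult:
  assumes "objs Xs"
  shows "c Xs \<cdot> \<mu> (Eo (map To Xs)) = c Xs \<cdot> Ta (c Xs)"
  using alg_mult[OF L_algebra, of "map free Xs"] assms
  by (simp add: snd_L free_algebra del: assoc Ta_comp)

lemma c_u:
  assumes "X \<in> Obj C"
  shows "c [X] \<cdot> Ta (u (To X)) = u (To X) \<cdot> \<mu> X"
  using alg_arr_comm[OF L_u, of "free X"] assms
  by (simp add: snd_L free_algebra del: assoc)

lemma c_\<sigma>: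
  assumes "\<forall>Xs\<in>set Xss. objs Xs"
  shows "c (concat Xss) \<cdot> Ta (\<sigma> (map (map To) Xss)) =
    \<sigma> (map (map To) Xss) \<cdot> (Ea (map (\<lambda>Xs. c Xs) Xss) \<cdot> \<tau> (map (\<lambda>Xs. Eo (map To Xs)) Xss))"
  using L_\<sigma>_comm[of "map (map free) Xss"] assms
  by (simp add: snd_L free_algebra del: assoc)

lemma c_simps:
  assumes "objs Xs"
  shows "c Xs \<in> Arr C" "Dom C (c Xs) = To (Eo (map To Xs))" "Cod C (c Xs) = Eo (map To Xs)"
  using assms by simp_all

end

text \<open>Equal liftings have the same structure maps on tensor products of free algebras, and
  \<open>\<tau>_eq_free\<close> computes \<tau> from these.\<close>

lemma (in setting) lifting_of_inj: "inj_on (lifting_of C E T) (opmonoidal_structures C E T)"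
proof (rule inj_onI)
  fix t t' assume t: "t \<in> opmonoidal_structures C E T" and t': "t' \<in> opmonoidal_structures C E T"
    and eq: "lifting_of C E T t = lifting_of C E T t'"
  interpret a: opmon C T E t by unfold_locales (rule t)
  interpret b: opmon C T E t' by unfold_locales (rule t')
  have "t Xs = t' Xs" if Xs: "Xs \<in> lists (Obj C)" for Xs
  proof -
    have X: "objs Xs" using Xs by (simp add: in_lists_conv_set)
    have f: "\<forall>A\<in>set (map (\<lambda>X. (To X, \<mu> X)) Xs). A \<in> algebras C T"
      using X by (simp add: free_algebra)
    have "a.L (map (\<lambda>X. (To X, \<mu> X)) Xs) = b.L (map (\<lambda>X. (To X, \<mu> X)) Xs)"
      using a.lifting_fobj[OF f] b.lifting_fobj[OF f] eq by metis
    then show ?thesis using a.\<tau>_eq_free[OF X] b.\<tau>_eq_free[OF X] by simp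
  qed
  moreover have "t \<in> extensional (lists (Obj C))" "t' \<in> extensional (lists (Obj C))"
    using t t' by (auto simp: opmonoidal_structures_def)
  ultimately show "t = t'" by (metis extensionalityI)
qed

text \<open>Two liftings are equal only if they agree as functions on all arguments; outside the
  lists of algebras and of algebra maps extensionality settles this.\<close>

lemma liftings_undefined:
  assumes "F \<in> liftings C E T"
  shows "As \<notin> lists (algebras C T) \<Longrightarrow> fobj (tensor F) As = undefined"
    "ps \<notin> lists (Arr (alg_cat C T)) \<Longrightarrow> farr (tensor F) ps = undefined"
    "A \<notin> algebras C T \<Longrightarrow> tunit F A = undefined"
    "Ass \<notin> lists (lists (algebras C T)) \<Longrightarrow> tsubst F Ass = undefined"
  using assms unfolding liftings_def mem_Collect_eq alg_cat_simps
  by (blast intro: extensional_arb)+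

section \<open>From a lifting to an opmonoidal structure\<close>

locale lifting = setting C T E for C :: "('o, 'a) category" (structure) and T E +
  fixes F :: "('o \<times> 'a, ('o, 'a) alg_map) multitensor"
  assumes lifting: "F \<in> liftings C E T"

sublocale lifting \<subseteq> lifted: multi "alg_cat C T" F
  by unfold_locales (use lifting in \<open>simp add: liftings_def\<close>)

context lifting
begin

lemma F_obj [simp]:
  assumes "\<forall>A\<in>set As. A \<in> algebras C T"
  shows "fobj (tensor F) As \<in> algebras C T" "fst (fobj (tensor F) As) = Eo (map fst As)"
  using lifting lifted.Eo_obj[of As] assms
  by (simp_all add: liftings_def functors_agree_def in_lists_conv_set)

lemma F_arr [simp]:
  assumes "\<forall>p\<in>set ps. p \<in> Arr (alg_cat C T)"
  shows "farr (tensor F) ps \<in> Arr (alg_cat C T)"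
    "fst (farr (tensor F) ps) = fobj (tensor F) (map fst ps)"
    "fst (snd (farr (tensor F) ps)) = Ea (map (\<lambda>p. fst (snd p)) ps)"
    "snd (snd (farr (tensor F) ps)) = fobj (tensor F) (map (\<lambda>p. snd (snd p)) ps)"
  using lifting lifted.Ea_simps[of ps] assms
  by (simp_all add: liftings_def functors_agree_def in_lists_conv_set)

lemma F_u [simp]:
  assumes "A \<in> algebras C T"
  shows "tunit F A \<in> Arr (alg_cat C T)" "fst (tunit F A) = A" "fst (snd (tunit F A)) = u (fst A)"
    "snd (snd (tunit F A)) = fobj (tensor F) [A]"
  using lifting lifted.u_simps[of A] assms by (simp_all add: liftings_def del: split_paired_All)

lemma F_\<sigma> [simp]:
  assumes "\<forall>As\<in>set Ass. \<forall>A\<in>set As. A \<in> algebras C T"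
  shows "tsubst F Ass \<in> Arr (alg_cat C T)"
    "fst (tsubst F Ass) = fobj (tensor F) (map (fobj (tensor F)) Ass)"
    "fst (snd (tsubst F Ass)) = \<sigma> (map (map fst) Ass)"
    "snd (snd (tsubst F Ass)) = fobj (tensor F) (concat Ass)"
  using lifting lifted.\<sigma>_simps[of Ass] assms
  by (simp_all add: liftings_def in_lists_conv_set del: split_paired_All)

definition st where "st As = snd (fobj (tensor F) As)"

lemma st_simps [simp]:
  assumes "\<forall>A\<in>set As. A \<in> algebras C T"
  shows "st As \<in> Arr C" "Dom C (st As) = To (Eo (map fst As))" "Cod C (st As) = Eo (map fst As)"
  using alg_simps[OF F_obj(1)[OF assms]] F_obj(2)[OF assms] by (simp_all add: st_def)

lemma st_map:
  assumes "\<forall>p\<in>set ps. p \<in> Arr (alg_cat C T)"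
  shows "Ea (map (\<lambda>p. fst (snd p)) ps) \<cdot> st (map fst ps) =
    st (map (\<lambda>p. snd (snd p)) ps) \<cdot> Ta (Ea (map (\<lambda>p. fst (snd p)) ps))"
  using alg_arr_comm[OF F_arr(1)[OF assms]] assms by (simp add: st_def)

definition cf where "cf Xs = st (map (\<lambda>X. (To X, \<mu> X)) Xs)"

lemma cf_simps [simp]:
  assumes "objs Xs"
  shows "cf Xs \<in> Arr C" "Dom C (cf Xs) = To (Eo (map To Xs))" "Cod C (cf Xs) = Eo (map To Xs)"
  using assms by (simp_all add: cf_def free_algebra)

text \<open>A structure map is an algebra map from a free algebra, and it is split by \<eta> in the
  underlying category. So the lifting is determined everywhere by its values on free
  algebras.\<close>

lemma st_eq:
  assumes As: "\<forall>A\<in>set As. A \<in> algebras C T"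
  shows "st As = Ea (map snd As) \<cdot> (cf (map fst As) \<cdot> Ta (Ea (map (\<lambda>A. \<eta> (fst A)) As)))"
proof -
  have "\<forall>A\<in>set As. ((To (fst A), \<mu> (fst A)), snd A, A) \<in> Arr (alg_cat C T)"
    using As by (intro ballI alg_arrI free_algebra) (simp_all add: alg_mult)
  then have 1: "Ea (map snd As) \<cdot> cf (map fst As) = st As \<cdot> Ta (Ea (map snd As))"
    using st_map[of "map (\<lambda>A. ((To (fst A), \<mu> (fst A)), snd A, A)) As"] by (simp add: cf_def)
  have "(Ea (map snd As) \<cdot> cf (map fst As)) \<cdot> Ta (Ea (map (\<lambda>A. \<eta> (fst A)) As)) =
      st As \<cdot> Ta (Ea (map snd As) \<cdot> Ea (map (\<lambda>A. \<eta> (fst A)) As))"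
    unfolding 1 using As by simp
  also have "Ea (map snd As) \<cdot> Ea (map (\<lambda>A. \<eta> (fst A)) As) = Ident C (Eo (map fst As))"
    using As by (simp add: Ea_comp[symmetric] alg_unit)
  finally show ?thesis using As by simp
qed

text \<open>Cases 4 and 5 use that the lifting acts on the algebra maps \<open>Tf\<close> and \<mu>;
  cases 6 and 7 are the algebra laws of a tensor product; cases 8 and 9 say that its unit and
  substitution are algebra maps.\<close>

lemma free_structures: "free_structures C T E cf"
proof (unfold_locales, goal_cases)
  case (4 fs)
  then have "\<forall>f\<in>set fs. ((To (Dom C f), \<mu> (Dom C f)), Ta f, (To (Cod C f), \<mu> (Cod C f))) \<in> Arr (alg_cat C T)"
    by (intro ballI alg_arrI free_algebra) (simp_all add: \<mu>_nat)
  then show ?case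
    using st_map[of "map (\<lambda>f. ((To (Dom C f), \<mu> (Dom C f)), Ta f, (To (Cod C f), \<mu> (Cod C f)))) fs"]
    by (simp add: cf_def)
next
  case (5 Xs)
  then have "\<forall>X\<in>set Xs. ((To (To X), \<mu> (To X)), \<mu> X, (To X, \<mu> X)) \<in> Arr (alg_cat C T)"
    by (intro ballI alg_arrI free_algebra) (simp_all add: monad_assoc)
  then show ?case
    using st_map[of "map (\<lambda>X. ((To (To X), \<mu> (To X)), \<mu> X, (To X, \<mu> X))) Xs"]
    by (simp add: cf_def)
next
  case (6 Xs)
  then show ?case using alg_unit[OF F_obj(1), of "map (\<lambda>X. (To X, \<mu> X)) Xs"]
    by (simp add: cf_def st_def free_algebra)
next
  case (7 Xs)
  then show ?case using alg_mult[OF F_obj(1), of "map (\<lambda>X. (To X, \<mu> X)) Xs"]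
    by (simp add: cf_def st_def free_algebra)
next
  case (8 X)
  then show ?case using alg_arr_comm[OF F_u(1), of "(To X, \<mu> X)"]
    by (simp add: cf_def st_def free_algebra)
next
  case (9 Xss)
  let ?A = "map (\<lambda>Xs. map (\<lambda>X. (To X, \<mu> X)) Xs) Xss"
  have A: "\<forall>As\<in>set ?A. \<forall>A\<in>set As. A \<in> algebras C T" using 9 by (simp add: free_algebra)
  have "\<sigma> (map (map To) Xss) \<cdot> st (map (fobj (tensor F)) ?A) =
      cf (concat Xss) \<cdot> Ta (\<sigma> (map (map To) Xss))"
    using alg_arr_comm[OF F_\<sigma>(1)[OF A]] 9 A by (simp add: cf_def st_def free_algebra)
  \<comment> \<open>The factors here are themselves tensor products and need not be free, so
    \<open>st_eq\<close> is applied to them; its right-hand side produces the \<open>t\<close> of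
    \<open>c_\<sigma>\<close>.\<close>
  moreover have "st (map (fobj (tensor F)) ?A) =
      Ea (map cf Xss) \<cdot> (cf (map (\<lambda>Xs. Eo (map To Xs)) Xss) \<cdot>
        Ta (Ea (map \<eta> (map (\<lambda>Xs. Eo (map To Xs)) Xss))))"
    using 9 by (subst st_eq) (simp_all add: free_algebra st_def[symmetric] cf_def[symmetric])
  ultimately show ?case by (simp add: 9)
qed simp_all

lemma lifting_surj: "\<exists>\<tau>\<in>opmonoidal_structures C E T. lifting_of C E T \<tau> = F"
proof -
  define t where "t = (\<lambda>Xs. cf Xs \<cdot> Ta (Ea (map \<eta> Xs)))"
  define t' where "t' = restrict t (lists (Obj C))"
  interpret free_structures C T E cf t
    unfolding t_def by (rule free_structures)
  have op: "t' \<in> opmonoidal_structures C E T" unfolding t'_def by (rule t_opmonoidal)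
  interpret opmon C T E t' by unfold_locales (rule op)
  \<comment> \<open>By \<open>\<tau> = cf \<circ> TE\<eta>\<close> the structure map on the left is
    the right-hand side of \<open>st_eq\<close>. All other components follow, since the underlying
    arrows of a lifting are prescribed.\<close>
  have [simp]: "L As = fobj (tensor F) As" if "\<forall>A\<in>set As. A \<in> algebras C T" for As
    using that st_eq[OF that]
    by (simp add: lifted_tensor_def prod_eq_iff st_def t'_def t_def in_lists_conv_set)
  note undef = liftings_undefined[OF lifting] liftings_undefined[OF lifting_of_lifting]
  have "fobj (tensor E') As = fobj (tensor F) As" for As
  proof (cases "As \<in> lists (algebras C T)")
    case False
    then show ?thesis by (simp add: undef)
  qed (simp add: in_lists_conv_set)
  moreover have "farr (tensor E') ps = farr (tensor F) ps" for ps
  proof (cases "ps \<in> lists (Arr (alg_cat C T))")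
    case False
    then show ?thesis by (simp add: undef)
  qed (simp add: in_lists_conv_set prod_eq_iff)
  moreover have "tunit E' A = tunit F A" for A
  proof (cases "A \<in> algebras C T")
    case False
    then show ?thesis by (simp add: undef)
  qed (simp add: prod_eq_iff)
  moreover have "tsubst E' Ass = tsubst F Ass" for Ass
  proof (cases "Ass \<in> lists (lists (algebras C T))")
    case False
    then show ?thesis by (simp add: undef)
  qed (simp add: in_lists_conv_set prod_eq_iff)
  ultimately have "E' = F"
    by (intro multitensor.equality cfunctor.equality ext) simp_all
  then show ?thesis using op by blast
qed

end

lemma (in setting) lifting_of_bij:
  "bij_betw (lifting_of C E T) (opmonoidal_structures C E T) (liftings C E T)"
  unfolding bij_betw_def
proof (intro conjI equalityI subsetI lifting_of_inj)
  fix F assume "F \<in> lifting_of C E T ` opmonoidal_structures C E T"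
  then obtain t where t: "t \<in> opmonoidal_structures C E T" "F = lifting_of C E T t" by blast
  interpret opmon C T E t by unfold_locales (rule t)
  show "F \<in> liftings C E T" unfolding t(2) by (rule lifting_of_lifting)
next
  fix F assume F: "F \<in> liftings C E T"
  interpret lifting C T E F by unfold_locales (rule F)
  show "F \<in> lifting_of C E T ` opmonoidal_structures C E T" using lifting_surj by blast
qed

section \<open>Substitutions\<close>

lemma EM_simps [simp]:
  "fobj (tensor (EM_multitensor C E T s)) Xs = fobj (tensor E) (map (fobj (mfun T)) Xs)"
  "farr (tensor (EM_multitensor C E T s)) fs = farr (tensor E) (map (farr (mfun T)) fs)"
  "tunit (EM_multitensor C E T s) X = Comp C (tunit E (fobj (mfun T) X)) (munit T X)"
  "tsubst (EM_multitensor C E T s) = s"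
  by (simp_all add: EM_multitensor_def)

lemma unary_monad_simps [simp]:
  "mfun (unary_monad E) = tensor E \<circ>\<circ> singleton_functor" "munit (unary_monad E) = tunit E"
  "mmult (unary_monad E) X = tsubst E [[X]]"
  by (simp_all add: unary_monad_def)

section \<open>From an opmonoidal structure to a substitution\<close>

context opmon
begin

abbreviation "s \<equiv> substitution_of C E T \<tau>"

lemma s_eq:
  assumes "\<forall>Xs\<in>set Xss. objs Xs"
  shows "s Xss = \<sigma> (map (map To) Xss) \<cdot> Ea (map (\<lambda>Xs. c Xs) Xss)"
  using assms by (simp add: substitution_of_def in_lists_conv_set)

lemma s_simps [simp]:
  assumes "\<forall>Xs\<in>set Xss. objs Xs"
  shows "s Xss \<in> Arr C" "Dom C (s Xss) = Eo (map (\<lambda>Xs. To (Eo (map To Xs))) Xss)"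
    "Cod C (s Xss) = Eo (map To (concat Xss))"
  using assms by (simp_all add: s_eq)

lemma s_nat:
  assumes f: "\<forall>fs\<in>set fss. \<forall>f\<in>set fs. f \<in> Arr C"
  shows "s (map (map (Cod C)) fss) \<cdot> Ea (map (\<lambda>fs. Ta (Ea (map Ta fs))) fss) =
    Ea (map Ta (concat fss)) \<cdot> s (map (map (Dom C)) fss)"
proof -
  let ?a = "map (\<lambda>fs. map (\<lambda>f. To (Dom C f)) fs) fss" and ?b = "map (\<lambda>fs. map (\<lambda>f. To (Cod C f)) fs) fss"
  have nat: "Ea (concat (map (map Ta) fss)) \<cdot> \<sigma> ?a = \<sigma> ?b \<cdot> Ea (map (\<lambda>fs. Ea (map Ta fs)) fss)"
    using f by (intro \<sigma>_nat) simp
  have "s (map (map (Cod C)) fss) \<cdot> Ea (map (\<lambda>fs. Ta (Ea (map Ta fs))) fss) =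
      \<sigma> ?b \<cdot> Ea (map (\<lambda>fs. c (map (Cod C) fs) \<cdot> Ta (Ea (map Ta fs))) fss)"
    using f by (simp add: s_eq Ea_comp)
  also have "\<dots> = \<sigma> ?b \<cdot> Ea (map (\<lambda>fs. Ea (map Ta fs) \<cdot> c (map (Dom C) fs)) fss)"
    using f by (simp add: c_nat[symmetric] del: assoc map_fusion)
  also have "\<dots> = (\<sigma> ?b \<cdot> Ea (map (\<lambda>fs. Ea (map Ta fs)) fss)) \<cdot> Ea (map (\<lambda>fs. c (map (Dom C) fs)) fss)"
    using f by (simp add: Ea_comp)
  also have "\<dots> = Ea (map Ta (concat fss)) \<cdot> s (map (map (Dom C)) fss)"
    unfolding nat[symmetric] using f by (simp add: s_eq)
  finally show ?thesis .
qed

text \<open>In each block the \<open>T\<close> of the inner substitution meets a \<open>c\<close>.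
  After \<tau> has been moved past it, \<open>c_mult\<close> trades \<open>c \<circ> Tc\<close> for
  \<open>c \<circ> \<mu>\<close>, and this \<mu> together with \<tau> forms the \<open>c\<close> of
  the other layer. What remains is associativity of \<sigma> and its naturality at
  \<open>c\<close>.\<close>

lemma s_assoc:
  assumes X: "\<forall>Xss\<in>set Xsss. \<forall>Xs\<in>set Xss. objs Xs"
  shows "s (map concat Xsss) \<cdot> Ea (map (\<lambda>Xss. Ta (s Xss)) Xsss) =
    s (concat Xsss) \<cdot> s (map (\<lambda>Xss. map (\<lambda>Xs. Eo (map To Xs)) Xss) Xsss)"
proof -
  let ?TX = "map (\<lambda>Xss. map (map To) Xss) Xsss"
  let ?c = "\<lambda>Xss. Ea (map (\<lambda>Xs. c Xs) Xss)"
  let ?Z = "\<lambda>Xss. map (\<lambda>Xs. Eo (map To Xs)) Xss"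
  have c: "c Xs \<in> Arr C \<and> Dom C (c Xs) = To (Eo (map To Xs)) \<and> Cod C (c Xs) = Eo (map To Xs)"
    if "Xss \<in> set Xsss" "Xs \<in> set Xss" for Xss Xs
    using that X by (intro conjI c_simps) auto
  have cs: "?c Xss \<in> Arr C \<and> Dom C (?c Xss) = Eo (map (\<lambda>Xs. To (Eo (map To Xs))) Xss) \<and>
      Cod C (?c Xss) = Eo (?Z Xss)" if "Xss \<in> set Xsss" for Xss
    using that X by simp
  have inner: "c (concat Xss) \<cdot> Ta (s Xss) =
      \<sigma> (map (map To) Xss) \<cdot> (?c Xss \<cdot> (Ea (map (\<lambda>Xs. \<mu> (Eo (map To Xs))) Xss) \<cdot>
        \<tau> (map (\<lambda>Xs. To (Eo (map To Xs))) Xss)))"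
    if Xss: "Xss \<in> set Xsss" for Xss
  proof -
    have X': "\<forall>Xs\<in>set Xss. objs Xs" using Xss X by blast
    have nat: "Ea (map (\<lambda>Xs. Ta (c Xs)) Xss) \<cdot> \<tau> (map (\<lambda>Xs. To (Eo (map To Xs))) Xss) =
        \<tau> (?Z Xss) \<cdot> Ta (?c Xss)"
      using X' by (intro \<tau>_nat) (simp add: c_simps)
    have "c (concat Xss) \<cdot> Ta (s Xss) =
        (c (concat Xss) \<cdot> Ta (\<sigma> (map (map To) Xss))) \<cdot> Ta (?c Xss)"
      using X' by (simp add: s_eq)
    also have "\<dots> = \<sigma> (map (map To) Xss) \<cdot> (?c Xss \<cdot> (\<tau> (?Z Xss) \<cdot> Ta (?c Xss)))"
      unfolding c_\<sigma>[OF X'] using X' by simp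
    also have "\<dots> = \<sigma> (map (map To) Xss) \<cdot> ((?c Xss \<cdot> Ea (map (\<lambda>Xs. Ta (c Xs)) Xss)) \<cdot>
        \<tau> (map (\<lambda>Xs. To (Eo (map To Xs))) Xss))"
      unfolding nat[symmetric] using X' by simp
    also have "?c Xss \<cdot> Ea (map (\<lambda>Xs. Ta (c Xs)) Xss) = Ea (map (\<lambda>Xs. c Xs \<cdot> Ta (c Xs)) Xss)"
      using X' by (intro Ea_comp[symmetric]) simp
    also have "\<dots> = Ea (map (\<lambda>Xs. c Xs \<cdot> \<mu> (Eo (map To Xs))) Xss)"
      using X' by (simp only: c_mult cong: list.map_cong_simp) (simp add: c_mult[symmetric] del: assoc Ta_comp)
    also have "\<dots> = ?c Xss \<cdot> Ea (map (\<lambda>Xs. \<mu> (Eo (map To Xs))) Xss)"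
      using X' by (intro Ea_comp) simp
    finally show ?thesis using X' by simp
  qed
  have nat: "Ea (concat (map (\<lambda>Xss. map (\<lambda>Xs. c Xs) Xss) Xsss)) \<cdot>
      \<sigma> (map (\<lambda>Xss. map (\<lambda>Xs. To (Eo (map To Xs))) Xss) Xsss) =
      \<sigma> (map ?Z Xsss) \<cdot> Ea (map ?c Xsss)"
    using c by (intro \<sigma>_nat) blast
  let ?r = "Ea (map (\<lambda>Xss. Ea (map (\<lambda>Xs. \<mu> (Eo (map To Xs))) Xss) \<cdot> \<tau> (map (\<lambda>Xs. To (Eo (map To Xs))) Xss)) Xsss)"
  have "s (map concat Xsss) \<cdot> Ea (map (\<lambda>Xss. Ta (s Xss)) Xsss) =
     \<sigma> (map concat ?TX) \<cdot> Ea (map (\<lambda>Xss. c (concat Xss) \<cdot> Ta (s Xss)) Xsss)"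
    using X by (simp add: s_eq Ea_comp)
  also have "map (\<lambda>Xss. c (concat Xss) \<cdot> Ta (s Xss)) Xsss =
      map (\<lambda>Xss. \<sigma> (map (map To) Xss) \<cdot> (?c Xss \<cdot>
        (Ea (map (\<lambda>Xs. \<mu> (Eo (map To Xs))) Xss) \<cdot> \<tau> (map (\<lambda>Xs. To (Eo (map To Xs))) Xss)))) Xsss"
    by (rule list.map_cong0) (rule inner)
  also have "\<sigma> (map concat ?TX) \<cdot> Ea \<dots> =
      (\<sigma> (map concat ?TX) \<cdot> Ea (map \<sigma> ?TX)) \<cdot> (Ea (map ?c Xsss) \<cdot> ?r)"
    using X by (simp add: Ea_comp)
  also have "\<sigma> (map concat ?TX) \<cdot> Ea (map \<sigma> ?TX) = \<sigma> (concat ?TX) \<cdot> \<sigma> (map ?Z Xsss)"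
    using X mult_assoc[of ?TX] by simp
  also have "(\<sigma> (concat ?TX) \<cdot> \<sigma> (map ?Z Xsss)) \<cdot> (Ea (map ?c Xsss) \<cdot> ?r) =
      \<sigma> (concat ?TX) \<cdot> ((\<sigma> (map ?Z Xsss) \<cdot> Ea (map ?c Xsss)) \<cdot> ?r)"
    using X by simp
  also have "\<dots> = s (concat Xsss) \<cdot> s (map (\<lambda>Xss. map (\<lambda>Xs. Eo (map To Xs)) Xss) Xsss)"
    unfolding nat[symmetric] using X by (simp add: s_eq)
  finally show ?thesis .
qed

text \<open>Recovers \<open>c\<close> from the substitution, by naturality of u and the left unit
  law of \<open>E\<close>. In the converse direction the left-hand side becomes the definition of
  \<open>c\<close>.\<close>

lemma s_unit_left:
  assumes "objs Xs"
  shows "s [Xs] \<cdot> u (To (Eo (map To Xs))) = c Xs"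
proof -
  have "s [Xs] \<cdot> u (To (Eo (map To Xs))) = \<sigma> [map To Xs] \<cdot> (Ea [c Xs] \<cdot> u (To (Eo (map To Xs))))"
    using assms by (simp add: s_eq)
  also have "Ea [c Xs] \<cdot> u (To (Eo (map To Xs))) = u (Eo (map To Xs)) \<cdot> c Xs"
    using assms by (subst u_nat) simp_all
  also have "\<sigma> [map To Xs] \<cdot> (u (Eo (map To Xs)) \<cdot> c Xs) = (\<sigma> [map To Xs] \<cdot> u (Eo (map To Xs))) \<cdot> c Xs"
    using assms by simp
  finally show ?thesis using assms by (simp add: mult_unit_left del: assoc)
qed

text \<open>By \<open>c_u\<close> each \<open>Tu\<close> becomes \<mu> followed by u, and the right
  unit law of \<open>E\<close> removes u. The enriched categories below need this form as
  well.\<close>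

lemma s_unary:
  assumes "objs Xs"
  shows "s (map (\<lambda>X. [X]) Xs) \<cdot> Ea (map (\<lambda>X. Ta (u (To X))) Xs) = Ea (map \<mu> Xs)"
proof -
  have "s (map (\<lambda>X. [X]) Xs) \<cdot> Ea (map (\<lambda>X. Ta (u (To X))) Xs) =
     \<sigma> (map (\<lambda>X. [To X]) Xs) \<cdot> Ea (map (\<lambda>X. c [X] \<cdot> Ta (u (To X))) Xs)"
    using assms by (simp add: s_eq Ea_comp)
  also have "map (\<lambda>X. c [X] \<cdot> Ta (u (To X))) Xs = map (\<lambda>X. u (To X) \<cdot> \<mu> X) Xs"
    by (rule list.map_cong0, rule c_u) (use assms in blast)
  also have "\<sigma> (map (\<lambda>X. [To X]) Xs) \<cdot> Ea \<dots> = (\<sigma> (map (\<lambda>X. [X]) (map To Xs)) \<cdot> Ea (map u (map To Xs))) \<cdot> Ea (map \<mu> Xs)"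
    using assms by (simp add: Ea_comp)
  also have "\<sigma> (map (\<lambda>X. [X]) (map To Xs)) \<cdot> Ea (map u (map To Xs)) = Ident C (Eo (map To Xs))"
    using assms by (subst mult_unit_right) simp_all
  finally show ?thesis using assms by simp
qed

lemma s_unit_right:
  assumes "objs Xs"
  shows "s (map (\<lambda>X. [X]) Xs) \<cdot> Ea (map (\<lambda>X. Ta (u (To X)) \<cdot> Ta (\<eta> X)) Xs) = Ident C (Eo (map To Xs))"
proof -
  have "s (map (\<lambda>X. [X]) Xs) \<cdot> Ea (map (\<lambda>X. Ta (u (To X)) \<cdot> Ta (\<eta> X)) Xs) =
     (s (map (\<lambda>X. [X]) Xs) \<cdot> Ea (map (\<lambda>X. Ta (u (To X))) Xs)) \<cdot> Ea (map (\<lambda>X. Ta (\<eta> X)) Xs)"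
    using assms by (simp add: Ea_comp)
  also have "\<dots> = Ident C (Eo (map To Xs))"
    unfolding s_unary[OF assms] using assms by (simp add: Ea_comp[symmetric] monad_unit_right)
  finally show ?thesis .
qed

text \<open>The \<eta> in front of each block cancels its \<open>c\<close> by \<open>c_unit\<close>,
  leaving \<sigma>.\<close>

lemma s_\<eta>:
  assumes X: "\<forall>Xs\<in>set Xss. objs Xs"
  shows "s Xss \<cdot> Ea (map (\<lambda>Xs. \<eta> (Eo (map To Xs))) Xss) = \<sigma> (map (map To) Xss)"
proof -
  have "s Xss \<cdot> Ea (map (\<lambda>Xs. \<eta> (Eo (map To Xs))) Xss) =
      \<sigma> (map (map To) Xss) \<cdot> Ea (map (\<lambda>Xs. c Xs \<cdot> \<eta> (Eo (map To Xs))) Xss)"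
    using X by (simp add: s_eq Ea_comp)
  also have "\<dots> = \<sigma> (map (map To) Xss)"
    using X by (simp add: c_unit del: assoc cong: list.map_cong_simp)
  finally show ?thesis .
qed

text \<open>Cases 1 to 4 are functoriality, 5 and 6 naturality of unit and substitution, 7 and 8 the
  unit laws, 9 associativity.\<close>

lemma EM_multitensor: "is_multitensor C (EM_multitensor C E T s)"
  unfolding is_multitensor_def is_functor_def
proof (intro conjI allI ballI impI, goal_cases)
  case (4 as bs cs fs gs)
  then have m: "map (Cod C) fs = map (Dom C) gs" by simp
  then obtain ps where ps: "fs = map fst ps" "gs = map snd ps" by (rule list_pair)
  have "\<forall>p\<in>set ps. Dom C (snd p) = Cod C (fst p)"
    using m unfolding ps by simp
  then have "\<forall>p\<in>set ps. fst p \<in> Arr C \<and> snd p \<in> Arr C \<and> Dom C (snd p) = Cod C (fst p)"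
    using 4 unfolding ps by (simp add: in_lists_conv_set)
  then show ?case unfolding ps by (simp add: Ea_comp)
next
  case 5
  show ?case unfolding is_natural_def
    by (intro conjI allI ballI impI) (simp_all add: \<eta>_nat comp_tail[OF u_nat])
next
  case 6
  show ?case unfolding is_natural_def
    by (intro conjI allI ballI impI) (auto simp: in_lists_conv_set s_nat[simplified])
next
  case (7 Xs)
  then show ?case using s_unit_left[of Xs] c_unit[of Xs]
    by (simp add: in_lists_conv_set flip: assoc)
next
  case (8 Xs)
  then show ?case using s_unit_right[of Xs] by (simp add: in_lists_conv_set)
next
  case (9 Xsss)
  then show ?case using s_assoc[of Xsss] by (simp add: in_lists_conv_set)
qed (simp_all add: in_lists_conv_set)

lemma EM_unit_map:
  "is_multitensor_map C E (EM_multitensor C E T s) (\<lambda>Xs. Ea (map \<eta> Xs))"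
  unfolding is_multitensor_map_def
proof (intro conjI ballI)
  show "is_natural (seq_cat C) C (tensor E) (tensor (EM_multitensor C E T s)) (\<lambda>Xs. Ea (map \<eta> Xs))"
    unfolding is_natural_def
  proof (intro conjI allI ballI impI)
    fix as bs fs assume "fs \<in> hom (seq_cat C) as bs"
    then have f: "\<forall>f\<in>set fs. f \<in> Arr C" and ab: "as = map (Dom C) fs" "bs = map (Cod C) fs"
      by (auto simp: in_lists_conv_set)
    show "Ea (map \<eta> bs) \<cdot> Ea fs = farr (tensor (EM_multitensor C E T s)) fs \<cdot> Ea (map \<eta> as)"
      unfolding ab using f Ea_comp[of fs "\<lambda>f. f" "\<lambda>f. \<eta> (Cod C f)"]
        Ea_comp[of fs "\<lambda>f. \<eta> (Dom C f)" Ta] by (simp add: \<eta>_nat)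
  qed (simp add: in_lists_conv_set)
  show "Ea (map \<eta> [X]) \<cdot> u X = tunit (EM_multitensor C E T s) X" if "X \<in> Obj C" for X
    using that by (simp add: u_nat)
  fix Xss assume "Xss \<in> lists (lists (Obj C))"
  then have X: "\<forall>Xs\<in>set Xss. objs Xs" by (simp add: in_lists_conv_set)
  have "Ea (map \<eta> (concat Xss)) \<cdot> \<sigma> Xss =
      \<sigma> (map (map To) Xss) \<cdot> Ea (map (\<lambda>Xs. Ea (map \<eta> Xs)) Xss)"
    using \<sigma>_nat[of Xss \<eta> "\<lambda>X. X" To] X by simp
  also have "\<dots> = s Xss \<cdot> (Ea (map (\<lambda>Xs. \<eta> (Eo (map To Xs))) Xss) \<cdot> Ea (map (\<lambda>Xs. Ea (map \<eta> Xs)) Xss))"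
    unfolding s_\<eta>[OF X, symmetric] using X by simp
  finally show "Ea (map \<eta> (concat Xss)) \<cdot> \<sigma> Xss = tsubst (EM_multitensor C E T s) Xss \<cdot>
      (Ea (map \<eta> (map (fobj (tensor (EM_multitensor C E T s))) Xss)) \<cdot> Ea (map (\<lambda>Xs. Ea (map \<eta> Xs)) Xss))"
    by simp
qed

lemma EM_monad_map:
  "is_monad_map C T (unary_monad (EM_multitensor C E T s)) (\<lambda>X. u (To X))"
  unfolding is_monad_map_def
proof (intro conjI ballI)
  show "is_natural C C (mfun T) (mfun (unary_monad (EM_multitensor C E T s))) (\<lambda>X. u (To X))"
    unfolding is_natural_def by (intro conjI allI ballI impI) (simp_all add: u_nat)
  fix X assume X: "X \<in> Obj C"
  have "s [[X]] \<cdot> (u (To (Eo [To X])) \<cdot> Ta (u (To X))) = (s [[X]] \<cdot> u (To (Eo [To X]))) \<cdot> Ta (u (To X))"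
    using X by simp
  then show "u (To X) \<cdot> \<mu> X = mmult (unary_monad (EM_multitensor C E T s)) X \<cdot>
      (u (To (fobj (mfun (unary_monad (EM_multitensor C E T s))) X)) \<cdot> Ta (u (To X)))"
    using X s_unit_left[of "[X]"] c_u[OF X] by (simp del: assoc)
qed simp

text \<open>Only the last condition is still open: \<open>s_\<eta>\<close> absorbs its \<eta>, and
  the right unit law of \<open>E\<close> at the objects \<open>TX\<close> remains.\<close>

lemma substitution_of_substitution: "s \<in> EM_substitutions C E T"
proof -
  have "s (map (\<lambda>X. [X]) Xs) \<cdot> Ea (map (\<lambda>X. \<eta> (Eo [To X]) \<cdot> u (To X)) Xs) = Ident C (Eo (map To Xs))"
    if X: "objs Xs" for Xs
  proof -
    have "s (map (\<lambda>X. [X]) Xs) \<cdot> Ea (map (\<lambda>X. \<eta> (Eo [To X]) \<cdot> u (To X)) Xs) =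
       (s (map (\<lambda>X. [X]) Xs) \<cdot> Ea (map (\<lambda>X. \<eta> (Eo [To X])) Xs)) \<cdot> Ea (map (\<lambda>X. u (To X)) Xs)"
      using X by (simp add: Ea_comp)
    also have "s (map (\<lambda>X. [X]) Xs) \<cdot> Ea (map (\<lambda>X. \<eta> (Eo [To X])) Xs) = \<sigma> (map (\<lambda>X. [To X]) Xs)"
      using s_\<eta>[of "map (\<lambda>X. [X]) Xs"] X by simp
    finally show ?thesis using X mult_unit_right[of "map To Xs"] by simp
  qed
  then show ?thesis unfolding EM_substitutions_def
    by (simp add: EM_multitensor EM_unit_map EM_monad_map in_lists_conv_set del: assoc)
      (simp add: substitution_of_def)
qed

end

lemma (in setting) substitution_of_inj:
  "inj_on (substitution_of C E T) (opmonoidal_structures C E T)"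
proof (rule inj_onI)
  fix t t' assume t: "t \<in> opmonoidal_structures C E T" and t': "t' \<in> opmonoidal_structures C E T"
    and eq: "substitution_of C E T t = substitution_of C E T t'"
  interpret a: opmon C T E t by unfold_locales (rule t)
  interpret b: opmon C T E t' by unfold_locales (rule t')
  have "t Xs = t' Xs" if Xs: "Xs \<in> lists (Obj C)" for Xs
  proof -
    have X: "objs Xs" using Xs by (simp add: in_lists_conv_set)
    have "a.c Xs = b.c Xs" using a.s_unit_left[OF X] b.s_unit_left[OF X] eq by metis
    then show ?thesis using a.\<tau>_eq_free[OF X] b.\<tau>_eq_free[OF X]
      by (simp add: a.snd_L_free b.snd_L_free del: assoc)
  qed
  moreover have "t \<in> extensional (lists (Obj C))" "t' \<in> extensional (lists (Obj C))"
    using t t' by (auto simp: opmonoidal_structures_def)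
  ultimately show "t = t'" by (metis extensionalityI)
qed

section \<open>From a substitution to an opmonoidal structure\<close>

locale substitution = setting C T E for C :: "('o, 'a) category" (structure) and T E +
  fixes s :: "'o list list \<Rightarrow> 'a"
  assumes substitution: "s \<in> EM_substitutions C E T"

sublocale substitution \<subseteq> em: multi C "EM_multitensor C E T s"
  by unfold_locales (use substitution in \<open>simp add: EM_substitutions_def\<close>)

context substitution
begin

lemma s_simps [simp]:
  assumes "\<forall>Xs\<in>set Xss. objs Xs"
  shows "s Xss \<in> Arr C" "Dom C (s Xss) = Eo (map (\<lambda>Xs. To (Eo (map To Xs))) Xss)"
    "Cod C (s Xss) = Eo (map To (concat Xss))"
  using em.\<sigma>_simps[OF assms] by simp_all

lemma s_nat:
  assumes "\<forall>is\<in>set iss. \<forall>i\<in>set is. f i \<in> Arr C \<and> Dom C (f i) = a i \<and> Cod C (f i) = b i"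
  shows "Ea (concat (map (\<lambda>is. map (\<lambda>i. Ta (f i)) is) iss)) \<cdot> s (map (map a) iss) =
    s (map (map b) iss) \<cdot> Ea (map (\<lambda>is. Ta (Ea (map (\<lambda>i. Ta (f i)) is))) iss)"
  using em.\<sigma>_nat[OF assms] by simp

lemma s_assoc:
  assumes "\<forall>Xss\<in>set Xsss. \<forall>Xs\<in>set Xss. objs Xs"
  shows "s (map concat Xsss) \<cdot> Ea (map (\<lambda>Xss. Ta (s Xss)) Xsss) =
    s (concat Xsss) \<cdot> s (map (\<lambda>Xss. map (\<lambda>Xs. Eo (map To Xs)) Xss) Xsss)"
  using em.mult_assoc[OF assms] by simp

lemma s_unit:
  assumes "objs Xs"
  shows "s [Xs] \<cdot> (u (To (Eo (map To Xs))) \<cdot> \<eta> (Eo (map To Xs))) = Ident C (Eo (map To Xs))"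
  using em.mult_unit_left[OF assms] by simp

lemma s_\<sigma>:
  assumes "\<forall>Xs\<in>set Xss. objs Xs"
  shows "Ea (map \<eta> (concat Xss)) \<cdot> \<sigma> Xss =
    s Xss \<cdot> (Ea (map (\<lambda>Xs. \<eta> (Eo (map To Xs))) Xss) \<cdot> Ea (map (\<lambda>Xs. Ea (map \<eta> Xs)) Xss))"
  using substitution assms
  by (simp add: EM_substitutions_def is_multitensor_map_def in_lists_conv_set)

lemma s_\<mu>:
  assumes "X \<in> Obj C"
  shows "u (To X) \<cdot> \<mu> X = s [[X]] \<cdot> (u (To (Eo [To X])) \<cdot> Ta (u (To X)))"
  using substitution assms
  by (simp add: EM_substitutions_def is_monad_map_def)

lemma s_middle:
  assumes "objs Xs"
  shows "s (map (\<lambda>X. [X]) Xs) \<cdot> Ea (map (\<lambda>X. \<eta> (Eo [To X]) \<cdot> u (To X)) Xs) = Ident C (Eo (map To Xs))"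
  using substitution assms
  by (simp add: EM_substitutions_def in_lists_conv_set del: assoc)

text \<open>That \<open>E\<eta>\<close> is a multitensor map yields this equation only after
  precomposition with \<open>EE\<eta>\<close>. To remove it, \<open>s_middle\<close> inserts the
  identity \<open>s \<circ> E(\<eta>u)\<close> to the left of \<sigma>; u is moved past \<sigma>,
  \<open>s_\<sigma>\<close> applies to the inserted \<eta>, and associativity of \<open>s\<close>
  merges the two substitutions.\<close>

lemma s_\<eta>:
  assumes X: "\<forall>Xs\<in>set Xss. objs Xs"
  shows "s Xss \<cdot> Ea (map (\<lambda>Xs. \<eta> (Eo (map To Xs))) Xss) = \<sigma> (map (map To) Xss)"
proof -
  let ?W = "concat (map (\<lambda>Xs. map (\<lambda>X. [X]) Xs) Xss)"
  let ?TX = "map (map To) Xss"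
  let ?Y = "map (\<lambda>Xs. map (\<lambda>X. Eo [To X]) Xs) Xss"
  let ?Eu = "Ea (map (\<lambda>Xs. Ea (map (\<lambda>X. u (To X)) Xs)) Xss)"
  let ?\<eta> = "Ea (map (\<lambda>X. \<eta> (Eo [To X])) (concat Xss))"
  have u: "Ea (concat (map (\<lambda>Xs. map (\<lambda>X. u (To X)) Xs) Xss)) \<cdot> \<sigma> ?TX = \<sigma> ?Y \<cdot> ?Eu"
    using X by (intro \<sigma>_nat) simp
  have assoc_s: "s ?W \<cdot> s ?Y = s Xss \<cdot> Ea (map (\<lambda>Xs. Ta (s (map (\<lambda>X. [X]) Xs))) Xss)"
    using s_assoc[of "map (\<lambda>Xs. map (\<lambda>X. [X]) Xs) Xss"] X by simp
  \<comment> \<open>What the insertion leaves in one block: naturality of \<eta> brings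
    \<open>s\<close> in front of \<open>E(\<eta>u)\<close>, where \<open>s_middle\<close> for this
    block applies.\<close>
  have inner: "Ta (s (map (\<lambda>X. [X]) Xs)) \<cdot> (\<eta> (Eo (map (\<lambda>X. To (Eo [To X])) Xs)) \<cdot>
      (Ea (map (\<lambda>X. \<eta> (Eo [To X])) Xs) \<cdot> Ea (map (\<lambda>X. u (To X)) Xs))) = \<eta> (Eo (map To Xs))"
    if "Xs \<in> set Xss" for Xs
  proof -
    have X': "objs Xs" using X that by blast
    have m: "s (map (\<lambda>X. [X]) Xs) \<cdot> (Ea (map (\<lambda>X. \<eta> (Eo [To X])) Xs) \<cdot> Ea (map (\<lambda>X. u (To X)) Xs)) =
        Ident C (Eo (map To Xs))"
      using s_middle[OF X'] X' by (simp add: Ea_comp)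
    have "Ta (s (map (\<lambda>X. [X]) Xs)) \<cdot> (\<eta> (Eo (map (\<lambda>X. To (Eo [To X])) Xs)) \<cdot>
      (Ea (map (\<lambda>X. \<eta> (Eo [To X])) Xs) \<cdot> Ea (map (\<lambda>X. u (To X)) Xs))) =
      (Ta (s (map (\<lambda>X. [X]) Xs)) \<cdot> \<eta> (Eo (map (\<lambda>X. To (Eo [To X])) Xs))) \<cdot>
      (Ea (map (\<lambda>X. \<eta> (Eo [To X])) Xs) \<cdot> Ea (map (\<lambda>X. u (To X)) Xs))"
      using X' by simp
    also have "\<dots> = (\<eta> (Eo (map To Xs)) \<cdot> s (map (\<lambda>X. [X]) Xs)) \<cdot>
      (Ea (map (\<lambda>X. \<eta> (Eo [To X])) Xs) \<cdot> Ea (map (\<lambda>X. u (To X)) Xs))"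
      using X' by (subst \<eta>_nat) simp_all
    also have "\<dots> = \<eta> (Eo (map To Xs))" using X' m by simp
    finally show ?thesis .
  qed
  have "\<sigma> ?TX = (s ?W \<cdot> Ea (map (\<lambda>X. \<eta> (Eo [To X]) \<cdot> u (To X)) (concat Xss))) \<cdot> \<sigma> ?TX"
    using s_middle[of "concat Xss"] X by simp
  also have "\<dots> = s ?W \<cdot> (?\<eta> \<cdot> (Ea (concat (map (\<lambda>Xs. map (\<lambda>X. u (To X)) Xs) Xss)) \<cdot> \<sigma> ?TX))"
    using X Ea_comp[of "concat Xss" "\<lambda>X. u (To X)" "\<lambda>X. \<eta> (Eo [To X])"] by simp
  also have "\<dots> = s ?W \<cdot> ((Ea (map \<eta> (concat ?Y)) \<cdot> \<sigma> ?Y) \<cdot> ?Eu)"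
    unfolding u using X by simp
  also have "\<dots> = (s ?W \<cdot> s ?Y) \<cdot> (Ea (map (\<lambda>Xs. \<eta> (Eo (map (\<lambda>X. To (Eo [To X])) Xs))) Xss) \<cdot>
      (Ea (map (\<lambda>Xs. Ea (map (\<lambda>X. \<eta> (Eo [To X])) Xs)) Xss) \<cdot> ?Eu))"
    using X by (subst s_\<sigma>) simp_all
  also have "\<dots> = s Xss \<cdot> Ea (map (\<lambda>Xs. Ta (s (map (\<lambda>X. [X]) Xs)) \<cdot> (\<eta> (Eo (map (\<lambda>X. To (Eo [To X])) Xs)) \<cdot>
      (Ea (map (\<lambda>X. \<eta> (Eo [To X])) Xs) \<cdot> Ea (map (\<lambda>X. u (To X)) Xs)))) Xss)"
    unfolding assoc_s using X by (simp add: Ea_comp)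
  also have "map (\<lambda>Xs. Ta (s (map (\<lambda>X. [X]) Xs)) \<cdot> (\<eta> (Eo (map (\<lambda>X. To (Eo [To X])) Xs)) \<cdot>
      (Ea (map (\<lambda>X. \<eta> (Eo [To X])) Xs) \<cdot> Ea (map (\<lambda>X. u (To X)) Xs)))) Xss =
      map (\<lambda>Xs. \<eta> (Eo (map To Xs))) Xss"
    by (rule list.map_cong0) (rule inner)
  finally show ?thesis ..
qed

text \<open>The hypotheses mention \<mu> only in \<open>s_\<mu>\<close>, under a u. One use of
  \<open>s_middle\<close> supplies that u; after associativity a second use, at the objects
  \<open>Eo [To X]\<close>, removes the surplus \<open>\<eta>u\<close>.\<close>

lemma s_unary:
  assumes X: "objs Xs"
  shows "s (map (\<lambda>X. [X]) Xs) \<cdot> Ea (map (\<lambda>X. Ta (u (To X))) Xs) = Ea (map \<mu> Xs)"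
proof -
  let ?s = "s (map (\<lambda>X. [X]) Xs)" and ?\<eta>u = "\<lambda>X. \<eta> (Eo [To X]) \<cdot> u (To X)"
  have inner: "\<eta> (Eo [To X]) \<cdot> (u (To X) \<cdot> \<mu> X) = Ta (s [[X]]) \<cdot> (?\<eta>u (Eo [To X]) \<cdot> Ta (u (To X)))"
    if "X \<in> set Xs" for X
  proof -
    have X': "X \<in> Obj C" using that X by blast
    have "\<eta> (Eo [To X]) \<cdot> (u (To X) \<cdot> \<mu> X) = (\<eta> (Eo [To X]) \<cdot> s [[X]]) \<cdot> (u (To (Eo [To X])) \<cdot> Ta (u (To X)))"
      unfolding s_\<mu>[OF X'] using X' by simp
    also have "\<eta> (Eo [To X]) \<cdot> s [[X]] = Ta (s [[X]]) \<cdot> \<eta> (Eo [To (Eo [To X])])"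
      using X' by (subst \<eta>_nat) simp_all
    finally show ?thesis using X' by simp
  qed
  have middle: "s (map (\<lambda>X. [Eo [To X]]) Xs) \<cdot> Ea (map (\<lambda>X. ?\<eta>u (Eo [To X])) Xs) =
      Ident C (Eo (map (\<lambda>X. To (Eo [To X])) Xs))"
    using s_middle[of "map (\<lambda>X. Eo [To X]) Xs"] X by simp
  have assoc_s: "?s \<cdot> Ea (map (\<lambda>X. Ta (s [[X]])) Xs) = ?s \<cdot> s (map (\<lambda>X. [Eo [To X]]) Xs)"
    using s_assoc[of "map (\<lambda>X. [[X]]) Xs"] X by simp
  have "Ea (map \<mu> Xs) = (?s \<cdot> Ea (map ?\<eta>u Xs)) \<cdot> Ea (map \<mu> Xs)"
    unfolding s_middle[OF X] using X by simp
  also have "\<dots> = ?s \<cdot> Ea (map (\<lambda>X. \<eta> (Eo [To X]) \<cdot> (u (To X) \<cdot> \<mu> X)) Xs)"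
    using X by (simp add: Ea_comp)
  also have "map (\<lambda>X. \<eta> (Eo [To X]) \<cdot> (u (To X) \<cdot> \<mu> X)) Xs =
      map (\<lambda>X. Ta (s [[X]]) \<cdot> (?\<eta>u (Eo [To X]) \<cdot> Ta (u (To X)))) Xs"
    by (rule list.map_cong0) (rule inner)
  also have "?s \<cdot> Ea \<dots> = (?s \<cdot> Ea (map (\<lambda>X. Ta (s [[X]])) Xs)) \<cdot>
      (Ea (map (\<lambda>X. ?\<eta>u (Eo [To X])) Xs) \<cdot> Ea (map (\<lambda>X. Ta (u (To X))) Xs))"
    using X by (simp add: Ea_comp)
  also have "\<dots> = ?s \<cdot> ((s (map (\<lambda>X. [Eo [To X]]) Xs) \<cdot> Ea (map (\<lambda>X. ?\<eta>u (Eo [To X])) Xs)) \<cdot>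
      Ea (map (\<lambda>X. Ta (u (To X))) Xs))"
    unfolding assoc_s using X by simp
  also have "\<dots> = ?s \<cdot> Ea (map (\<lambda>X. Ta (u (To X))) Xs)"
    unfolding middle using X by simp
  finally show ?thesis ..
qed

text \<open>The formula found in \<open>s_unit_left\<close>: the algebra structure on
  \<open>ETX\<close> that any opmonoidal structure inducing \<open>s\<close> must have.\<close>

definition cs where "cs Xs = s [Xs] \<cdot> u (To (Eo (map To Xs)))"

lemma cs_simps [simp]:
  assumes "objs Xs"
  shows "cs Xs \<in> Arr C" "Dom C (cs Xs) = To (Eo (map To Xs))" "Cod C (cs Xs) = Eo (map To Xs)"
  using assms by (simp_all add: cs_def)

text \<open>By \<open>s_\<eta>\<close> the left-hand side is
  \<open>s \<circ> E(\<eta> \<circ> cs)\<close>. Naturality of \<eta> exposes a substitution under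
  \<open>T\<close>, associativity combines it with the outer one, and \<open>s_middle\<close>
  removes the extra layer.\<close>

lemma s_eq:
  assumes X: "\<forall>Xs\<in>set Xss. objs Xs"
  shows "\<sigma> (map (map To) Xss) \<cdot> Ea (map cs Xss) = s Xss"
proof -
  let ?Z = "\<lambda>Xs. Eo (map To Xs)"
  let ?\<eta>u = "\<lambda>X. \<eta> (Eo [To X]) \<cdot> u (To X)"
  have inner: "\<eta> (?Z Xs) \<cdot> cs Xs = Ta (s [Xs]) \<cdot> ?\<eta>u (?Z Xs)" if "Xs \<in> set Xss" for Xs
  proof -
    have X': "objs Xs" using that X by blast
    have "\<eta> (?Z Xs) \<cdot> cs Xs = (\<eta> (?Z Xs) \<cdot> s [Xs]) \<cdot> u (To (?Z Xs))"
      using X' by (simp add: cs_def)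
    also have "\<eta> (?Z Xs) \<cdot> s [Xs] = Ta (s [Xs]) \<cdot> \<eta> (Eo [To (?Z Xs)])"
      using X' by (subst \<eta>_nat) simp_all
    finally show ?thesis using X' by simp
  qed
  have middle: "s (map (\<lambda>Xs. [?Z Xs]) Xss) \<cdot> Ea (map (\<lambda>Xs. ?\<eta>u (?Z Xs)) Xss) =
      Ident C (Eo (map (\<lambda>Xs. To (?Z Xs)) Xss))"
    using s_middle[of "map ?Z Xss"] X by simp
  have assoc_s: "s Xss \<cdot> Ea (map (\<lambda>Xs. Ta (s [Xs])) Xss) = s Xss \<cdot> s (map (\<lambda>Xs. [?Z Xs]) Xss)"
    using s_assoc[of "map (\<lambda>Xs. [Xs]) Xss"] X by simp
  have "\<sigma> (map (map To) Xss) \<cdot> Ea (map cs Xss) = s Xss \<cdot> Ea (map (\<lambda>Xs. \<eta> (?Z Xs) \<cdot> cs Xs) Xss)"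
    unfolding s_\<eta>[OF X, symmetric] using X by (simp add: Ea_comp)
  also have "map (\<lambda>Xs. \<eta> (?Z Xs) \<cdot> cs Xs) Xss = map (\<lambda>Xs. Ta (s [Xs]) \<cdot> ?\<eta>u (?Z Xs)) Xss"
    by (rule list.map_cong0) (rule inner)
  also have "s Xss \<cdot> Ea \<dots> = (s Xss \<cdot> Ea (map (\<lambda>Xs. Ta (s [Xs])) Xss)) \<cdot> Ea (map (\<lambda>Xs. ?\<eta>u (?Z Xs)) Xss)"
    using X by (simp add: Ea_comp)
  also have "\<dots> = s Xss \<cdot> (s (map (\<lambda>Xs. [?Z Xs]) Xss) \<cdot> Ea (map (\<lambda>Xs. ?\<eta>u (?Z Xs)) Xss))"
    unfolding assoc_s using X by simp
  also have "\<dots> = s Xss" unfolding middle using X by simp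
  finally show ?thesis .
qed

text \<open>Cases 5, 7 and 9 are associativity of \<open>s\<close> together with naturality of u,
  where \<mu> has first been written through \<open>s\<close> (by \<open>s_unary\<close> or
  \<open>s_\<mu>\<close>), and \<sigma> by \<open>s_\<eta>\<close>. Case 4 is naturality, case 6 the
  left unit law, and case 8 is \<open>s_\<mu>\<close> itself.\<close>

lemma free_structures: "free_structures C T E cs"
proof (unfold_locales, goal_cases)
  case (4 fs)
  have "Ea (map Ta fs) \<cdot> cs (map (Dom C) fs) = (Ea (map Ta fs) \<cdot> s [map (Dom C) fs]) \<cdot> u (To (Eo (map (\<lambda>f. To (Dom C f)) fs)))"
    using 4 by (simp add: cs_def)
  also have "Ea (map Ta fs) \<cdot> s [map (Dom C) fs] = s [map (Cod C) fs] \<cdot> Ea [Ta (Ea (map Ta fs))]"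
    using s_nat[of "[fs]" "\<lambda>f. f" "Dom C" "Cod C"] 4 by simp
  finally show ?case using 4 by (simp add: cs_def u_nat)
next
  case (5 Xs)
  let ?Y = "map (\<lambda>X. Eo [To X]) Xs" and ?Tu = "Ea (map (\<lambda>X. Ta (u (To X))) Xs)" and ?W = "map (\<lambda>X. [X]) Xs"
  have "Ea (map \<mu> Xs) \<cdot> cs (map To Xs) = s ?W \<cdot> ((?Tu \<cdot> s [map To Xs]) \<cdot> u (To (Eo (map (\<lambda>X. To (To X)) Xs))))"
    unfolding s_unary[OF 5, symmetric] using 5 by (simp add: cs_def)
  also have "?Tu \<cdot> s [map To Xs] = s [?Y] \<cdot> Ea [Ta ?Tu]"
    using s_nat[of "[Xs]" "\<lambda>X. u (To X)" To "\<lambda>X. Eo [To X]"] 5 by simp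
  also have "s ?W \<cdot> ((s [?Y] \<cdot> Ea [Ta ?Tu]) \<cdot> u (To (Eo (map (\<lambda>X. To (To X)) Xs)))) =
      (s ?W \<cdot> s [?Y]) \<cdot> (Ea [Ta ?Tu] \<cdot> u (To (Eo (map (\<lambda>X. To (To X)) Xs))))"
    using 5 by simp
  also have "s ?W \<cdot> s [?Y] = s [Xs] \<cdot> Ea [Ta (s ?W)]"
    using s_assoc[of "[?W]"] 5 by simp
  also have "Ea [Ta ?Tu] \<cdot> u (To (Eo (map (\<lambda>X. To (To X)) Xs))) =
      u (To (Eo (map (\<lambda>X. To (Eo [To X])) Xs))) \<cdot> Ta ?Tu"
    using 5 by (subst u_nat) simp_all
  also have "(s [Xs] \<cdot> Ea [Ta (s ?W)]) \<cdot> (u (To (Eo (map (\<lambda>X. To (Eo [To X])) Xs))) \<cdot> Ta ?Tu) =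
      s [Xs] \<cdot> ((Ea [Ta (s ?W)] \<cdot> u (To (Eo (map (\<lambda>X. To (Eo [To X])) Xs)))) \<cdot> Ta ?Tu)"
    using 5 by simp
  also have "Ea [Ta (s ?W)] \<cdot> u (To (Eo (map (\<lambda>X. To (Eo [To X])) Xs))) = u (To (Eo (map To Xs))) \<cdot> Ta (s ?W)"
    using 5 by (subst u_nat) simp_all
  also have "s [Xs] \<cdot> ((u (To (Eo (map To Xs))) \<cdot> Ta (s ?W)) \<cdot> Ta ?Tu) = cs Xs \<cdot> Ta (s ?W \<cdot> ?Tu)"
    using 5 by (simp add: cs_def)
  finally show ?case unfolding s_unary[OF 5] .
next
  case (6 Xs)
  then show ?case using s_unit[OF 6] by (simp add: cs_def)
next
  case (7 Xs)
  let ?Z = "Eo (map To Xs)"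
  have "cs Xs \<cdot> \<mu> ?Z = s [Xs] \<cdot> (u (To ?Z) \<cdot> \<mu> ?Z)" using 7 by (simp add: cs_def)
  also have "\<dots> = (s [Xs] \<cdot> s [[?Z]]) \<cdot> (u (To (Eo [To ?Z])) \<cdot> Ta (u (To ?Z)))"
    using 7 by (subst s_\<mu>) simp_all
  also have "s [Xs] \<cdot> s [[?Z]] = s [Xs] \<cdot> Ea [Ta (s [Xs])]"
    using s_assoc[of "[[Xs]]"] 7 by simp
  also have "(s [Xs] \<cdot> Ea [Ta (s [Xs])]) \<cdot> (u (To (Eo [To ?Z])) \<cdot> Ta (u (To ?Z))) =
      s [Xs] \<cdot> ((Ea [Ta (s [Xs])] \<cdot> u (To (Eo [To ?Z]))) \<cdot> Ta (u (To ?Z)))"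
    using 7 by simp
  also have "Ea [Ta (s [Xs])] \<cdot> u (To (Eo [To ?Z])) = u (To ?Z) \<cdot> Ta (s [Xs])"
    using 7 by (subst u_nat) simp_all
  finally show ?case using 7 by (simp add: cs_def)
next
  case (8 X)
  then show ?case by (simp add: cs_def s_\<mu>)
next
  case (9 Xss)
  let ?Z = "map (\<lambda>Xs. Eo (map To Xs)) Xss" and ?TX = "map (map To) Xss"
  let ?u = "u (To (Eo (map To (concat Xss))))"
  have "cs (concat Xss) \<cdot> Ta (\<sigma> ?TX) = s [concat Xss] \<cdot> ((?u \<cdot> Ta (s Xss)) \<cdot> Ta (Ea (map \<eta> ?Z)))"
    unfolding s_\<eta>[OF 9, symmetric] using 9 by (simp add: cs_def)
  also have "?u \<cdot> Ta (s Xss) = Ea [Ta (s Xss)] \<cdot> u (To (Eo (map To ?Z)))"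
    using 9 by (subst u_nat) simp_all
  also have "s [concat Xss] \<cdot> ((Ea [Ta (s Xss)] \<cdot> u (To (Eo (map To ?Z)))) \<cdot> Ta (Ea (map \<eta> ?Z))) =
      (s [concat Xss] \<cdot> Ea [Ta (s Xss)]) \<cdot> (u (To (Eo (map To ?Z))) \<cdot> Ta (Ea (map \<eta> ?Z)))"
    using 9 by simp
  also have "s [concat Xss] \<cdot> Ea [Ta (s Xss)] = s Xss \<cdot> s [?Z]"
    using s_assoc[of "[Xss]"] 9 by simp
  also have "(s Xss \<cdot> s [?Z]) \<cdot> (u (To (Eo (map To ?Z))) \<cdot> Ta (Ea (map \<eta> ?Z))) =
      s Xss \<cdot> (cs ?Z \<cdot> Ta (Ea (map \<eta> ?Z)))"
    using 9 by (simp add: cs_def)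
  also have "\<dots> = \<sigma> ?TX \<cdot> (Ea (map cs Xss) \<cdot> (cs ?Z \<cdot> Ta (Ea (map \<eta> ?Z))))"
    unfolding s_eq[OF 9, symmetric] using 9 by simp
  finally show ?case .
qed simp_all

lemma substitution_surj: "\<exists>\<tau>\<in>opmonoidal_structures C E T. substitution_of C E T \<tau> = s"
proof -
  define t where "t = (\<lambda>Xs. cs Xs \<cdot> Ta (Ea (map \<eta> Xs)))"
  interpret free_structures C T E cs t
    unfolding t_def by (rule free_structures)
  have "substitution_of C E T (restrict t (lists (Obj C))) Xss = s Xss"
    if Xss: "Xss \<in> lists (lists (Obj C))" for Xss
  proof -
    have X: "\<forall>Xs\<in>set Xss. objs Xs" using Xss by (simp add: in_lists_conv_set)
    have "map (\<lambda>Xs. Ea (map \<mu> Xs) \<cdot> restrict t (lists (Obj C)) (map To Xs)) Xss = map cs Xss"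
      using X by (intro list.map_cong0) (simp add: in_lists_conv_set \<mu>_t)
    then show ?thesis using Xss s_eq[OF X] by (simp only: substitution_of_def restrict_apply if_True)
  qed
  moreover have "s Xss = undefined" if "Xss \<notin> lists (lists (Obj C))" for Xss
    using substitution that unfolding EM_substitutions_def mem_Collect_eq
    by (blast intro: extensional_arb)
  ultimately have "substitution_of C E T (restrict t (lists (Obj C))) = s"
    by (intro ext) (simp add: substitution_of_def restrict_def)
  then show ?thesis using t_opmonoidal by blast
qed

end

lemma (in setting) substitution_of_bij:
  "bij_betw (substitution_of C E T) (opmonoidal_structures C E T) (EM_substitutions C E T)"
  unfolding bij_betw_def
proof (intro conjI equalityI subsetI substitution_of_inj)
  fix s assume "s \<in> substitution_of C E T ` opmonoidal_structures C E T"
  then obtain t where t: "t \<in> opmonoidal_structures C E T" "s = substitution_of C E T t" by blast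
  interpret opmon C T E t by unfold_locales (rule t)
  show "s \<in> EM_substitutions C E T" unfolding t(2) by (rule substitution_of_substitution)
next
  fix s assume s: "s \<in> EM_substitutions C E T"
  interpret substitution C T E s by unfold_locales (rule s)
  show "s \<in> substitution_of C E T ` opmonoidal_structures C E T" using substitution_surj by blast
qed

section \<open>Paths and enriched categories\<close>

lemma steps_simps [simp]:
  "steps [] = []" "steps [x] = []" "steps (x # y # zs) = (x, y) # steps (y # zs)"
  by (simp_all add: steps_def)

lemma set_steps: "p \<in> set (steps xs) \<Longrightarrow> set xs \<subseteq> A \<Longrightarrow> p \<in> A \<times> A"
  by (induction xs rule: induct_list012) auto

lemma steps_map: "steps (map f xs) = map (\<lambda>p. (f (fst p), f (snd p))) (steps xs)"
  by (induction xs rule: induct_list012) auto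

lemma ends_mem: "xs \<noteq> [] \<Longrightarrow> set xs \<subseteq> A \<Longrightarrow> ends xs \<in> A \<times> A"
  by (auto simp: ends_def)

lemma ends_map: "xs \<noteq> [] \<Longrightarrow> ends (map f xs) = (f (fst (ends xs)), f (snd (ends xs)))"
  by (simp add: ends_def hd_map last_map)

lemma ends_pair [simp]: "ends [x, y] = (x, y)"
  by (simp add: ends_def)

lemma path_homs_simps [simp]: "path_homs X xs = map (ghom X) (steps xs)"
  by (simp add: path_homs_def)

lemma steps_append_tl: "xs \<noteq> [] \<Longrightarrow> steps (xs @ ys) = steps xs @ steps (last xs # ys)"
  by (induction xs rule: induct_list012) auto

text \<open>Each block after the first begins where the previous one ends, so dropping the heads
  removes just the repeated vertices and neither loses nor adds a step.\<close>

lemma nested_pathsD: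
  assumes "(ys, pss) \<in> nested_paths A"
  shows "ys \<noteq> []" "set ys \<subseteq> A" "join ys pss \<noteq> []" "set (join ys pss) \<subseteq> A"
    "ends (join ys pss) = ends ys" "steps (join ys pss) = concat (map steps pss)"
    "steps ys = map ends pss" "\<And>ps. ps \<in> set pss \<Longrightarrow> ps \<noteq> [] \<and> set ps \<subseteq> A"
proof -
  have *: "join ys pss \<noteq> [] \<and> set (join ys pss) \<subseteq> A \<and> ends (join ys pss) = ends ys \<and>
      steps (join ys pss) = concat (map steps pss) \<and> steps ys = map ends pss \<and>
      (\<forall>ps\<in>set pss. ps \<noteq> [] \<and> set ps \<subseteq> A)"
    if "ys \<noteq> []" "set ys \<subseteq> A" "list_all2 (\<lambda>(a, b) ps. ps \<in> paths A a b) (steps ys) pss"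
    using that
  proof (induction ys arbitrary: pss rule: induct_list012)
    case (3 x y zs)
    from 3(5) obtain ps qss where pss: "pss = ps # qss" "ps \<in> paths A x y"
      and q: "list_all2 (\<lambda>(a, b) ps. ps \<in> paths A a b) (steps (y # zs)) qss"
      by (auto simp: list_all2_Cons1)
    have ps: "ps \<noteq> []" "set ps \<subseteq> A" "hd ps = x" "last ps = y"
      using pss(2) by (auto simp: paths_def)
    have "y # zs \<noteq> []" "set (y # zs) \<subseteq> A" using 3(4) by simp_all
    from 3(2)[OF this q] have IH: "set (join (y # zs) qss) \<subseteq> A" "ends (join (y # zs) qss) = ends (y # zs)"
      "steps (join (y # zs) qss) = concat (map steps qss)" "steps (y # zs) = map ends qss"
      "\<forall>ps\<in>set qss. ps \<noteq> [] \<and> set ps \<subseteq> A"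
      by blast+
    have j: "join (x # y # zs) pss = ps @ concat (map tl qss)"
      using ps pss by (cases ps) (auto simp: join_def)
    have j': "join (y # zs) qss = y # concat (map tl qss)"
      by (simp add: join_def)
    have last: "last (ps @ concat (map tl qss)) = last (y # concat (map tl qss))"
      using ps by (simp add: last_append)
    have "set (concat (map tl qss)) \<subseteq> A" using IH(1) unfolding j' by simp
    moreover have "steps (ps @ concat (map tl qss)) = steps ps @ concat (map steps qss)"
      using steps_append_tl[OF ps(1)] ps(4) IH(3) unfolding j' by simp
    moreover have "ends (ps @ concat (map tl qss)) = ends (x # y # zs)"
      using IH(2) ps last unfolding j' by (simp add: ends_def)
    ultimately show ?case unfolding j using IH(4,5) ps pss(1) by (simp add: ends_def)
  qed (simp_all add: join_def ends_def)
  have ys: "ys \<noteq> []" "set ys \<subseteq> A" "list_all2 (\<lambda>(a, b) ps. ps \<in> paths A a b) (steps ys) pss"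
    using assms unfolding nested_paths_def by blast+
  from ys(1,2) *[OF ys] show "ys \<noteq> []" "set ys \<subseteq> A" "join ys pss \<noteq> []" "set (join ys pss) \<subseteq> A"
    "ends (join ys pss) = ends ys" "steps (join ys pss) = concat (map steps pss)"
    "steps ys = map ends pss" "\<And>ps. ps \<in> set pss \<Longrightarrow> ps \<noteq> [] \<and> set ps \<subseteq> A"
    by blast+
qed

text \<open>The degenerate nesting with a single block. If the block is a lone vertex x, the outer
  path is \<open>[x, x]\<close>, which still has one step.\<close>

lemma nested_single:
  assumes "xs \<noteq> []" "set xs \<subseteq> A"
  shows "([hd xs, last xs], [xs]) \<in> nested_paths A" "join [hd xs, last xs] [xs] = xs"
  using assms by (auto simp: nested_paths_def paths_def join_def)

text \<open>The other degenerate nesting: every block is a single step. A lone vertex then has an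
  empty list of blocks.\<close>

lemma nested_steps:
  assumes "xs \<noteq> []" "set xs \<subseteq> A"
  shows "(xs, map (\<lambda>p. [fst p, snd p]) (steps xs)) \<in> nested_paths A"
    "join xs (map (\<lambda>p. [fst p, snd p]) (steps xs)) = xs"
proof -
  have "list_all2 (\<lambda>(a, b) ps. ps \<in> paths A a b) (steps xs) (map (\<lambda>p. [fst p, snd p]) (steps xs))"
    by (auto simp: list.rel_map list_all2_same paths_def dest: set_steps[OF _ assms(2)])
  then show "(xs, map (\<lambda>p. [fst p, snd p]) (steps xs)) \<in> nested_paths A"
    using assms by (simp add: nested_paths_def)
  show "join xs (map (\<lambda>p. [fst p, snd p]) (steps xs)) = xs"
    using assms(1) by (induction xs rule: induct_list012) (auto simp: join_def)
qed

section \<open>Graphs, graph maps and enriched categories in components\<close>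

lemma graph_map_eqI:
  fixes f g :: "('x, 'o, 'a) graph_map"
  shows "gdom f = gdom g \<Longrightarrow> gcod f = gcod g \<Longrightarrow> gver f = gver g \<Longrightarrow> garr f = garr g \<Longrightarrow> f = g"
  by simp

lemma graph_eqI:
  fixes X Y :: "('x, 'o) graph"
  shows "verts X = verts Y \<Longrightarrow> ghom X = ghom Y \<Longrightarrow> X = Y"
  by simp

lemma graphs_iff: "X \<in> graphs U C \<longleftrightarrow> verts X \<in> U \<and> ghom X \<in> extensional (verts X \<times> verts X) \<and>
    (\<forall>p. p \<in> verts X \<times> verts X \<longrightarrow> ghom X p \<in> Obj C)"
  unfolding graphs_def PiE_iff mem_Collect_eq by blast

lemma graph_maps_iff: "f \<in> graph_maps U C \<longleftrightarrow> gdom f \<in> graphs U C \<and> gcod f \<in> graphs U C \<and>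
    (\<forall>a\<in>verts (gdom f). gver f a \<in> verts (gcod f)) \<and> gver f \<in> extensional (verts (gdom f)) \<and>
    garr f \<in> extensional (verts (gdom f) \<times> verts (gdom f)) \<and>
    (\<forall>p. p \<in> verts (gdom f) \<times> verts (gdom f) \<longrightarrow> garr f p \<in> Arr C \<and>
      Dom C (garr f p) = ghom (gdom f) p \<and>
      Cod C (garr f p) = ghom (gcod f) (gver f (fst p), gver f (snd p)))"
  unfolding graph_maps_def PiE_iff mem_Collect_eq by (auto simp: hom_def)

lemma graph_cat_simps [simp]:
  "Obj (graph_cat U C) = graphs U C" "Arr (graph_cat U C) = graph_maps U C"
  "Dom (graph_cat U C) = gdom" "Cod (graph_cat U C) = gcod"
  "gdom (Ident (graph_cat U C) X) = X" "gcod (Ident (graph_cat U C) X) = X"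
  "gver (Ident (graph_cat U C) X) = (\<lambda>a\<in>verts X. a)"
  "garr (Ident (graph_cat U C) X) = (\<lambda>p\<in>verts X \<times> verts X. Ident C (ghom X p))"
  "gdom (Comp (graph_cat U C) g f) = gdom f" "gcod (Comp (graph_cat U C) g f) = gcod g"
  "gver (Comp (graph_cat U C) g f) = (\<lambda>a\<in>verts (gdom f). gver g (gver f a))"
  "garr (Comp (graph_cat U C) g f) = (\<lambda>p\<in>verts (gdom f) \<times> verts (gdom f).
     Comp C (garr g (gver f (fst p), gver f (snd p))) (garr f p))"
  by (auto simp: graph_cat_def restrict_def)

lemma graph_fobj_simps [simp]:
  "verts (graph_fobj H X) = verts X"
  "ghom (graph_fobj H X) = (\<lambda>p\<in>verts X \<times> verts X. fobj H (ghom X p))"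
  by (simp_all add: graph_fobj_def)

lemma graph_functor_simps [simp]:
  "fobj (graph_functor H) X = graph_fobj H X"
  "gdom (farr (graph_functor H) f) = graph_fobj H (gdom f)"
  "gcod (farr (graph_functor H) f) = graph_fobj H (gcod f)"
  "gver (farr (graph_functor H) f) = gver f"
  "garr (farr (graph_functor H) f) = (\<lambda>p\<in>verts (gdom f) \<times> verts (gdom f). farr H (garr f p))"
  by (simp_all add: graph_functor_def)

lemma ecat_cat_simps [simp]:
  "Obj (ecat_cat U C E) = ecategories U C E" "Arr (ecat_cat U C E) = efunctors U C E"
  "Dom (ecat_cat U C E) = fst" "Cod (ecat_cat U C E) = (\<lambda>p. snd (snd p))"
  "Ident (ecat_cat U C E) A = (A, Ident (graph_cat U C) (fst A), A)"
  "Comp (ecat_cat U C E) q p = (fst p, Comp (graph_cat U C) (fst (snd q)) (fst (snd p)), snd (snd q))"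
  by (auto simp: ecat_cat_def split: prod.split)

lemma ecat_forget_simps [simp]:
  "fobj ecat_forget = fst" "farr ecat_forget p = fst (snd p)"
  by (auto simp: ecat_forget_def split: prod.split)

lemma ecategories_iff: "A \<in> ecategories U C E \<longleftrightarrow> fst A \<in> graphs U C \<and>
    snd A \<in> extensional (lists (verts (fst A)) - {[]}) \<and>
    (\<forall>xs. xs \<noteq> [] \<longrightarrow> set xs \<subseteq> verts (fst A) \<longrightarrow> snd A xs \<in> Arr C \<and>
      Dom C (snd A xs) = fobj (tensor E) (path_homs (fst A) xs) \<and>
      Cod C (snd A xs) = ghom (fst A) (ends xs)) \<and>
    (\<forall>x\<in>verts (fst A). \<forall>y\<in>verts (fst A).
      Comp C (snd A [x, y]) (tunit E (ghom (fst A) (x, y))) = Ident C (ghom (fst A) (x, y))) \<and>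
    (\<forall>ys pss. (ys, pss) \<in> nested_paths (verts (fst A)) \<longrightarrow>
      Comp C (snd A (join ys pss)) (tsubst E (map (path_homs (fst A)) pss)) =
      Comp C (snd A ys) (farr (tensor E) (map (snd A) pss)))"
proof (cases A)
  case (Pair X k)
  have lists: "xs \<in> lists S - {[]} \<longleftrightarrow> xs \<noteq> [] \<and> set xs \<subseteq> S" for xs and S :: "'a set"
    by auto
  show ?thesis unfolding Pair ecategories_def PiE_iff by (auto simp: lists simp del: path_homs_simps)
qed

lemma efunctors_iff: "p \<in> efunctors U C E \<longleftrightarrow> fst p \<in> ecategories U C E \<and>
    snd (snd p) \<in> ecategories U C E \<and> fst (snd p) \<in> graph_maps U C \<and>
    gdom (fst (snd p)) = fst (fst p) \<and> gcod (fst (snd p)) = fst (snd (snd p)) \<and>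
    (\<forall>xs. xs \<noteq> [] \<longrightarrow> set xs \<subseteq> verts (fst (fst p)) \<longrightarrow>
      Comp C (garr (fst (snd p)) (ends xs)) (snd (fst p) xs) =
      Comp C (snd (snd (snd p)) (map (gver (fst (snd p))) xs))
        (farr (tensor E) (map (garr (fst (snd p))) (steps xs))))"
proof -
  have lists: "xs \<in> lists S - {[]} \<longleftrightarrow> xs \<noteq> [] \<and> set xs \<subseteq> S" for xs and S :: "'a set"
    by auto
  obtain X k f Y l where p: "p = ((X, k), f, (Y, l))" by (metis prod.exhaust)
  show ?thesis unfolding p efunctors_def by (auto simp: lists)
qed

declare set_steps [simp] ends_mem [simp]

lemma fst_snd_mem [simp]: "p \<in> A \<times> A \<Longrightarrow> fst p \<in> A" "p \<in> A \<times> A \<Longrightarrow> snd p \<in> A"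
  by auto

section \<open>Translation between the two kinds of enriched category\<close>

context opmon
begin

abbreviation "EMT \<equiv> EM_multitensor C E T s"

lemma s_\<mu>:
  assumes "X \<in> Obj C"
  shows "s [[X]] \<cdot> (u (To (Eo [To X])) \<cdot> Ta (u (To X))) = u (To X) \<cdot> \<mu> X"
proof -
  have "s [[X]] \<cdot> (u (To (Eo [To X])) \<cdot> Ta (u (To X))) = (s [[X]] \<cdot> u (To (Eo [To X]))) \<cdot> Ta (u (To X))"
    using assms by simp
  then show ?thesis using assms s_unit_left[of "[X]"] c_u[OF assms] by (simp del: assoc)
qed

lemma s_\<tau>:
  assumes "objs Xs"
  shows "s [Xs] \<cdot> (u (To (Eo (map To Xs))) \<cdot> Ta (Ea (map \<eta> Xs))) = \<tau> Xs"
proof -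
  have "s [Xs] \<cdot> (u (To (Eo (map To Xs))) \<cdot> Ta (Ea (map \<eta> Xs))) =
      (s [Xs] \<cdot> u (To (Eo (map To Xs)))) \<cdot> Ta (Ea (map \<eta> Xs))"
    using assms by simp
  then show ?thesis
    using s_unit_left[OF assms] \<tau>_eq_free[OF assms] by (simp only: snd_L_free)
qed

lemma s_\<sigma>:
  assumes "\<forall>Xs\<in>set Xss. objs Xs"
  shows "Ea (map \<eta> (concat Xss)) \<cdot> \<sigma> Xss =
    s Xss \<cdot> (Ea (map (\<lambda>Xs. \<eta> (Eo (map To Xs))) Xss) \<cdot> Ea (map (\<lambda>Xs. Ea (map \<eta> Xs)) Xss))"
  using EM_unit_map assms by (simp add: is_multitensor_map_def in_lists_conv_set)

definition to_alg where
  "to_alg A p = (ghom (fst A) p, snd A [fst p, snd p] \<cdot> u (To (ghom (fst A) p)))"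

definition to_cat where
  "to_cat A = (\<lparr>verts = verts (fst A), ghom = restrict (to_alg A) (verts (fst A) \<times> verts (fst A))\<rparr>,
     \<lambda>xs\<in>lists (verts (fst A)) - {[]}. (L (map (to_alg A) (steps xs)),
       snd A xs \<cdot> Ea (map (\<lambda>p. \<eta> (ghom (fst A) p)) (steps xs)), to_alg A (ends xs)))"

definition of_cat where
  "of_cat B = (graph_fobj alg_forget (fst B),
     \<lambda>xs\<in>lists (verts (fst B)) - {[]}. fst (snd (snd B xs)) \<cdot>
        Ea (map (\<lambda>p. snd (ghom (fst B) p)) (steps xs)))"

definition to_functor where
  "to_functor p = (to_cat (fst p), \<lparr>gdom = fst (to_cat (fst p)), gcod = fst (to_cat (snd (snd p))),
     gver = gver (fst (snd p)),
     garr = \<lambda>q\<in>verts (fst (fst p)) \<times> verts (fst (fst p)). (to_alg (fst p) q, garr (fst (snd p)) q,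
       to_alg (snd (snd p)) (gver (fst (snd p)) (fst q), gver (fst (snd p)) (snd q)))\<rparr>,
     to_cat (snd (snd p)))"

definition of_functor where
  "of_functor p = (of_cat (fst p), farr (graph_functor alg_forget) (fst (snd p)), of_cat (snd (snd p)))"

lemma fst_to_alg [simp]: "fst (to_alg A p) = ghom (fst A) p"
  by (simp add: to_alg_def)

lemma to_cat_simps [simp]:
  "verts (fst (to_cat A)) = verts (fst A)"
  "ghom (fst (to_cat A)) = restrict (to_alg A) (verts (fst A) \<times> verts (fst A))"
  "xs \<noteq> [] \<Longrightarrow> set xs \<subseteq> verts (fst A) \<Longrightarrow> snd (to_cat A) xs = (L (map (to_alg A) (steps xs)),
       snd A xs \<cdot> Ea (map (\<lambda>p. \<eta> (ghom (fst A) p)) (steps xs)), to_alg A (ends xs))"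
  by (auto simp: to_cat_def)

lemma of_cat_simps [simp]:
  "verts (fst (of_cat B)) = verts (fst B)"
  "ghom (fst (of_cat B)) = (\<lambda>p\<in>verts (fst B) \<times> verts (fst B). fst (ghom (fst B) p))"
  "xs \<noteq> [] \<Longrightarrow> set xs \<subseteq> verts (fst B) \<Longrightarrow> snd (of_cat B) xs = fst (snd (snd B xs)) \<cdot>
        Ea (map (\<lambda>p. snd (ghom (fst B) p)) (steps xs))"
  by (auto simp: of_cat_def)

end

section \<open>From \<open>EM(T)\<close>-categories to categories over the lifting\<close>

locale em_cat = opmon C T E \<tau> for C :: "('o, 'a) category" (structure) and T E \<tau> +
  fixes U :: "'x set set" and A :: "('x, 'o, 'a) ecat"
  assumes em_cat: "A \<in> ecategories U C (EM_multitensor C E T (substitution_of C E T \<tau>))"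
begin

abbreviation "V \<equiv> verts (fst A)"
abbreviation "H \<equiv> ghom (fst A)"
abbreviation "k \<equiv> snd A"
abbreviation "\<alpha> p \<equiv> k [fst p, snd p] \<cdot> u (To (H p))"

lemma H_obj [simp]: "p \<in> V \<times> V \<Longrightarrow> H p \<in> Obj C"
  using em_cat unfolding ecategories_iff graphs_iff by blast

lemma k_simps [simp]:
  assumes "xs \<noteq> []" "set xs \<subseteq> V"
  shows "k xs \<in> Arr C" "Dom C (k xs) = Eo (map (\<lambda>p. To (H p)) (steps xs))" "Cod C (k xs) = H (ends xs)"
  using em_cat assms unfolding ecategories_iff by simp_all

lemma k_unit: "p \<in> V \<times> V \<Longrightarrow> k [fst p, snd p] \<cdot> (u (To (H p)) \<cdot> \<eta> (H p)) = Ident C (H p)"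
  using em_cat unfolding ecategories_iff by (cases p) simp

lemma k_assoc:
  assumes "(ys, pss) \<in> nested_paths V"
  shows "k (join ys pss) \<cdot> s (map (\<lambda>ps. map H (steps ps)) pss) = k ys \<cdot> Ea (map (\<lambda>ps. Ta (k ps)) pss)"
  using em_cat assms unfolding ecategories_iff by simp

lemma k_assoc_steps:
  assumes "xs \<noteq> []" "set xs \<subseteq> V"
  shows "k xs \<cdot> Ea (map (\<lambda>p. Ta (k [fst p, snd p])) (steps xs)) = k xs \<cdot> s (map (\<lambda>p. [H p]) (steps xs))"
  using k_assoc[OF nested_steps(1)[OF assms]] nested_steps(2)[OF assms] by simp

lemma k_assoc_single:
  assumes "xs \<noteq> []" "set xs \<subseteq> V"
  shows "k [fst (ends xs), snd (ends xs)] \<cdot> Ea [Ta (k xs)] = k xs \<cdot> s [map H (steps xs)]"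
  using k_assoc[OF nested_single(1)[OF assms]] nested_single(2)[OF assms] by (simp add: ends_def)

text \<open>For the multiplication law, \<open>s_\<mu>\<close> writes \<open>u \<circ> \<mu>\<close>
  through the substitution, and associativity of \<open>k\<close> at one block of one step turns
  that substitution into \<open>Tk\<close>.\<close>

lemma \<alpha>_algebra [simp]:
  assumes p: "p \<in> V \<times> V"
  shows "to_alg A p \<in> algebras C T"
proof -
  have pV: "set [fst p, snd p] \<subseteq> V" using p by simp
  have "\<alpha> p \<cdot> \<mu> (H p) = k [fst p, snd p] \<cdot> (u (To (H p)) \<cdot> \<mu> (H p))"
    using p by simp
  also have "\<dots> = (k [fst p, snd p] \<cdot> s [[H p]]) \<cdot> (u (To (Eo [To (H p)])) \<cdot> Ta (u (To (H p))))"
    unfolding s_\<mu>[OF H_obj[OF p], symmetric] using p by simp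
  also have "k [fst p, snd p] \<cdot> s [[H p]] = k [fst p, snd p] \<cdot> Ea [Ta (k [fst p, snd p])]"
    using k_assoc_single[of "[fst p, snd p]"] p by simp
  also have "(k [fst p, snd p] \<cdot> Ea [Ta (k [fst p, snd p])]) \<cdot> (u (To (Eo [To (H p)])) \<cdot> Ta (u (To (H p)))) =
      k [fst p, snd p] \<cdot> ((Ea [Ta (k [fst p, snd p])] \<cdot> u (To (Eo [To (H p)]))) \<cdot> Ta (u (To (H p))))"
    using p by simp
  also have "Ea [Ta (k [fst p, snd p])] \<cdot> u (To (Eo [To (H p)])) = u (To (H p)) \<cdot> Ta (k [fst p, snd p])"
    using p by (subst u_nat) simp_all
  finally show ?thesis using p k_unit[OF p] by (simp add: to_alg_def algebras_def)
qed

text \<open>So \<open>k\<close> can be recovered from \<open>k \<circ> E\<eta>\<close>. Naturality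
  of \<eta> rewrites \<open>\<eta> \<circ> \<alpha>\<close> as
  \<open>T\<alpha> \<circ> \<eta>\<close>; associativity with one-step blocks exchanges
  \<open>Tk\<close> for a substitution, which \<open>s_unary\<close> evaluates to \<mu>, and \<mu>
  cancels \<eta>.\<close>

lemma k_\<eta>_\<alpha>:
  assumes xs: "xs \<noteq> []" "set xs \<subseteq> V"
  shows "k xs \<cdot> (Ea (map (\<lambda>p. \<eta> (H p)) (steps xs)) \<cdot> Ea (map \<alpha> (steps xs))) = k xs"
proof -
  let ?s = "s (map (\<lambda>p. [H p]) (steps xs))"
  have "Ea (map (\<lambda>p. \<eta> (H p)) (steps xs)) \<cdot> Ea (map \<alpha> (steps xs)) =
      Ea (map (\<lambda>p. \<eta> (H p) \<cdot> \<alpha> p) (steps xs))"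
    using xs by (intro Ea_comp[symmetric]) simp
  also have "map (\<lambda>p. \<eta> (H p) \<cdot> \<alpha> p) (steps xs) = map (\<lambda>p. Ta (\<alpha> p) \<cdot> \<eta> (To (H p))) (steps xs)"
    using xs by (intro list.map_cong0) (subst \<eta>_nat, simp_all)
  also have "Ea \<dots> = Ea (map (\<lambda>p. Ta (k [fst p, snd p])) (steps xs)) \<cdot>
      (Ea (map (\<lambda>p. Ta (u (To (H p)))) (steps xs)) \<cdot> Ea (map (\<lambda>p. \<eta> (To (H p))) (steps xs)))"
    using xs by (simp add: Ea_comp)
  also have "k xs \<cdot> \<dots> = (k xs \<cdot> Ea (map (\<lambda>p. Ta (k [fst p, snd p])) (steps xs))) \<cdot>
      (Ea (map (\<lambda>p. Ta (u (To (H p)))) (steps xs)) \<cdot> Ea (map (\<lambda>p. \<eta> (To (H p))) (steps xs)))"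
    using xs by simp
  also have "\<dots> = k xs \<cdot> ((?s \<cdot> Ea (map (\<lambda>p. Ta (u (To (H p)))) (steps xs))) \<cdot>
      Ea (map (\<lambda>p. \<eta> (To (H p))) (steps xs)))"
    unfolding k_assoc_steps[OF xs] using xs by simp
  also have "?s \<cdot> Ea (map (\<lambda>p. Ta (u (To (H p)))) (steps xs)) = Ea (map (\<lambda>p. \<mu> (H p)) (steps xs))"
    using s_unary[of "map H (steps xs)"] xs by simp
  also have "Ea (map (\<lambda>p. \<mu> (H p)) (steps xs)) \<cdot> Ea (map (\<lambda>p. \<eta> (To (H p))) (steps xs)) =
      Ident C (Eo (map (\<lambda>p. To (H p)) (steps xs)))"
    using xs by (simp add: Ea_comp[symmetric] monad_unit_left)
  finally show ?thesis using xs by simp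
qed

text \<open>Both composites equal \<open>k \<circ> \<tau>\<close>. On one side
  \<open>k_\<eta>_\<alpha>\<close> absorbs the structure maps; on the other \<open>s_\<tau>\<close>
  writes \<tau> through the substitution, and associativity with a single block applies.\<close>

lemma \<kappa>_arr:
  assumes xs: "xs \<noteq> []" "set xs \<subseteq> V"
  shows "(L (map (to_alg A) (steps xs)), k xs \<cdot> Ea (map (\<lambda>p. \<eta> (H p)) (steps xs)), to_alg A (ends xs))
    \<in> Arr (alg_cat C T)"
proof -
  let ?\<eta> = "Ea (map (\<lambda>p. \<eta> (H p)) (steps xs))" and ?H = "map H (steps xs)"
  have ends: "ends xs \<in> V \<times> V" using xs by simp
  have "k xs \<cdot> ?\<eta> \<cdot> snd (L (map (to_alg A) (steps xs))) =
      (k xs \<cdot> (?\<eta> \<cdot> Ea (map \<alpha> (steps xs)))) \<cdot> \<tau> ?H"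
    using xs by (simp add: snd_L to_alg_def)
  also have "\<dots> = k xs \<cdot> \<tau> ?H" unfolding k_\<eta>_\<alpha>[OF xs] ..
  also have "\<dots> = (k xs \<cdot> s [?H]) \<cdot> (u (To (Eo (map To ?H))) \<cdot> Ta ?\<eta>)"
    using xs s_\<tau>[of ?H] by simp
  also have "k xs \<cdot> s [?H] = k [fst (ends xs), snd (ends xs)] \<cdot> Ea [Ta (k xs)]"
    using k_assoc_single[OF xs] by simp
  also have "(k [fst (ends xs), snd (ends xs)] \<cdot> Ea [Ta (k xs)]) \<cdot> (u (To (Eo (map To ?H))) \<cdot> Ta ?\<eta>) =
      k [fst (ends xs), snd (ends xs)] \<cdot> ((Ea [Ta (k xs)] \<cdot> u (To (Eo (map To ?H)))) \<cdot> Ta ?\<eta>)"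
    using xs ends by simp
  also have "Ea [Ta (k xs)] \<cdot> u (To (Eo (map To ?H))) = u (To (H (ends xs))) \<cdot> Ta (k xs)"
    using xs by (subst u_nat) simp_all
  also have "k [fst (ends xs), snd (ends xs)] \<cdot> ((u (To (H (ends xs))) \<cdot> Ta (k xs)) \<cdot> Ta ?\<eta>) =
      snd (to_alg A (ends xs)) \<cdot> Ta (k xs \<cdot> ?\<eta>)"
    using xs ends by (simp add: to_alg_def)
  finally show ?thesis using xs ends by (intro alg_arrI) simp_all
qed

text \<open>Under \<open>E\<eta>\<close> the substitution \<sigma> becomes \<open>s\<close> by
  \<open>s_\<sigma>\<close>, so associativity of \<open>k\<close> applies; naturality then moves
  \<eta> out of the blocks.\<close>

lemma \<kappa>_assoc:
  assumes n: "(ys, pss) \<in> nested_paths V"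
  shows "k (join ys pss) \<cdot> (Ea (map (\<lambda>p. \<eta> (H p)) (steps (join ys pss))) \<cdot> \<sigma> (map (\<lambda>ps. map H (steps ps)) pss)) =
    k ys \<cdot> (Ea (map (\<lambda>p. \<eta> (H p)) (steps ys)) \<cdot>
      Ea (map (\<lambda>ps. k ps \<cdot> Ea (map (\<lambda>p. \<eta> (H p)) (steps ps))) pss))"
proof -
  note nD = nested_pathsD[OF n]
  have ps: "\<And>ps. ps \<in> set pss \<Longrightarrow> ps \<noteq> []" "\<And>ps. ps \<in> set pss \<Longrightarrow> set ps \<subseteq> V" using nD(8) by auto
  let ?H = "map (\<lambda>ps. map H (steps ps)) pss" and ?\<eta> = "\<lambda>ps. Ea (map (\<lambda>p. \<eta> (H p)) (steps ps))"
  have "Ea (map (\<lambda>p. \<eta> (H p)) (steps (join ys pss))) \<cdot> \<sigma> ?H =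
     s ?H \<cdot> (Ea (map (\<lambda>ps. \<eta> (Eo (map (\<lambda>p. To (H p)) (steps ps)))) pss) \<cdot> Ea (map ?\<eta> pss))"
    unfolding nD(6) using s_\<sigma>[of ?H] ps by simp
  then have "k (join ys pss) \<cdot> (Ea (map (\<lambda>p. \<eta> (H p)) (steps (join ys pss))) \<cdot> \<sigma> ?H) =
     (k (join ys pss) \<cdot> s ?H) \<cdot> (Ea (map (\<lambda>ps. \<eta> (Eo (map (\<lambda>p. To (H p)) (steps ps)))) pss) \<cdot> Ea (map ?\<eta> pss))"
    using ps nD(1-6) by simp
  also have "\<dots> = k ys \<cdot> Ea (map (\<lambda>ps. Ta (k ps) \<cdot> \<eta> (Eo (map (\<lambda>p. To (H p)) (steps ps))) \<cdot> ?\<eta> ps) pss)"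
    unfolding k_assoc[OF n] using ps nD(1,2,7) by (simp add: Ea_comp)
  also have "map (\<lambda>ps. Ta (k ps) \<cdot> \<eta> (Eo (map (\<lambda>p. To (H p)) (steps ps))) \<cdot> ?\<eta> ps) pss =
      map (\<lambda>ps. \<eta> (H (ends ps)) \<cdot> (k ps \<cdot> ?\<eta> ps)) pss"
    using ps by (intro list.map_cong0) (subst \<eta>_nat, simp_all)
  also have "k ys \<cdot> Ea \<dots> = k ys \<cdot> (Ea (map (\<lambda>p. \<eta> (H p)) (steps ys)) \<cdot> Ea (map (\<lambda>ps. k ps \<cdot> ?\<eta> ps) pss))"
    unfolding nD(7) using ps by (simp add: Ea_comp)
  finally show ?thesis .
qed

lemma to_cat_ecategory: "to_cat A \<in> ecategories U (alg_cat C T) E'"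
  unfolding ecategories_iff
proof (intro conjI allI impI ballI)
  show "fst (to_cat A) \<in> graphs U (alg_cat C T)"
    using em_cat by (simp add: ecategories_iff graphs_iff del: split_paired_All)
  show "snd (to_cat A) \<in> extensional (lists (verts (fst (to_cat A))) - {[]})"
    by (simp add: to_cat_def)
next
  fix xs assume xs: "xs \<noteq> []" "set xs \<subseteq> verts (fst (to_cat A))"
  then have [simp]: "set xs \<subseteq> V" by simp
  show "snd (to_cat A) xs \<in> Arr (alg_cat C T)"
    using xs \<kappa>_arr by simp
  show "Dom (alg_cat C T) (snd (to_cat A) xs) = fobj (tensor E') (path_homs (fst (to_cat A)) xs)"
    "Cod (alg_cat C T) (snd (to_cat A) xs) = ghom (fst (to_cat A)) (ends xs)"
    using xs by simp_all
next
  fix x y assume "x \<in> verts (fst (to_cat A))" "y \<in> verts (fst (to_cat A))"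
  then have p: "(x, y) \<in> V \<times> V" by simp
  have "k [x, y] \<cdot> Ea [\<eta> (H (x, y))] \<cdot> u (H (x, y)) = Ident C (H (x, y))"
    using p k_unit[OF p] \<alpha>_algebra[OF p] by (simp add: u_nat)
  then show "snd (to_cat A) [x, y] \<cdot>\<^bsub>alg_cat C T\<^esub> tunit E' (ghom (fst (to_cat A)) (x, y)) =
      Ident (alg_cat C T) (ghom (fst (to_cat A)) (x, y))"
    using p \<alpha>_algebra[OF p] by (simp add: to_cat_simps)
next
  fix ys pss assume "(ys, pss) \<in> nested_paths (verts (fst (to_cat A)))"
  then have n: "(ys, pss) \<in> nested_paths V" by simp
  note nD = nested_pathsD[OF n]
  have ps: "\<And>ps. ps \<in> set pss \<Longrightarrow> ps \<noteq> []" "\<And>ps. ps \<in> set pss \<Longrightarrow> set ps \<subseteq> V" using nD(8) by auto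
  have L: "map (restrict (to_alg A) (V \<times> V)) (steps xs) = map (to_alg A) (steps xs)" if "set xs \<subseteq> V" for xs
    using that by simp
  have 1: "tsubst E' (map (path_homs (fst (to_cat A))) pss) = (L (map (\<lambda>ps. L (map (to_alg A) (steps ps))) pss),
      \<sigma> (map (\<lambda>ps. map H (steps ps)) pss), L (map (to_alg A) (concat (map steps pss))))"
    using ps by simp
  have 2: "farr (tensor E') (map (snd (to_cat A)) pss) = (L (map (\<lambda>ps. L (map (to_alg A) (steps ps))) pss),
      Ea (map (\<lambda>ps. k ps \<cdot> Ea (map (\<lambda>p. \<eta> (H p)) (steps ps))) pss), L (map (\<lambda>ps. to_alg A (ends ps)) pss))"
    using ps \<kappa>_arr by simp
  show "snd (to_cat A) (join ys pss) \<cdot>\<^bsub>alg_cat C T\<^esub> tsubst E' (map (path_homs (fst (to_cat A))) pss) =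
      snd (to_cat A) ys \<cdot>\<^bsub>alg_cat C T\<^esub> farr (tensor E') (map (snd (to_cat A)) pss)"
    unfolding 1 2 using \<kappa>_assoc[OF n] nD(1-5) ps by (simp add: nD(6,7))
qed

end

text \<open>Each structure map is an algebra map from a free algebra, and the lifted tensor product
  acts on these maps.\<close>

lemma (in opmon) L_free:
  assumes As: "\<forall>A\<in>set As. A \<in> algebras C T"
  shows "Ea (map snd As) \<cdot> c (map fst As) = snd (L As) \<cdot> Ta (Ea (map snd As))"
proof -
  have "\<forall>A\<in>set As. ((To (fst A), \<mu> (fst A)), snd A, A) \<in> Arr (alg_cat C T)"
    using As by (intro ballI alg_arrI free_algebra) (simp_all add: alg_mult)
  then show ?thesis
    using alg_arr_comm[OF L_map[of "map (\<lambda>A. ((To (fst A), \<mu> (fst A)), snd A, A)) As"]]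
    by (simp add: snd_L del: assoc)
qed

section \<open>From categories over the lifting to \<open>EM(T)\<close>-categories\<close>

locale lift_cat = opmon C T E \<tau> for C :: "('o, 'a) category" (structure) and T E \<tau> +
  fixes U :: "'x set set" and B :: "('x, 'o \<times> 'a, ('o, 'a) alg_map) ecat"
  assumes lift_cat: "B \<in> ecategories U (alg_cat C T) (lifting_of C E T \<tau>)"
begin

abbreviation "V \<equiv> verts (fst B)"
abbreviation "G \<equiv> ghom (fst B)"
abbreviation "\<kappa> xs \<equiv> fst (snd (snd B xs))"

lemma G_algebra [simp]: "p \<in> V \<times> V \<Longrightarrow> G p \<in> algebras C T"
  using lift_cat unfolding ecategories_iff graphs_iff alg_cat_simps by blast

lemma B_simps [simp]:
  assumes "xs \<noteq> []" "set xs \<subseteq> V"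
  shows "snd B xs \<in> Arr (alg_cat C T)" "fst (snd B xs) = L (map G (steps xs))"
    "snd (snd (snd B xs)) = G (ends xs)"
  using lift_cat assms unfolding ecategories_iff by simp_all

lemma \<kappa>_simps [simp]:
  assumes "xs \<noteq> []" "set xs \<subseteq> V"
  shows "\<kappa> xs \<in> Arr C" "Dom C (\<kappa> xs) = Eo (map (\<lambda>p. fst (G p)) (steps xs))"
    "Cod C (\<kappa> xs) = fst (G (ends xs))"
  using alg_arrD[OF B_simps(1)[OF assms]] B_simps[OF assms] by simp_all

lemma \<kappa>_comm:
  assumes "xs \<noteq> []" "set xs \<subseteq> V"
  shows "\<kappa> xs \<cdot> snd (L (map G (steps xs))) = snd (G (ends xs)) \<cdot> Ta (\<kappa> xs)"
  using alg_arr_comm[OF B_simps(1)[OF assms]] B_simps[OF assms] by simp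

lemma \<kappa>_unit:
  assumes "p \<in> V \<times> V"
  shows "\<kappa> [fst p, snd p] \<cdot> u (fst (G p)) = Ident C (fst (G p))"
proof -
  have "snd B [fst p, snd p] \<cdot>\<^bsub>alg_cat C T\<^esub> tunit E' (G p) = Ident (alg_cat C T) (G p)"
  proof -
    have "\<forall>x\<in>V. \<forall>y\<in>V. snd B [x, y] \<cdot>\<^bsub>alg_cat C T\<^esub> tunit E' (G (x, y)) = Ident (alg_cat C T) (G (x, y))"
      using lift_cat unfolding ecategories_iff by (elim conjE)
    from this[rule_format, of "fst p" "snd p"] show ?thesis using fst_snd_mem[OF assms]
      unfolding prod.collapse by blast
  qed
  then show ?thesis using assms by simp
qed

lemma \<kappa>_assoc:
  assumes n: "(ys, pss) \<in> nested_paths V"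
  shows "\<kappa> (join ys pss) \<cdot> \<sigma> (map (\<lambda>ps. map (\<lambda>p. fst (G p)) (steps ps)) pss) = \<kappa> ys \<cdot> Ea (map \<kappa> pss)"
proof -
  have "snd B (join ys pss) \<cdot>\<^bsub>alg_cat C T\<^esub> tsubst E' (map (path_homs (fst B)) pss) =
      snd B ys \<cdot>\<^bsub>alg_cat C T\<^esub> farr (tensor E') (map (snd B) pss)"
  proof -
    have "\<forall>ys pss. (ys, pss) \<in> nested_paths V \<longrightarrow>
        snd B (join ys pss) \<cdot>\<^bsub>alg_cat C T\<^esub> tsubst E' (map (path_homs (fst B)) pss) =
        snd B ys \<cdot>\<^bsub>alg_cat C T\<^esub> farr (tensor E') (map (snd B) pss)"
      using lift_cat unfolding ecategories_iff by (elim conjE)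
    then show ?thesis using n by blast
  qed
  moreover have "\<And>ps. ps \<in> set pss \<Longrightarrow> ps \<noteq> []" "\<And>ps. ps \<in> set pss \<Longrightarrow> set ps \<subseteq> V"
    using nested_pathsD(8)[OF n] by auto
  ultimately show ?thesis by simp
qed

abbreviation "k xs \<equiv> \<kappa> xs \<cdot> Ea (map (\<lambda>p. snd (G p)) (steps xs))"

text \<open>With x for structure maps, each block satisfies
  \<open>\<kappa> \<circ> Ex \<circ> c = x \<circ> Tk\<close>, by \<open>L_free\<close> and because
  \<kappa> is an algebra map. The blocks are then joined by associativity of \<kappa> and naturality
  of \<sigma> at the structure maps.\<close>

lemma k_assoc:
  assumes n: "(ys, pss) \<in> nested_paths V"
  shows "k (join ys pss) \<cdot> s (map (\<lambda>ps. map (\<lambda>p. fst (G p)) (steps ps)) pss) =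
    k ys \<cdot> Ea (map (\<lambda>ps. Ta (k ps)) pss)"
proof -
  note nD = nested_pathsD[OF n]
  have ps: "\<And>ps. ps \<in> set pss \<Longrightarrow> ps \<noteq> []" "\<And>ps. ps \<in> set pss \<Longrightarrow> set ps \<subseteq> V" using nD(8) by auto
  let ?H = "\<lambda>ps. map (\<lambda>p. fst (G p)) (steps ps)" and ?a = "\<lambda>ps. Ea (map (\<lambda>p. snd (G p)) (steps ps))"
  let ?TH = "map (\<lambda>ps. map (\<lambda>p. To (fst (G p))) (steps ps)) pss"
  have inner: "\<kappa> ps \<cdot> (?a ps \<cdot> c (?H ps)) = snd (G (ends ps)) \<cdot> Ta (k ps)" if "ps \<in> set pss" for ps
  proof -
    have p: "ps \<noteq> []" "set ps \<subseteq> V" using ps that by auto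
    have "\<kappa> ps \<cdot> (?a ps \<cdot> c (?H ps)) = (\<kappa> ps \<cdot> snd (L (map G (steps ps)))) \<cdot> Ta (?a ps)"
      using L_free[of "map G (steps ps)"] p L_algebra[of "map G (steps ps)"] by (simp add: snd_L)
    also have "\<dots> = snd (G (ends ps)) \<cdot> Ta (k ps)" unfolding \<kappa>_comm[OF p] using p by simp
    finally show ?thesis .
  qed
  have nat: "Ea (concat (map (\<lambda>ps. map (\<lambda>p. snd (G p)) (steps ps)) pss)) \<cdot> \<sigma> ?TH =
      \<sigma> (map ?H pss) \<cdot> Ea (map ?a pss)"
    using \<sigma>_nat[of "map steps pss" "\<lambda>p. snd (G p)" "\<lambda>p. To (fst (G p))" "\<lambda>p. fst (G p)"] ps by simp
  have "k (join ys pss) \<cdot> s (map ?H pss) =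
     \<kappa> (join ys pss) \<cdot> ((Ea (concat (map (\<lambda>ps. map (\<lambda>p. snd (G p)) (steps ps)) pss)) \<cdot> \<sigma> ?TH) \<cdot>
       Ea (map (\<lambda>ps. c (?H ps)) pss))"
    using ps nD(1-4) by (simp add: s_eq nD(5,6))
  also have "\<dots> = (\<kappa> (join ys pss) \<cdot> \<sigma> (map ?H pss)) \<cdot> (Ea (map ?a pss) \<cdot> Ea (map (\<lambda>ps. c (?H ps)) pss))"
    unfolding nat using ps nD(1-4) by (simp add: nD(5,6))
  also have "\<dots> = \<kappa> ys \<cdot> Ea (map (\<lambda>ps. \<kappa> ps \<cdot> (?a ps \<cdot> c (?H ps))) pss)"
    unfolding \<kappa>_assoc[OF n] using ps nD(1,2) by (simp add: nD(7) Ea_comp)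
  also have "map (\<lambda>ps. \<kappa> ps \<cdot> (?a ps \<cdot> c (?H ps))) pss = map (\<lambda>ps. snd (G (ends ps)) \<cdot> Ta (k ps)) pss"
    by (rule list.map_cong0) (rule inner)
  also have "\<kappa> ys \<cdot> Ea \<dots> = k ys \<cdot> Ea (map (\<lambda>ps. Ta (k ps)) pss)"
    using ps nD(1,2) by (simp add: nD(7) Ea_comp)
  finally show ?thesis .
qed

lemma of_cat_ecategory: "of_cat B \<in> ecategories U C EMT"
  unfolding ecategories_iff
proof (intro conjI allI impI ballI)
  show "fst (of_cat B) \<in> graphs U C"
    using lift_cat by (simp add: ecategories_iff graphs_iff del: split_paired_All)
  show "snd (of_cat B) \<in> extensional (lists (verts (fst (of_cat B))) - {[]})"
    by (simp add: of_cat_def)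
next
  fix xs assume xs: "xs \<noteq> []" "set xs \<subseteq> verts (fst (of_cat B))"
  then have [simp]: "set xs \<subseteq> V" by simp
  show "snd (of_cat B) xs \<in> Arr C" "Dom C (snd (of_cat B) xs) = fobj (tensor EMT) (path_homs (fst (of_cat B)) xs)"
    "Cod C (snd (of_cat B) xs) = ghom (fst (of_cat B)) (ends xs)"
    using xs by simp_all
next
  fix x y assume "x \<in> verts (fst (of_cat B))" "y \<in> verts (fst (of_cat B))"
  then have p: "(x, y) \<in> V \<times> V" by simp
  have "k [x, y] \<cdot> (u (To (fst (G (x, y)))) \<cdot> \<eta> (fst (G (x, y)))) =
      (\<kappa> [x, y] \<cdot> u (fst (G (x, y)))) \<cdot> (snd (G (x, y)) \<cdot> \<eta> (fst (G (x, y))))"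
    using p G_algebra[OF p] by (simp add: comp_tail[OF u_nat])
  also have "\<dots> = Ident C (fst (G (x, y)))"
    using p \<kappa>_unit[OF p] G_algebra[OF p] by (simp add: alg_unit del: assoc)
  finally show "snd (of_cat B) [x, y] \<cdot> tunit EMT (ghom (fst (of_cat B)) (x, y)) =
      Ident C (ghom (fst (of_cat B)) (x, y))"
    using p by simp
next
  fix ys pss assume "(ys, pss) \<in> nested_paths (verts (fst (of_cat B)))"
  then have n: "(ys, pss) \<in> nested_paths V" by simp
  note nD = nested_pathsD[OF n]
  have ps: "\<And>ps. ps \<in> set pss \<Longrightarrow> ps \<noteq> []" "\<And>ps. ps \<in> set pss \<Longrightarrow> set ps \<subseteq> V" using nD(8) by auto
  have 1: "map (path_homs (fst (of_cat B))) pss = map (\<lambda>ps. map (\<lambda>p. fst (G p)) (steps ps)) pss"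
    using ps by simp
  have 2: "map Ta (map (snd (of_cat B)) pss) = map (\<lambda>ps. Ta (k ps)) pss"
    using ps by simp
  show "snd (of_cat B) (join ys pss) \<cdot> tsubst EMT (map (path_homs (fst (of_cat B))) pss) =
      snd (of_cat B) ys \<cdot> farr (tensor EMT) (map (snd (of_cat B)) pss)"
    using k_assoc[OF n] nD(1-4) unfolding 1 EM_simps 2 by simp
qed

text \<open>Naturality moves u past the structure map, and the unit law of \<kappa> cancels it; the
  algebra structures of the homs are thus recovered.\<close>

lemma to_alg_of_cat [simp]:
  assumes p: "p \<in> V \<times> V"
  shows "to_alg (of_cat B) p = G p"
proof -
  have "k [fst p, snd p] \<cdot> u (To (fst (G p))) = (\<kappa> [fst p, snd p] \<cdot> u (fst (G p))) \<cdot> snd (G p)"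
    using p G_algebra[OF p] by (simp add: u_nat)
  also have "\<dots> = snd (G p)" unfolding \<kappa>_unit[OF p] using p by simp
  finally show ?thesis using p by (simp add: to_alg_def prod_eq_iff)
qed

lemma to_cat_of_cat: "to_cat (of_cat B) = B"
proof (rule prod_eqI)
  show "fst (to_cat (of_cat B)) = fst B"
  proof (rule graph_eqI)
    show "ghom (fst (to_cat (of_cat B))) = G"
      using lift_cat by (intro extensionalityI[of _ "V \<times> V"]) (simp_all add: ecategories_iff graphs_iff del: split_paired_All)
  qed simp
  show "snd (to_cat (of_cat B)) = snd B"
  proof (rule extensionalityI[of _ "lists V - {[]}"])
    show "snd (to_cat (of_cat B)) \<in> extensional (lists V - {[]})" by (simp add: to_cat_def)
    show "snd B \<in> extensional (lists V - {[]})" using lift_cat by (simp add: ecategories_iff)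
    fix xs assume "xs \<in> lists V - {[]}"
    then have xs: "xs \<noteq> []" "set xs \<subseteq> V" by auto
    \<comment> \<open>The round trip inserts the structure maps and then \<eta>, which cancel by the
      unit law of algebras.\<close>
    have "\<kappa> xs \<cdot> (Ea (map (\<lambda>p. snd (G p)) (steps xs)) \<cdot> Ea (map (\<lambda>p. \<eta> (fst (G p))) (steps xs))) = \<kappa> xs"
      using xs by (simp add: Ea_comp[symmetric] alg_unit)
    then show "snd (to_cat (of_cat B)) xs = snd B xs"
      using xs by (simp add: prod_eq_iff)
  qed
qed

end

lemma (in em_cat) of_cat_to_cat: "of_cat (to_cat A) = A"
proof (rule prod_eqI)
  show "fst (of_cat (to_cat A)) = fst A"
  proof (rule graph_eqI)
    show "ghom (fst (of_cat (to_cat A))) = H"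
      using em_cat by (intro extensionalityI[of _ "V \<times> V"]) (simp_all add: ecategories_iff graphs_iff del: split_paired_All)
  qed simp
  show "snd (of_cat (to_cat A)) = k"
  proof (rule extensionalityI[of _ "lists V - {[]}"])
    show "snd (of_cat (to_cat A)) \<in> extensional (lists V - {[]})" by (simp add: of_cat_def)
    show "snd A \<in> extensional (lists V - {[]})" using em_cat by (simp add: ecategories_iff)
    fix xs assume "xs \<in> lists V - {[]}"
    then have xs: "xs \<noteq> []" "set xs \<subseteq> V" by auto
    then show "snd (of_cat (to_cat A)) xs = snd A xs"
      using k_\<eta>_\<alpha>[OF xs] by (simp add: to_alg_def)
  qed
qed

section \<open>Enriched functors on both sides\<close>

locale em_functor = opmon C T E \<tau> for C :: "('o, 'a) category" (structure) and T E \<tau> +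
  fixes U :: "'x set set"
    and p :: "('x, 'o, 'a) ecat \<times> ('x, 'o, 'a) graph_map \<times> ('x, 'o, 'a) ecat"
  assumes em_functor: "p \<in> efunctors U C (EM_multitensor C E T (substitution_of C E T \<tau>))"

sublocale em_functor \<subseteq> A: em_cat C T E \<tau> U "fst p"
  by unfold_locales (use em_functor in \<open>simp add: efunctors_iff\<close>)

sublocale em_functor \<subseteq> B: em_cat C T E \<tau> U "snd (snd p)"
  by unfold_locales (use em_functor in \<open>simp add: efunctors_iff\<close>)

context em_functor
begin

abbreviation "f \<equiv> fst (snd p)"

lemma f_graphs: "gdom f = fst (fst p)" "gcod f = fst (snd (snd p))"
  using em_functor by (simp_all add: efunctors_iff)

lemma f_graph_map: "f \<in> graph_maps U C"
  using em_functor by (simp add: efunctors_iff)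

lemma f_ext: "gver f \<in> extensional A.V" "garr f \<in> extensional (A.V \<times> A.V)"
  using f_graph_map unfolding graph_maps_iff f_graphs by blast+

lemma gver_V [simp]: "a \<in> A.V \<Longrightarrow> gver f a \<in> B.V"
  using f_graph_map unfolding graph_maps_iff f_graphs by blast

lemma garr_simps [simp]:
  assumes "q \<in> A.V \<times> A.V"
  shows "garr f q \<in> Arr C" "Dom C (garr f q) = A.H q"
    "Cod C (garr f q) = B.H (gver f (fst q), gver f (snd q))"
  using f_graph_map assms unfolding graph_maps_iff f_graphs by blast+

lemma f_comm:
  assumes "xs \<noteq> []" "set xs \<subseteq> A.V"
  shows "garr f (ends xs) \<cdot> A.k xs = B.k (map (gver f) xs) \<cdot> Ea (map (\<lambda>q. Ta (garr f q)) (steps xs))"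
  using em_functor assms by (simp add: efunctors_iff)

lemma set_map_V [simp]: "set xs \<subseteq> A.V \<Longrightarrow> gver f ` set xs \<subseteq> B.V"
  by auto

text \<open>Compatibility with composition on a one-step path, precomposed with u.\<close>

lemma to_alg_map:
  assumes q: "q \<in> A.V \<times> A.V"
  shows "(to_alg (fst p) q, garr f q, to_alg (snd (snd p)) (gver f (fst q), gver f (snd q))) \<in> Arr (alg_cat C T)"
proof -
  let ?q = "(gver f (fst q), gver f (snd q))"
  have q': "?q \<in> B.V \<times> B.V" using q by auto
  have "garr f q \<cdot> A.\<alpha> q = (garr f q \<cdot> A.k [fst q, snd q]) \<cdot> u (To (A.H q))"
    using q by simp
  also have "garr f q \<cdot> A.k [fst q, snd q] = B.k [fst ?q, snd ?q] \<cdot> Ea [Ta (garr f q)]"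
    using f_comm[of "[fst q, snd q]"] q by simp
  also have "(B.k [fst ?q, snd ?q] \<cdot> Ea [Ta (garr f q)]) \<cdot> u (To (A.H q)) = B.\<alpha> ?q \<cdot> Ta (garr f q)"
    using q q' by (simp add: u_nat)
  finally show ?thesis using q q' A.\<alpha>_algebra[OF q] B.\<alpha>_algebra[OF q'] by (intro alg_arrI) (simp_all add: to_alg_def)
qed

lemma to_functor_efunctor: "to_functor p \<in> efunctors U (alg_cat C T) E'"
  unfolding efunctors_iff
proof (intro conjI allI impI)
  show "fst (to_functor p) \<in> ecategories U (alg_cat C T) E'"
    "snd (snd (to_functor p)) \<in> ecategories U (alg_cat C T) E'"
    by (simp_all add: to_functor_def A.to_cat_ecategory B.to_cat_ecategory)
  have "fst (to_cat (fst p)) \<in> graphs U (alg_cat C T)" "fst (to_cat (snd (snd p))) \<in> graphs U (alg_cat C T)"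
    using A.to_cat_ecategory B.to_cat_ecategory by (simp_all add: ecategories_iff)
  then show "fst (snd (to_functor p)) \<in> graph_maps U (alg_cat C T)"
    using f_ext to_alg_map by (simp add: to_functor_def graph_maps_iff del: split_paired_All)
  fix xs assume xs: "xs \<noteq> []" "set xs \<subseteq> verts (fst (fst (to_functor p)))"
  then have xs': "set xs \<subseteq> A.V" by (simp add: to_functor_def)
  let ?g = "\<lambda>q. (to_alg (fst p) q, garr f q, to_alg (snd (snd p)) (gver f (fst q), gver f (snd q)))"
  let ?e = "\<lambda>q. Ea (map (\<lambda>q. \<eta> (A.H q)) (steps xs))"
  have m: "map (garr (fst (snd (to_functor p)))) (steps xs) = map ?g (steps xs)"
    using xs' by (simp add: to_functor_def)
  have arr: "\<forall>q\<in>set (map ?g (steps xs)). q \<in> Arr (alg_cat C T)"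
    using xs' to_alg_map by simp
  have "garr f (ends xs) \<cdot> (A.k xs \<cdot> Ea (map (\<lambda>q. \<eta> (A.H q)) (steps xs))) =
      (garr f (ends xs) \<cdot> A.k xs) \<cdot> Ea (map (\<lambda>q. \<eta> (A.H q)) (steps xs))"
    using xs xs' by simp
  also have "\<dots> = B.k (map (gver f) xs) \<cdot> Ea (map (\<lambda>q. Ta (garr f q) \<cdot> \<eta> (A.H q)) (steps xs))"
    unfolding f_comm[OF xs(1) xs'] using xs xs' by (simp add: Ea_comp steps_map)
  also have "map (\<lambda>q. Ta (garr f q) \<cdot> \<eta> (A.H q)) (steps xs) =
      map (\<lambda>q. \<eta> (B.H (gver f (fst q), gver f (snd q))) \<cdot> garr f q) (steps xs)"
    using xs' by (intro list.map_cong0) (simp add: \<eta>_nat)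
  finally have "garr f (ends xs) \<cdot> (A.k xs \<cdot> Ea (map (\<lambda>q. \<eta> (A.H q)) (steps xs))) =
      B.k (map (gver f) xs) \<cdot> (Ea (map (\<lambda>q. \<eta> (B.H (gver f (fst q), gver f (snd q)))) (steps xs)) \<cdot>
        Ea (map (garr f) (steps xs)))"
    using xs' by (simp add: Ea_comp)
  then show "garr (fst (snd (to_functor p))) (ends xs) \<cdot>\<^bsub>alg_cat C T\<^esub> snd (fst (to_functor p)) xs =
      snd (snd (snd (to_functor p))) (map (gver (fst (snd (to_functor p)))) xs) \<cdot>\<^bsub>alg_cat C T\<^esub>
      farr (tensor E') (map (garr (fst (snd (to_functor p)))) (steps xs))"
    unfolding m lifting_farr[OF arr] using xs(1) xs'
    by (simp add: to_functor_def steps_map ends_map)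
qed (simp_all add: to_functor_def)

lemma of_functor_to_functor: "of_functor (to_functor p) = p"
proof -
  have "farr (graph_functor alg_forget) (fst (snd (to_functor p))) = f"
  proof (rule graph_map_eqI)
    show "gdom (farr (graph_functor alg_forget) (fst (snd (to_functor p)))) = gdom f"
      "gcod (farr (graph_functor alg_forget) (fst (snd (to_functor p)))) = gcod f"
      using A.of_cat_to_cat B.of_cat_to_cat
      by (simp_all add: to_functor_def f_graphs of_cat_def prod_eq_iff)
    show "gver (farr (graph_functor alg_forget) (fst (snd (to_functor p)))) = gver f"
      by (simp add: to_functor_def)
    show "garr (farr (graph_functor alg_forget) (fst (snd (to_functor p)))) = garr f"
      using f_ext by (intro extensionalityI[of _ "A.V \<times> A.V"]) (simp_all add: to_functor_def f_graphs)
  qed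
  then show ?thesis
    using A.of_cat_to_cat B.of_cat_to_cat by (simp add: of_functor_def to_functor_def prod_eq_iff)
qed

end

locale lift_functor = opmon C T E \<tau> for C :: "('o, 'a) category" (structure) and T E \<tau> +
  fixes U :: "'x set set"
    and p :: "('x, 'o \<times> 'a, ('o, 'a) alg_map) ecat \<times> ('x, 'o \<times> 'a, ('o, 'a) alg_map) graph_map \<times>
      ('x, 'o \<times> 'a, ('o, 'a) alg_map) ecat"
  assumes lift_functor: "p \<in> efunctors U (alg_cat C T) (lifting_of C E T \<tau>)"

sublocale lift_functor \<subseteq> A: lift_cat C T E \<tau> U "fst p"
  by unfold_locales (use lift_functor in \<open>simp add: efunctors_iff\<close>)

sublocale lift_functor \<subseteq> B: lift_cat C T E \<tau> U "snd (snd p)"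
  by unfold_locales (use lift_functor in \<open>simp add: efunctors_iff\<close>)

context lift_functor
begin

abbreviation "f \<equiv> fst (snd p)"
abbreviation "g q \<equiv> fst (snd (garr f q))"

lemma f_graphs: "gdom f = fst (fst p)" "gcod f = fst (snd (snd p))"
  using lift_functor by (simp_all add: efunctors_iff)

lemma f_graph_map: "f \<in> graph_maps U (alg_cat C T)"
  using lift_functor by (simp add: efunctors_iff)

lemma f_ext: "gver f \<in> extensional A.V" "garr f \<in> extensional (A.V \<times> A.V)"
  using f_graph_map unfolding graph_maps_iff f_graphs by blast+

lemma gver_V [simp]: "a \<in> A.V \<Longrightarrow> gver f a \<in> B.V"
  using f_graph_map unfolding graph_maps_iff f_graphs by blast

lemma garr_simps [simp]:
  assumes "q \<in> A.V \<times> A.V"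
  shows "garr f q \<in> Arr (alg_cat C T)" "fst (garr f q) = A.G q"
    "snd (snd (garr f q)) = B.G (gver f (fst q), gver f (snd q))"
  using f_graph_map assms unfolding graph_maps_iff f_graphs alg_cat_simps by blast+

lemma g_simps [simp]:
  assumes "q \<in> A.V \<times> A.V"
  shows "g q \<in> Arr C" "Dom C (g q) = fst (A.G q)"
    "Cod C (g q) = fst (B.G (gver f (fst q), gver f (snd q)))"
  using alg_arrD[OF garr_simps(1)[OF assms]] garr_simps[OF assms] by simp_all

lemma g_alg:
  assumes "q \<in> A.V \<times> A.V"
  shows "g q \<cdot> snd (A.G q) = snd (B.G (gver f (fst q), gver f (snd q))) \<cdot> Ta (g q)"
  using alg_arr_comm[OF garr_simps(1)[OF assms]] garr_simps[OF assms] by simp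

lemma set_map_V [simp]: "set xs \<subseteq> A.V \<Longrightarrow> gver f ` set xs \<subseteq> B.V"
  by auto

lemma g_comm:
  assumes xs: "xs \<noteq> []" "set xs \<subseteq> A.V"
  shows "g (ends xs) \<cdot> A.\<kappa> xs = B.\<kappa> (map (gver f) xs) \<cdot> Ea (map g (steps xs))"
proof -
  have "garr f (ends xs) \<cdot>\<^bsub>alg_cat C T\<^esub> snd (fst p) xs =
      snd (snd (snd p)) (map (gver f) xs) \<cdot>\<^bsub>alg_cat C T\<^esub> farr (tensor E') (map (garr f) (steps xs))"
  proof -
    have "\<forall>xs. xs \<noteq> [] \<longrightarrow> set xs \<subseteq> A.V \<longrightarrow> garr f (ends xs) \<cdot>\<^bsub>alg_cat C T\<^esub> snd (fst p) xs =
        snd (snd (snd p)) (map (gver f) xs) \<cdot>\<^bsub>alg_cat C T\<^esub> farr (tensor E') (map (garr f) (steps xs))"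
      using lift_functor unfolding efunctors_iff by (elim conjE)
    then show ?thesis using xs by blast
  qed
  then show ?thesis using xs by simp
qed

lemma of_functor_efunctor: "of_functor p \<in> efunctors U C EMT"
  unfolding efunctors_iff
proof (intro conjI allI impI)
  show "fst (of_functor p) \<in> ecategories U C EMT" "snd (snd (of_functor p)) \<in> ecategories U C EMT"
    by (simp_all add: of_functor_def A.of_cat_ecategory B.of_cat_ecategory)
  have "fst (of_cat (fst p)) \<in> graphs U C" "fst (of_cat (snd (snd p))) \<in> graphs U C"
    using A.of_cat_ecategory B.of_cat_ecategory by (simp_all add: ecategories_iff)
  then show "fst (snd (of_functor p)) \<in> graph_maps U C"
    using f_ext by (simp add: of_functor_def of_cat_def graph_maps_iff f_graphs del: split_paired_All)
  show "gdom (fst (snd (of_functor p))) = fst (fst (of_functor p))"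
    "gcod (fst (snd (of_functor p))) = fst (snd (snd (of_functor p)))"
    by (simp_all add: of_functor_def of_cat_def f_graphs)
  fix xs assume xs: "xs \<noteq> []" "set xs \<subseteq> verts (fst (fst (of_functor p)))"
  then have xs': "set xs \<subseteq> A.V" by (simp add: of_functor_def)
  let ?B = "\<lambda>q. B.G (gver f (fst q), gver f (snd q))"
  have "g (ends xs) \<cdot> A.k xs = (g (ends xs) \<cdot> A.\<kappa> xs) \<cdot> Ea (map (\<lambda>q. snd (A.G q)) (steps xs))"
    using xs(1) xs' by simp
  also have "\<dots> = B.\<kappa> (map (gver f) xs) \<cdot> Ea (map (\<lambda>q. g q \<cdot> snd (A.G q)) (steps xs))"
    unfolding g_comm[OF xs(1) xs'] using xs(1) xs' by (simp add: Ea_comp steps_map)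
  also have "map (\<lambda>q. g q \<cdot> snd (A.G q)) (steps xs) = map (\<lambda>q. snd (?B q) \<cdot> Ta (g q)) (steps xs)"
    using xs' by (intro list.map_cong0) (simp add: g_alg)
  also have "B.\<kappa> (map (gver f) xs) \<cdot> Ea \<dots> =
      (B.\<kappa> (map (gver f) xs) \<cdot> Ea (map (\<lambda>q. snd (?B q)) (steps xs))) \<cdot> Ea (map (\<lambda>q. Ta (g q)) (steps xs))"
    using xs(1) xs' by (simp add: Ea_comp steps_map)
  finally show "garr (fst (snd (of_functor p))) (ends xs) \<cdot> snd (fst (of_functor p)) xs =
      snd (snd (snd (of_functor p))) (map (gver (fst (snd (of_functor p)))) xs) \<cdot>
      farr (tensor EMT) (map (garr (fst (snd (of_functor p)))) (steps xs))"
    using xs(1) xs' by (simp add: of_functor_def f_graphs steps_map del: assoc)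
qed

lemma to_functor_of_functor: "to_functor (of_functor p) = p"
proof -
  have "fst (snd (to_functor (of_functor p))) = f"
  proof (rule graph_map_eqI)
    show "garr (fst (snd (to_functor (of_functor p)))) = garr f"
      using f_ext by (intro extensionalityI[of _ "A.V \<times> A.V"])
        (simp_all add: to_functor_def of_functor_def f_graphs prod_eq_iff)
  qed (simp_all add: to_functor_def of_functor_def f_graphs A.to_cat_of_cat B.to_cat_of_cat)
  then show ?thesis
    using A.to_cat_of_cat B.to_cat_of_cat by (simp add: of_functor_def to_functor_def prod_eq_iff)
qed

end

section \<open>The isomorphism of categories of enriched categories\<close>

lemma (in opmon) ecat_iso:
  fixes U :: "'x set set"
  shows "\<exists>F. is_iso_functor (ecat_cat U C EMT) (ecat_cat U (alg_cat C T) E') F \<and>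
    functors_agree (ecat_cat U C EMT) ((graph_functor alg_forget \<circ>\<circ> ecat_forget) \<circ>\<circ> F) ecat_forget"
proof -
  define F :: "(('x, 'o, 'a) ecat, ('x, 'o, 'a) ecat \<times> ('x, 'o, 'a) graph_map \<times> ('x, 'o, 'a) ecat,
      ('x, 'o \<times> 'a, ('o, 'a) alg_map) ecat,
      ('x, 'o \<times> 'a, ('o, 'a) alg_map) ecat \<times> ('x, 'o \<times> 'a, ('o, 'a) alg_map) graph_map \<times>
      ('x, 'o \<times> 'a, ('o, 'a) alg_map) ecat) cfunctor"
    where "F = \<lparr>fobj = to_cat, farr = to_functor\<rparr>"
  have em: "em_cat C T E \<tau> U A" if "A \<in> ecategories U C EMT" for A
    by unfold_locales (rule that)
  have lift: "lift_cat C T E \<tau> U B" if "B \<in> ecategories U (alg_cat C T) E'" for B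
    by unfold_locales (rule that)
  have emf: "em_functor C T E \<tau> U p" if "p \<in> efunctors U C EMT" for p
    by unfold_locales (rule that)
  have liftf: "lift_functor C T E \<tau> U p" if "p \<in> efunctors U (alg_cat C T) E'" for p
    by unfold_locales (rule that)
  note cat_facts = em_cat.of_cat_to_cat[OF em] lift_cat.to_cat_of_cat[OF lift]
    em_cat.to_cat_ecategory[OF em] lift_cat.of_cat_ecategory[OF lift]
  note functor_facts = em_functor.of_functor_to_functor[OF emf] lift_functor.to_functor_of_functor[OF liftf]
    em_functor.to_functor_efunctor[OF emf] lift_functor.of_functor_efunctor[OF liftf]
  have obj: "bij_betw to_cat (ecategories U C EMT) (ecategories U (alg_cat C T) E')"
    by (rule bij_betw_byWitness[where f' = of_cat]) (intro ballI image_subsetI cat_facts; assumption)+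
  have arr: "bij_betw to_functor (efunctors U C EMT) (efunctors U (alg_cat C T) E')"
    by (rule bij_betw_byWitness[where f' = of_functor]) (intro ballI image_subsetI functor_facts; assumption)+
  have ident: "to_functor (A, Ident (graph_cat U C) (fst A), A) =
      (to_cat A, Ident (graph_cat U (alg_cat C T)) (fst (to_cat A)), to_cat A)"
    if "A \<in> ecategories U C EMT" for A
  proof -
    interpret em_cat C T E \<tau> U A by (rule em[OF that])
    have "fst (snd (to_functor (A, Ident (graph_cat U C) (fst A), A))) =
        Ident (graph_cat U (alg_cat C T)) (fst (to_cat A))"
      by (rule graph_map_eqI) (simp_all add: to_functor_def fun_eq_iff restrict_def del: split_paired_All)
    then show ?thesis by (simp add: to_functor_def)
  qed
  have comp: "to_functor (fst p, fst (snd q) \<cdot>\<^bsub>graph_cat U C\<^esub> fst (snd p), snd (snd q)) =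
      (to_cat (fst p), fst (snd (to_functor q)) \<cdot>\<^bsub>graph_cat U (alg_cat C T)\<^esub> fst (snd (to_functor p)),
       to_cat (snd (snd q)))"
    if "p \<in> efunctors U C EMT" "q \<in> efunctors U C EMT" "fst q = snd (snd p)" for p q
  proof -
    interpret p: em_functor C T E \<tau> U p by (rule emf[OF that(1)])
    interpret q: em_functor C T E \<tau> U q by (rule emf[OF that(2)])
    have "fst (snd (to_functor (fst p, fst (snd q) \<cdot>\<^bsub>graph_cat U C\<^esub> fst (snd p), snd (snd q)))) =
        fst (snd (to_functor q)) \<cdot>\<^bsub>graph_cat U (alg_cat C T)\<^esub> fst (snd (to_functor p))"
      using that(3)
      by (intro graph_map_eqI) (simp_all add: to_functor_def p.f_graphs fun_eq_iff restrict_def del: split_paired_All)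
    then show ?thesis by (simp add: to_functor_def)
  qed
  have "is_functor (ecat_cat U C EMT) (ecat_cat U (alg_cat C T) E') F"
    unfolding is_functor_def F_def
  proof (intro conjI allI ballI impI)
    fix A assume "A \<in> Obj (ecat_cat U C EMT)"
    then show "fobj \<lparr>fobj = to_cat, farr = to_functor\<rparr> A \<in> Obj (ecat_cat U (alg_cat C T) E')"
      by (simp add: cat_facts)
  next
    fix A B p assume "p \<in> hom (ecat_cat U C EMT) A B"
    then show "farr \<lparr>fobj = to_cat, farr = to_functor\<rparr> p \<in> hom (ecat_cat U (alg_cat C T) E')
        (fobj \<lparr>fobj = to_cat, farr = to_functor\<rparr> A) (fobj \<lparr>fobj = to_cat, farr = to_functor\<rparr> B)"
      using functor_facts(3)[of p] by (simp add: to_functor_def)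
  next
    fix A assume "A \<in> Obj (ecat_cat U C EMT)"
    then show "farr \<lparr>fobj = to_cat, farr = to_functor\<rparr> (Ident (ecat_cat U C EMT) A) =
        Ident (ecat_cat U (alg_cat C T) E') (fobj \<lparr>fobj = to_cat, farr = to_functor\<rparr> A)"
      using ident by simp
  next
    fix A B D p q assume "p \<in> hom (ecat_cat U C EMT) A B" "q \<in> hom (ecat_cat U C EMT) B D"
    then show "farr \<lparr>fobj = to_cat, farr = to_functor\<rparr> (q \<cdot>\<^bsub>ecat_cat U C EMT\<^esub> p) =
        farr \<lparr>fobj = to_cat, farr = to_functor\<rparr> q \<cdot>\<^bsub>ecat_cat U (alg_cat C T) E'\<^esub>
        farr \<lparr>fobj = to_cat, farr = to_functor\<rparr> p"
      using comp[of p q] by (simp add: to_functor_def)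
  qed
  \<comment> \<open>On underlying graphs \<open>of_cat\<close> and \<open>of_functor\<close> are the
    forgetful functor, so commutation is contained in the equations saying that they undo
    \<open>to_cat\<close> and \<open>to_functor\<close>.\<close>
  moreover have "functors_agree (ecat_cat U C EMT) ((graph_functor alg_forget \<circ>\<circ> ecat_forget) \<circ>\<circ> F) ecat_forget"
    unfolding functors_agree_def F_def
  proof (intro conjI ballI)
    fix A assume "A \<in> Obj (ecat_cat U C EMT)"
    then have "fst (of_cat (to_cat A)) = fst A"
      by (simp add: cat_facts)
    then show "fobj ((graph_functor alg_forget \<circ>\<circ> ecat_forget) \<circ>\<circ> \<lparr>fobj = to_cat, farr = to_functor\<rparr>) A =
        fobj ecat_forget A"
      by (simp add: of_cat_def)
  next
    fix p assume "p \<in> Arr (ecat_cat U C EMT)"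
    then have "fst (snd (of_functor (to_functor p))) = fst (snd p)"
      by (simp add: functor_facts)
    then show "farr ((graph_functor alg_forget \<circ>\<circ> ecat_forget) \<circ>\<circ> \<lparr>fobj = to_cat, farr = to_functor\<rparr>) p =
        farr ecat_forget p"
      by (simp add: of_functor_def)
  qed
  ultimately show ?thesis
    using obj arr unfolding is_iso_functor_def by (intro exI[of _ F]) (simp add: F_def)
qed

section \<open>Coproducts and the graph monad\<close>

context cat
begin

lemma coproduct_simps:
  assumes "is_coproduct C I X c \<iota>"
  shows "c \<in> Obj C" "i \<in> I \<Longrightarrow> X i \<in> Obj C" "i \<in> I \<Longrightarrow> \<iota> i \<in> Arr C"
    "i \<in> I \<Longrightarrow> Dom C (\<iota> i) = X i" "i \<in> I \<Longrightarrow> Cod C (\<iota> i) = c"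
  using assms by (auto simp: is_coproduct_def)

lemma coproduct_ex1:
  assumes "is_coproduct C I X c \<iota>" "d \<in> Obj C"
    "\<And>i. i \<in> I \<Longrightarrow> g i \<in> Arr C \<and> Dom C (g i) = X i \<and> Cod C (g i) = d"
  shows "\<exists>!h. h \<in> hom C c d \<and> (\<forall>i\<in>I. h \<cdot> \<iota> i = g i)"
proof -
  have "\<forall>d\<in>Obj C. \<forall>g. (\<forall>i\<in>I. g i \<in> hom C (X i) d) \<longrightarrow>
      (\<exists>!h. h \<in> hom C c d \<and> (\<forall>i\<in>I. h \<cdot> \<iota> i = g i))"
    using assms(1) unfolding is_coproduct_def by (elim conjE)
  moreover have "\<forall>i\<in>I. g i \<in> hom C (X i) d" using assms(3) by simp
  ultimately show ?thesis using assms(2) by blast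
qed

text \<open>Joint epimorphy of the injections, with the target left implicit, as equations between
  arrows out of a coproduct are checked.\<close>

lemma coproduct_eq:
  assumes c: "is_coproduct C I X c \<iota>" and h: "h \<in> Arr C" "h' \<in> Arr C" "Dom C h = c" "Dom C h' = c"
    "Cod C h = Cod C h'" and e: "\<And>i. i \<in> I \<Longrightarrow> h \<cdot> \<iota> i = h' \<cdot> \<iota> i"
  shows "h = h'"
proof -
  let ?P = "\<lambda>k. k \<in> hom C c (Cod C h) \<and> (\<forall>i\<in>I. k \<cdot> \<iota> i = h \<cdot> \<iota> i)"
  have "\<exists>!k. ?P k"
    by (rule coproduct_ex1[OF c]) (use h coproduct_simps[OF c] in simp_all)
  moreover have "?P h" using h by simp
  moreover have "?P h'" using h e by simp
  ultimately show ?thesis by blast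
qed

lemma coproductI:
  assumes "c \<in> Obj C"
    "\<And>i. i \<in> I \<Longrightarrow> X i \<in> Obj C \<and> \<iota> i \<in> Arr C \<and> Dom C (\<iota> i) = X i \<and> Cod C (\<iota> i) = c"
    "\<And>d g. d \<in> Obj C \<Longrightarrow> (\<And>i. i \<in> I \<Longrightarrow> g i \<in> hom C (X i) d) \<Longrightarrow>
      \<exists>h. h \<in> hom C c d \<and> (\<forall>i\<in>I. h \<cdot> \<iota> i = g i)"
    "\<And>h h'. h \<in> Arr C \<Longrightarrow> h' \<in> Arr C \<Longrightarrow> Dom C h = c \<Longrightarrow> Dom C h' = c \<Longrightarrow> Cod C h = Cod C h' \<Longrightarrow>
      (\<And>i. i \<in> I \<Longrightarrow> h \<cdot> \<iota> i = h' \<cdot> \<iota> i) \<Longrightarrow> h = h'"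
  shows "is_coproduct C I X c \<iota>"
  unfolding is_coproduct_def
proof (intro conjI ballI allI impI)
  fix d g assume d: "d \<in> Obj C" and g: "\<forall>i\<in>I. g i \<in> hom C (X i) d"
  obtain h where h: "h \<in> hom C c d" "\<forall>i\<in>I. h \<cdot> \<iota> i = g i"
    using assms(3)[OF d, of g] g by blast
  show "\<exists>!h. h \<in> hom C c d \<and> (\<forall>i\<in>I. h \<cdot> \<iota> i = g i)"
  proof (rule ex1I[of _ h])
    fix h' assume "h' \<in> hom C c d \<and> (\<forall>i\<in>I. h' \<cdot> \<iota> i = g i)"
    then show "h' = h" using h by - (rule assms(4), simp_all)
  qed (use h in blast)
qed (use assms(1,2) in simp_all)

lemma coproduct_cong:
  assumes "is_coproduct C I X c \<iota>" "\<And>i. i \<in> I \<Longrightarrow> X i = X' i" "\<And>i. i \<in> I \<Longrightarrow> \<iota> i = \<iota>' i"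
  shows "is_coproduct C I X' c \<iota>'"
  using assms unfolding is_coproduct_def by (simp cong: ball_cong)

lemma coproduct_reindex:
  assumes "is_coproduct C I X c \<iota>" "bij_betw f K I"
  shows "is_coproduct C K (\<lambda>k. X (f k)) c (\<lambda>k. \<iota> (f k))"
proof (rule coproductI)
  note c = coproduct_simps[OF assms(1)]
  have f: "\<And>k. k \<in> K \<Longrightarrow> f k \<in> I" using assms(2) by (auto simp: bij_betw_def)
  show "c \<in> Obj C" by (rule c)
  show "X (f k) \<in> Obj C \<and> \<iota> (f k) \<in> Arr C \<and> Dom C (\<iota> (f k)) = X (f k) \<and> Cod C (\<iota> (f k)) = c"
    if "k \<in> K" for k using c f that by simp
  show "\<exists>h. h \<in> hom C c d \<and> (\<forall>k\<in>K. h \<cdot> \<iota> (f k) = g k)"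
    if d: "d \<in> Obj C" and g: "\<And>k. k \<in> K \<Longrightarrow> g k \<in> hom C (X (f k)) d" for d g
  proof -
    let ?g = "\<lambda>i. g (inv_into K f i)"
    have inv: "inv_into K f i \<in> K" "f (inv_into K f i) = i" if "i \<in> I" for i
      using assms(2) that by (auto simp: bij_betw_def inv_into_into f_inv_into_f)
    have "?g i \<in> Arr C \<and> Dom C (?g i) = X i \<and> Cod C (?g i) = d" if "i \<in> I" for i
      using g[OF inv(1)[OF that]] inv(2)[OF that] by simp
    from coproduct_ex1[OF assms(1) d this] obtain h where "h \<in> hom C c d" "\<forall>i\<in>I. h \<cdot> \<iota> i = ?g i"
      by blast
    moreover have "inv_into K f (f k) = k" if "k \<in> K" for k
      using assms(2) that by (simp add: bij_betw_def)
    ultimately show ?thesis using f by auto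
  qed
  show "h = h'" if "h \<in> Arr C" "h' \<in> Arr C" "Dom C h = c" "Dom C h' = c" "Cod C h = Cod C h'"
    and e: "\<And>k. k \<in> K \<Longrightarrow> h \<cdot> \<iota> (f k) = h' \<cdot> \<iota> (f k)" for h h'
  proof (rule coproduct_eq[OF assms(1) that(1-5)])
    fix i assume "i \<in> I"
    then obtain k where "k \<in> K" "i = f k" using assms(2) by (auto simp: bij_betw_def)
    then show "h \<cdot> \<iota> i = h' \<cdot> \<iota> i" using e by simp
  qed
qed

text \<open>Needed in two places: in the induction distributing \<open>E\<close> over all its
  variables, and to write \<Gamma> applied twice as one coproduct.\<close>

lemma coproduct_sigma:
  assumes c: "is_coproduct C I X c \<iota>" and X: "\<And>i. i \<in> I \<Longrightarrow> is_coproduct C (J i) (Y i) (X i) (\<kappa> i)"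
  shows "is_coproduct C (Sigma I J) (\<lambda>(i, j). Y i j) c (\<lambda>(i, j). \<iota> i \<cdot> \<kappa> i j)"
proof (rule coproductI)
  note cs = coproduct_simps[OF c] and Xs = coproduct_simps[OF X]
  show "c \<in> Obj C" by (rule cs)
  show "(case k of (i, j) \<Rightarrow> Y i j) \<in> Obj C \<and> (case k of (i, j) \<Rightarrow> \<iota> i \<cdot> \<kappa> i j) \<in> Arr C \<and>
      Dom C (case k of (i, j) \<Rightarrow> \<iota> i \<cdot> \<kappa> i j) = (case k of (i, j) \<Rightarrow> Y i j) \<and>
      Cod C (case k of (i, j) \<Rightarrow> \<iota> i \<cdot> \<kappa> i j) = c" if "k \<in> Sigma I J" for k
    using that cs Xs by auto
  show "\<exists>h. h \<in> hom C c d \<and> (\<forall>k\<in>Sigma I J. h \<cdot> (case k of (i, j) \<Rightarrow> \<iota> i \<cdot> \<kappa> i j) = g k)"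
    if d: "d \<in> Obj C" and g: "\<And>k. k \<in> Sigma I J \<Longrightarrow> g k \<in> hom C (case k of (i, j) \<Rightarrow> Y i j) d" for d g
  proof -
    have "\<exists>h. h \<in> hom C (X i) d \<and> (\<forall>j\<in>J i. h \<cdot> \<kappa> i j = g (i, j))" if i: "i \<in> I" for i
    proof -
      have "g (i, j) \<in> Arr C \<and> Dom C (g (i, j)) = Y i j \<and> Cod C (g (i, j)) = d" if "j \<in> J i" for j
        using g[of "(i, j)"] i that by simp
      from coproduct_ex1[OF X[OF i] d this] show ?thesis by blast
    qed
    then obtain k where k: "\<And>i. i \<in> I \<Longrightarrow> k i \<in> hom C (X i) d"
      "\<And>i j. i \<in> I \<Longrightarrow> j \<in> J i \<Longrightarrow> k i \<cdot> \<kappa> i j = g (i, j)" by metis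
    then have "\<And>i. i \<in> I \<Longrightarrow> k i \<in> Arr C \<and> Dom C (k i) = X i \<and> Cod C (k i) = d" by simp
    from coproduct_ex1[OF c d this] obtain h where h: "h \<in> hom C c d" "\<forall>i\<in>I. h \<cdot> \<iota> i = k i" by blast
    have "h \<cdot> (\<iota> i \<cdot> \<kappa> i j) = g (i, j)" if "i \<in> I" "j \<in> J i" for i j
    proof -
      have "h \<cdot> (\<iota> i \<cdot> \<kappa> i j) = (h \<cdot> \<iota> i) \<cdot> \<kappa> i j"
        using h(1) that cs Xs by simp
      then show ?thesis using h(2) k(2) that by simp
    qed
    then show ?thesis using h(1) by auto
  qed
  show "h = h'" if h: "h \<in> Arr C" "h' \<in> Arr C" "Dom C h = c" "Dom C h' = c" "Cod C h = Cod C h'"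
    and e: "\<And>k. k \<in> Sigma I J \<Longrightarrow> h \<cdot> (case k of (i, j) \<Rightarrow> \<iota> i \<cdot> \<kappa> i j) = h' \<cdot> (case k of (i, j) \<Rightarrow> \<iota> i \<cdot> \<kappa> i j)" for h h'
  proof (rule coproduct_eq[OF c h])
    fix i assume i: "i \<in> I"
    show "h \<cdot> \<iota> i = h' \<cdot> \<iota> i"
    proof (rule coproduct_eq[OF X[OF i]])
      fix j assume j: "j \<in> J i"
      then show "(h \<cdot> \<iota> i) \<cdot> \<kappa> i j = (h' \<cdot> \<iota> i) \<cdot> \<kappa> i j"
        using e[of "(i, j)"] i h cs Xs by simp
    qed (use h i cs in simp_all)
  qed
qed

lemma coproduct_singleton:
  assumes "X a \<in> Obj C"
  shows "is_coproduct C {a} X (X a) (\<lambda>i. Ident C (X i))"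
  using assms by (intro coproductI) auto

end

section \<open>Small index sets\<close>

lemma small_subset:
  assumes "is_universe U" "small U I" "J \<subseteq> I"
  shows "small U J"
proof -
  obtain A f where A: "A \<in> U" "bij_betw f I A" using assms(2) by (auto simp: small_def)
  have "f ` J \<subseteq> A" using A(2) assms(3) by (auto simp: bij_betw_def)
  then have "f ` J \<in> U" using assms(1) A(1) by (auto simp: is_universe_def)
  moreover have "bij_betw f J (f ` J)"
    using A(2) assms(3) by (auto simp: bij_betw_def intro: inj_on_subset)
  ultimately show ?thesis by (auto simp: small_def)
qed

lemma small_bij: "bij_betw f I J \<Longrightarrow> small U J \<Longrightarrow> small U I"
  unfolding small_def by (meson bij_betw_trans)

lemma small_lists:
  assumes "is_universe U" "small U I"
  shows "small U (lists I)"
proof -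
  obtain A f where A: "A \<in> U" "bij_betw f I A" using assms(2) by (auto simp: small_def)
  have "inj_on (map f) (lists I)"
  proof (rule inj_onI)
    fix xs ys assume "xs \<in> lists I" "ys \<in> lists I" "map f xs = map f ys"
    then show "xs = ys" using A(2) unfolding bij_betw_def
      by (metis in_lists_conv_set inj_on_map_eq_map inj_on_subset subsetI Un_iff)
  qed
  moreover have "map f ` lists I = lists A"
    using A(2) by (simp add: bij_betw_def flip: lists_image)
  ultimately have "bij_betw (map f) (lists I) (lists A)" by (simp add: bij_betw_def)
  moreover have "small U (lists A)" using A(1) assms(1) by (auto simp: is_universe_def)
  ultimately show ?thesis by (rule small_bij)
qed

lemma small_member: "A \<in> U \<Longrightarrow> small U A"
  unfolding small_def by (metis bij_betw_id)

text \<open>Preservation is assumed for index sets of lists of vertices, but nested paths have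
  another type. A small index set is carried to one-element lists over a member of \<open>U\<close>,
  and the resulting coproduct is carried back.\<close>

lemma preserves_small:
  assumes C: "is_category C" and D: "is_category D"
    and F: "preserves_small_coproducts U C D F" and I: "small U I" and c: "is_coproduct C I X c \<iota>"
  shows "is_coproduct D I (\<lambda>i. fobj F (X i)) (fobj F c) (\<lambda>i. farr F (\<iota> i))"
proof -
  interpret C: cat C by unfold_locales (rule C)
  interpret D: cat D by unfold_locales (rule D)
  obtain A f where A: "A \<in> U" "bij_betw f I A" using I by (auto simp: small_def)
  have s: "bij_betw (\<lambda>a. [a]) A ((\<lambda>a. [a]) ` A)" by (auto simp: bij_betw_def inj_on_def)
  let ?J = "(\<lambda>a. [a]) ` A" and ?g = "\<lambda>l. inv_into I f (hd l)" and ?h = "\<lambda>i. [f i]"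
  have "bij_betw hd ?J A" by (rule bij_betw_byWitness[where f' = "\<lambda>a. [a]"]) auto
  then have g: "bij_betw ?g ?J I"
    using bij_betw_trans[OF _ bij_betw_inv_into[OF A(2)], of hd ?J] by (simp add: comp_def)
  have h: "bij_betw ?h I ?J"
    using bij_betw_trans[OF A(2) s] by (simp add: comp_def)
  have "small U ?J"
    by (rule small_bij[OF \<open>bij_betw hd ?J A\<close>]) (rule small_member[OF A(1)])
  then have "is_coproduct D ?J (\<lambda>j. fobj F (X (?g j))) (fobj F c) (\<lambda>j. farr F (\<iota> (?g j)))"
    using F C.coproduct_reindex[OF c g] unfolding preserves_small_coproducts_def by blast
  from D.coproduct_reindex[OF this h] show ?thesis
    by (rule D.coproduct_cong) (use A(2) in \<open>simp_all add: bij_betw_def\<close>)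
qed

lemma paths_iff: "xs \<in> paths A a b \<longleftrightarrow> xs \<noteq> [] \<and> set xs \<subseteq> A \<and> ends xs = (a, b)"
  by (auto simp: paths_def ends_def)

lemma small_paths:
  assumes "is_universe U" "A \<in> U"
  shows "small U (paths A a b)"
  by (rule small_subset[OF assms(1) small_lists[OF assms(1) small_member[OF assms(2)]]])
    (auto simp: paths_def)

text \<open>Functoriality for lists put together by append, where identities and injections stand
  side by side and no single family is at hand.\<close>

lemma (in multi) Ea_map2:
  assumes "\<forall>f\<in>set fs. f \<in> Arr C" "\<forall>g\<in>set gs. g \<in> Arr C" "map (Dom C) gs = map (Cod C) fs"
  shows "Ea gs \<cdot> Ea fs = Ea (map2 (Comp C) gs fs)"
proof -
  obtain ps where ps: "gs = map fst ps" "fs = map snd ps" using assms(3) by (rule list_pair)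
  have "\<forall>p\<in>set ps. Dom C (fst p) = Cod C (snd p)" using assms(3) unfolding ps by simp
  then show ?thesis using assms(1,2) unfolding ps by (simp add: Ea_comp)
qed

section \<open>Distributivity and the coproducts in \<Gamma>\<close>

locale distrib = multi C E for C :: "('o, 'a) category" (structure) and E +
  fixes U :: "'x set set"
  assumes universe: "is_universe U" and coproducts: "has_small_coproducts U C"
    and distributive: "is_distributive U C E"
begin

text \<open>Induction on the slots still open: distributivity expands the first, the induction
  hypothesis the others, and \<open>coproduct_sigma\<close> combines them. Objects in the slots
  already expanded are collected in \<open>Ys\<close>. All slots share \<open>X\<close> and \<iota>,
  because an index is a path and determines its own summand.\<close>

lemma E_coproduct:
  fixes I :: "'p \<Rightarrow> 'x list set"
  assumes "\<And>p. p \<in> set ps \<Longrightarrow> small U (I p) \<and> is_coproduct C (I p) X (d p) \<iota>"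
    and "objs Ys"
  shows "is_coproduct C {is. list_all2 (\<lambda>p i. i \<in> I p) ps is} (\<lambda>is. Eo (Ys @ map X is))
    (Eo (Ys @ map d ps)) (\<lambda>is. Ea (map (Ident C) Ys @ map \<iota> is))"
  using assms
proof (induction ps arbitrary: Ys)
  \<comment> \<open>With no open slot the only index is the empty list, and the coproduct is that of
    a single object.\<close>
  case Nil
  then show ?case using coproduct_singleton[of "\<lambda>_. Eo Ys" "[]"]
    by simp (erule coproduct_cong, auto)
next
  case (Cons p ps)
  note Ys = Cons.prems(2)
  have p: "small U (I p)" "is_coproduct C (I p) X (d p) \<iota>" using Cons.prems(1) by simp_all
  note ps = coproduct_simps[OF p(2)]
  have q: "d q \<in> Obj C" if "q \<in> set ps" for q
    using Cons.prems(1) coproduct_simps(1) that by (metis list.set_intros(2))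
  have 1: "is_coproduct C (I p) (\<lambda>i. Eo (Ys @ [X i] @ map d ps)) (Eo (Ys @ [d p] @ map d ps))
      (\<lambda>i. Ea (map (Ident C) Ys @ [\<iota> i] @ map (Ident C) (map d ps)))"
  proof -
    have "preserves_small_coproducts U C C (slot_functor C E Ys (map d ps))"
      using distributive q Ys by (simp add: is_distributive_def in_lists_conv_set)
    then have "is_coproduct C (I p) (\<lambda>i. fobj (slot_functor C E Ys (map d ps)) (X i))
        (fobj (slot_functor C E Ys (map d ps)) (d p)) (\<lambda>i. farr (slot_functor C E Ys (map d ps)) (\<iota> i))"
      using p unfolding preserves_small_coproducts_def by blast
    then show ?thesis by (simp add: slot_functor_def)
  qed
  have 2: "is_coproduct C {is. list_all2 (\<lambda>p i. i \<in> I p) ps is} (\<lambda>is. Eo ((Ys @ [X i]) @ map X is))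
      (Eo (Ys @ [X i] @ map d ps)) (\<lambda>is. Ea (map (Ident C) (Ys @ [X i]) @ map \<iota> is))" if "i \<in> I p" for i
    using Cons.IH[of "Ys @ [X i]"] Cons.prems(1) Ys ps that by simp
  let ?K = "{is. list_all2 (\<lambda>p i. i \<in> I p) (p # ps) is}"
  have bij: "bij_betw (\<lambda>is. (hd is, tl is)) ?K (SIGMA i : I p. {is. list_all2 (\<lambda>p i. i \<in> I p) ps is})"
    by (rule bij_betw_byWitness[where f' = "\<lambda>(i, is). i # is"]) (auto simp: list_all2_Cons1)
  \<comment> \<open>The injection of the first slot after those of the others: in every position at
    least one of the two factors is an identity.\<close>
  have comp: "Ea (map (Ident C) Ys @ [\<iota> i] @ map (Ident C) (map d ps)) \<cdot>
      Ea (map (Ident C) (Ys @ [X i]) @ map \<iota> is) = Ea (map (Ident C) Ys @ map \<iota> (i # is))"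
    if i: "i \<in> I p" and "is": "list_all2 (\<lambda>p i. i \<in> I p) ps is" for i "is"
  proof -
    have len: "length ps = length is" using "is" by (rule list_all2_lengthD)
    have n: "\<iota> (is ! k) \<in> Arr C \<and> Cod C (\<iota> (is ! k)) = d (ps ! k)" if "k < length is" for k
      using Cons.prems(1)[of "ps ! k"] coproduct_simps(3,5)[of "I (ps ! k)" X "d (ps ! k)" \<iota> "is ! k"]
        list_all2_nthD[OF "is", of k] that len by simp
    then have "\<forall>f\<in>set is. \<iota> f \<in> Arr C" by (auto simp: in_set_conv_nth)
    moreover have "map d ps = map (\<lambda>i. Cod C (\<iota> i)) is"
      using n len by (simp add: list_eq_iff_nth_eq)
    moreover have "map2 (Comp C) (map (\<lambda>q. Ident C (d q)) ps) (map \<iota> is) = map \<iota> is"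
      using n len by (simp add: list_eq_iff_nth_eq)
    ultimately show ?thesis using i Ys ps q by (subst Ea_map2) auto
  qed
  from coproduct_reindex[OF coproduct_sigma[OF 1 2] bij]
  show ?case
    by (simp, elim coproduct_cong) (use comp in \<open>auto simp: list_all2_Cons1\<close>)
qed

abbreviation "\<Gamma> \<equiv> Gamma_fobj C E"
abbreviation "\<Gamma>a \<equiv> Gamma_farr C E"
abbreviation "inc \<equiv> Gamma_inj C E"

lemma \<Gamma>_verts [simp]: "verts (\<Gamma> X) = verts X"
  by (simp add: Gamma_fobj_def)

lemma graph_obj [simp]: "X \<in> graphs U C \<Longrightarrow> p \<in> verts X \<times> verts X \<Longrightarrow> ghom X p \<in> Obj C"
  unfolding graphs_iff by blast

lemma graph_verts: "X \<in> graphs U C \<Longrightarrow> verts X \<in> U"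
  unfolding graphs_iff by blast

text \<open>The paths between two vertices form a small set, so the choice in
  \<open>chosen_coproduct\<close> is made among existing coproducts.\<close>

lemma \<Gamma>_coproduct:
  assumes X: "X \<in> graphs U C" and p: "p \<in> verts X \<times> verts X"
  shows "is_coproduct C (paths (verts X) (fst p) (snd p)) (\<lambda>xs. Eo (map (ghom X) (steps xs)))
    (ghom (\<Gamma> X) p) (inc X)"
proof -
  let ?P = "paths (verts X) (fst p) (snd p)"
  let ?c = "Gamma_coproduct C E X p"
  have "small U ?P" by (intro small_paths universe graph_verts X)
  moreover have "\<forall>xs\<in>?P. Eo (map (ghom X) (steps xs)) \<in> Obj C"
    using X by (simp add: paths_iff)
  ultimately have "\<exists>c \<iota>. is_coproduct C ?P (\<lambda>xs. Eo (map (ghom X) (steps xs))) c \<iota>"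
    using coproducts[unfolded has_small_coproducts_def, rule_format,
        of ?P "\<lambda>xs. Eo (map (ghom X) (steps xs))"] by blast
  then have "is_coproduct C ?P (\<lambda>xs. Eo (map (ghom X) (steps xs)))
      (fst (chosen_coproduct C ?P (\<lambda>xs. Eo (map (ghom X) (steps xs)))))
      (snd (chosen_coproduct C ?P (\<lambda>xs. Eo (map (ghom X) (steps xs)))))"
    unfolding chosen_coproduct_def case_prod_unfold by - (rule someI_ex, simp)
  then have c: "is_coproduct C ?P (\<lambda>xs. Eo (map (ghom X) (steps xs))) (fst ?c) (snd ?c)"
    by (simp add: Gamma_coproduct_def case_prod_unfold)
  have "ghom (\<Gamma> X) p = fst ?c" using p by (simp add: Gamma_fobj_def)
  then show ?thesis using coproduct_cong[OF c, where \<iota>' = "inc X"]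
    by (simp add: Gamma_inj_def paths_iff)
qed

end

section \<open>Distributive laws on summands\<close>

text \<open>Evaluates the definite descriptions that define \<Gamma> on graph maps, its
  multiplication, and the distributive law of \<tau>.\<close>

lemma (in cat) the_coproduct:
  assumes "is_coproduct C I X c \<iota>" "d \<in> Obj C"
    "\<And>i. i \<in> I \<Longrightarrow> g i \<in> Arr C \<and> Dom C (g i) = X i \<and> Cod C (g i) = d"
    "h = (THE h. h \<in> hom C c d \<and> (\<forall>i\<in>I. h \<cdot> \<iota> i = g i))"
  shows "h \<in> Arr C" "Dom C h = c" "Cod C h = d" "\<And>i. i \<in> I \<Longrightarrow> h \<cdot> \<iota> i = g i"
  using theI'[OF coproduct_ex1[OF assms(1-3)]] unfolding assms(4)[symmetric] by simp_all

context distrib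
begin

lemma \<Gamma>_graph [simp]:
  assumes X: "X \<in> graphs U C"
  shows "\<Gamma> X \<in> graphs U C"
proof -
  have "ghom (\<Gamma> X) p \<in> Obj C" if "p \<in> verts X \<times> verts X" for p
    using coproduct_simps(1)[OF \<Gamma>_coproduct[OF X that]] .
  moreover have "ghom (\<Gamma> X) \<in> extensional (verts X \<times> verts X)" by (simp add: Gamma_fobj_def)
  ultimately show ?thesis unfolding graphs_iff \<Gamma>_verts using graph_verts[OF X] by blast
qed

lemma ends_paths: "xs \<noteq> [] \<Longrightarrow> set xs \<subseteq> A \<Longrightarrow> xs \<in> paths A (fst (ends xs)) (snd (ends xs))"
  by (simp add: paths_iff)

lemma inc_simps [simp]:
  assumes "X \<in> graphs U C" "xs \<noteq> []" "set xs \<subseteq> verts X"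
  shows "inc X xs \<in> Arr C" "Dom C (inc X xs) = Eo (map (ghom X) (steps xs))"
    "Cod C (inc X xs) = ghom (\<Gamma> X) (ends xs)"
  using coproduct_simps(3-5)[OF \<Gamma>_coproduct[OF assms(1) ends_mem[OF assms(2,3)]] ends_paths[OF assms(2,3)]] .

abbreviation "nested X p \<equiv> {n \<in> nested_paths (verts X). ends (fst n) = p}"

text \<open>For a fixed outer path, \<open>E_coproduct\<close> expands the steps into blocks; the
  pairs of an outer path and a list of blocks for it are exactly the nested paths.\<close>

lemma nested_coproduct:
  assumes X: "X \<in> graphs U C" and p: "p \<in> verts X \<times> verts X"
  shows "is_coproduct C (nested X p)
    (\<lambda>n. Eo (map (\<lambda>ps. Eo (map (ghom X) (steps ps))) (snd n))) (ghom (\<Gamma> (\<Gamma> X)) p)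
    (\<lambda>n. inc (\<Gamma> X) (fst n) \<cdot> Ea (map (inc X) (snd n)))"
proof -
  let ?J = "\<lambda>ys. {pss. list_all2 (\<lambda>q ps. ps \<in> paths (verts X) (fst q) (snd q)) (steps ys) pss}"
  let ?P = "paths (verts X) (fst p) (snd p)"
  have outer: "is_coproduct C ?P (\<lambda>ys. Eo (map (ghom (\<Gamma> X)) (steps ys))) (ghom (\<Gamma> (\<Gamma> X)) p) (inc (\<Gamma> X))"
    using \<Gamma>_coproduct[of "\<Gamma> X" p] X p by simp
  have inner: "is_coproduct C (?J ys) (\<lambda>pss. Eo (map (\<lambda>ps. Eo (map (ghom X) (steps ps))) pss))
      (Eo (map (ghom (\<Gamma> X)) (steps ys))) (\<lambda>pss. Ea (map (inc X) pss))" if "ys \<in> ?P" for ys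
  proof -
    have ys: "set ys \<subseteq> verts X" using that by (simp add: paths_iff)
    have "small U (paths (verts X) (fst q) (snd q)) \<and> is_coproduct C (paths (verts X) (fst q) (snd q))
        (\<lambda>ps. Eo (map (ghom X) (steps ps))) (ghom (\<Gamma> X) q) (inc X)" if "q \<in> set (steps ys)" for q
      using \<Gamma>_coproduct[OF X] set_steps[OF that ys] small_paths[OF universe graph_verts[OF X]] by blast
    from E_coproduct[OF this, where Ys = "[]"] show ?thesis by simp
  qed
  have eq: "Sigma ?P ?J = nested X p"
    by (auto simp: nested_paths_def paths_iff case_prod_unfold)
  show ?thesis using coproduct_sigma[OF outer inner]
    unfolding eq case_prod_unfold .
qed

lemma graph_map_simps [simp]:
  assumes "f \<in> graph_maps U C"
  shows "gdom f \<in> graphs U C" "gcod f \<in> graphs U C"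
    "a \<in> verts (gdom f) \<Longrightarrow> gver f a \<in> verts (gcod f)"
    "p \<in> verts (gdom f) \<times> verts (gdom f) \<Longrightarrow> garr f p \<in> Arr C"
    "p \<in> verts (gdom f) \<times> verts (gdom f) \<Longrightarrow> Dom C (garr f p) = ghom (gdom f) p"
    "p \<in> verts (gdom f) \<times> verts (gdom f) \<Longrightarrow>
      Cod C (garr f p) = ghom (gcod f) (gver f (fst p), gver f (snd p))"
  using assms unfolding graph_maps_iff by blast+

lemma graph_map_ext:
  assumes "f \<in> graph_maps U C"
  shows "gver f \<in> extensional (verts (gdom f))" "garr f \<in> extensional (verts (gdom f) \<times> verts (gdom f))"
  using assms unfolding graph_maps_iff by blast+

lemma gver_image [simp]:
  assumes "f \<in> graph_maps U C" "S \<subseteq> verts (gdom f)"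
  shows "gver f ` S \<subseteq> verts (gcod f)"
  using assms by auto

lemma \<Gamma>a_simps [simp]:
  "gdom (\<Gamma>a f) = \<Gamma> (gdom f)" "gcod (\<Gamma>a f) = \<Gamma> (gcod f)" "gver (\<Gamma>a f) = gver f"
  "garr (\<Gamma>a f) \<in> extensional (verts (gdom f) \<times> verts (gdom f))"
  by (simp_all add: Gamma_farr_def)

lemma \<Gamma>a_garr:
  assumes f: "f \<in> graph_maps U C" and p: "p \<in> verts (gdom f) \<times> verts (gdom f)"
  shows "garr (\<Gamma>a f) p \<in> Arr C" "Dom C (garr (\<Gamma>a f) p) = ghom (\<Gamma> (gdom f)) p"
    "Cod C (garr (\<Gamma>a f) p) = ghom (\<Gamma> (gcod f)) (gver f (fst p), gver f (snd p))"
    "\<And>xs. xs \<in> paths (verts (gdom f)) (fst p) (snd p) \<Longrightarrow> garr (\<Gamma>a f) p \<cdot> inc (gdom f) xs =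
      inc (gcod f) (map (gver f) xs) \<cdot> Ea (map (garr f) (steps xs))"
proof -
  let ?g = "\<lambda>xs. inc (gcod f) (map (gver f) xs) \<cdot> Ea (map (garr f) (steps xs))"
  let ?d = "ghom (\<Gamma> (gcod f)) (gver f (fst p), gver f (snd p))"
  have d: "?d \<in> Obj C" using f p by simp
  have g: "?g xs \<in> Arr C \<and> Dom C (?g xs) = Eo (map (ghom (gdom f)) (steps xs)) \<and> Cod C (?g xs) = ?d"
    if "xs \<in> paths (verts (gdom f)) (fst p) (snd p)" for xs
  proof -
    have xs: "xs \<noteq> []" "set xs \<subseteq> verts (gdom f)" "ends xs = p" using that by (simp_all add: paths_iff)
    then show ?thesis using f by (simp add: steps_map ends_map)
  qed
  have "garr (\<Gamma>a f) p = (THE h. h \<in> hom C (ghom (\<Gamma> (gdom f)) p) ?d \<and>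
      (\<forall>xs\<in>paths (verts (gdom f)) (fst p) (snd p). h \<cdot> inc (gdom f) xs = ?g xs))"
    using p by (simp add: Gamma_farr_def case_prod_unfold)
  note the = the_coproduct[OF \<Gamma>_coproduct[OF graph_map_simps(1)[OF f] p] d g this]
  show "garr (\<Gamma>a f) p \<in> Arr C" "Dom C (garr (\<Gamma>a f) p) = ghom (\<Gamma> (gdom f)) p"
    "Cod C (garr (\<Gamma>a f) p) = ?d" by (rule the; assumption)+
  show "garr (\<Gamma>a f) p \<cdot> inc (gdom f) xs = ?g xs"
    if "xs \<in> paths (verts (gdom f)) (fst p) (snd p)" for xs using that by (rule the(4)[rotated])
qed

lemma \<Gamma>a_garr_simps [simp]:
  assumes "f \<in> graph_maps U C" "p \<in> verts (gdom f) \<times> verts (gdom f)"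
  shows "garr (\<Gamma>a f) p \<in> Arr C" "Dom C (garr (\<Gamma>a f) p) = ghom (\<Gamma> (gdom f)) p"
    "Cod C (garr (\<Gamma>a f) p) = ghom (\<Gamma> (gcod f)) (gver f (fst p), gver f (snd p))"
  using \<Gamma>a_garr[OF assms] by simp_all

lemma \<Gamma>a_inc:
  assumes "f \<in> graph_maps U C" "xs \<noteq> []" "set xs \<subseteq> verts (gdom f)"
  shows "garr (\<Gamma>a f) (ends xs) \<cdot> inc (gdom f) xs =
      inc (gcod f) (map (gver f) xs) \<cdot> Ea (map (garr f) (steps xs))"
  using \<Gamma>a_garr(4)[OF assms(1) ends_mem[OF assms(2,3)] ends_paths[OF assms(2,3)]] .

lemma \<Gamma>a_map: "f \<in> graph_maps U C \<Longrightarrow> \<Gamma>a f \<in> graph_maps U C"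
  unfolding graph_maps_iff[of "\<Gamma>a f"] using graph_map_ext by simp

lemma unit_garr: "p \<in> verts X \<times> verts X \<Longrightarrow>
    garr (Gamma_unit C E X) p = inc X [fst p, snd p] \<cdot> u (ghom X p)"
  by (simp add: Gamma_unit_def case_prod_unfold)

lemma mult_garr:
  assumes X: "X \<in> graphs U C" and p: "p \<in> verts X \<times> verts X"
  shows "garr (Gamma_mult C E X) p \<in> Arr C" "Dom C (garr (Gamma_mult C E X) p) = ghom (\<Gamma> (\<Gamma> X)) p"
    "Cod C (garr (Gamma_mult C E X) p) = ghom (\<Gamma> X) p"
    "\<And>n. n \<in> nested X p \<Longrightarrow> garr (Gamma_mult C E X) p \<cdot> (inc (\<Gamma> X) (fst n) \<cdot> Ea (map (inc X) (snd n))) =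
      inc X (join (fst n) (snd n)) \<cdot> \<sigma> (map (\<lambda>ps. map (ghom X) (steps ps)) (snd n))"
proof -
  let ?g = "\<lambda>n. inc X (join (fst n) (snd n)) \<cdot> \<sigma> (map (\<lambda>ps. map (ghom X) (steps ps)) (snd n))"
  have d: "ghom (\<Gamma> X) p \<in> Obj C" using X p by simp
  have g: "?g n \<in> Arr C \<and> Dom C (?g n) = Eo (map (\<lambda>ps. Eo (map (ghom X) (steps ps))) (snd n)) \<and>
      Cod C (?g n) = ghom (\<Gamma> X) p" if "n \<in> nested X p" for n
  proof -
    have n: "(fst n, snd n) \<in> nested_paths (verts X)" "ends (fst n) = p" using that by simp_all
    note nD = nested_pathsD[OF n(1)]
    have "\<And>ps. ps \<in> set (snd n) \<Longrightarrow> set ps \<subseteq> verts X" using nD(8) by blast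
    then show ?thesis using X n(2) nD(3,4,5,6) by simp
  qed
  have "garr (Gamma_mult C E X) p = (THE h. h \<in> hom C (ghom (\<Gamma> (\<Gamma> X)) p) (ghom (\<Gamma> X) p) \<and>
      (\<forall>n\<in>nested X p. h \<cdot> (inc (\<Gamma> X) (fst n) \<cdot> Ea (map (inc X) (snd n))) = ?g n))"
    using p by (simp add: Gamma_mult_def case_prod_unfold) (rule arg_cong[where f = The], rule ext, auto)
  note the = the_coproduct[OF nested_coproduct[OF X p] d g this]
  show "garr (Gamma_mult C E X) p \<in> Arr C" "Dom C (garr (Gamma_mult C E X) p) = ghom (\<Gamma> (\<Gamma> X)) p"
    "Cod C (garr (Gamma_mult C E X) p) = ghom (\<Gamma> X) p" by (rule the; assumption)+
  show "garr (Gamma_mult C E X) p \<cdot> (inc (\<Gamma> X) (fst n) \<cdot> Ea (map (inc X) (snd n))) = ?g n"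
    if "n \<in> nested X p" for n using that by (rule the(4)[rotated])
qed

text \<open>A nested path is encoded injectively as the list of lists with the outer path at its
  head.\<close>

lemma small_nested:
  assumes X: "X \<in> graphs U C"
  shows "small U (nested X p)"
proof -
  have "bij_betw (\<lambda>n. fst n # snd n) (nested X p) ((\<lambda>n. fst n # snd n) ` nested X p)"
    by (auto simp: bij_betw_def inj_on_def prod_eq_iff)
  moreover have "(\<lambda>n. fst n # snd n) ` nested X p \<subseteq> lists (lists (verts X))"
  proof (rule image_subsetI)
    fix n assume "n \<in> nested X p"
    then have "(fst n, snd n) \<in> nested_paths (verts X)" by simp
    from nested_pathsD(2,8)[OF this] show "fst n # snd n \<in> lists (lists (verts X))"
      by (auto simp: in_lists_conv_set)
  qed
  then have "small U ((\<lambda>n. fst n # snd n) ` nested X p)"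
    using small_subset[OF universe small_lists[OF universe small_lists[OF universe small_member[OF graph_verts[OF X]]]]]
    by blast
  ultimately show ?thesis by (rule small_bij)
qed

end

section \<open>The monads \<open>T\<close> and \<Gamma> on graphs\<close>

locale gamma = setting C T E + distrib C E U
  for C :: "('o, 'a) category" (structure) and T E and U :: "'x set set" +
  assumes preserves: "preserves_small_coproducts U C C (mfun T)"
begin

abbreviation "GT \<equiv> graph_fobj (mfun T)"

lemma T_coproduct: "small U I \<Longrightarrow> is_coproduct C I X c \<iota> \<Longrightarrow>
    is_coproduct C I (\<lambda>i. To (X i)) (To c) (\<lambda>i. Ta (\<iota> i))"
  by (rule preserves_small[OF is_category is_category preserves])

lemma GT_graph [simp]:
  assumes "X \<in> graphs U C"
  shows "GT X \<in> graphs U C"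
  unfolding graphs_iff using assms graph_verts[OF assms] by simp

lemma graph_nat_map:
  assumes X: "X \<in> graphs U C" and F: "\<And>Y. Y \<in> Obj C \<Longrightarrow> fobj F Y \<in> Obj C" "\<And>Y. Y \<in> Obj C \<Longrightarrow> fobj G Y \<in> Obj C"
    and a: "\<And>Y. Y \<in> Obj C \<Longrightarrow> a Y \<in> hom C (fobj F Y) (fobj G Y)"
  shows "graph_nat F G a X \<in> graph_maps U C"
  unfolding graph_maps_iff graphs_iff graph_nat_def using X graph_verts[OF X] F a by simp

lemma \<eta>_map: "X \<in> graphs U C \<Longrightarrow> graph_nat id_functor (mfun T) \<eta> X \<in> graph_maps U C"
  by (intro graph_nat_map) simp_all

lemma \<mu>_map: "X \<in> graphs U C \<Longrightarrow> graph_nat (mfun T \<circ>\<circ> mfun T) (mfun T) \<mu> X \<in> graph_maps U C"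
  by (intro graph_nat_map) simp_all

lemma small_ends: "X \<in> graphs U C \<Longrightarrow> small U (paths (verts X) a b)"
  by (intro small_paths universe graph_verts)

lemma T_\<Gamma>_eq:
  assumes X: "X \<in> graphs U C" and p: "p \<in> verts X \<times> verts X"
    and h: "h \<in> Arr C" "h' \<in> Arr C" "Dom C h = To (ghom (\<Gamma> X) p)" "Dom C h' = To (ghom (\<Gamma> X) p)"
    "Cod C h = Cod C h'"
    and e: "\<And>xs. xs \<noteq> [] \<Longrightarrow> set xs \<subseteq> verts X \<Longrightarrow> ends xs = p \<Longrightarrow> h \<cdot> Ta (inc X xs) = h' \<cdot> Ta (inc X xs)"
  shows "h = h'"
  by (rule coproduct_eq[OF T_coproduct[OF small_ends[OF X] \<Gamma>_coproduct[OF X p]] h])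
    (simp add: paths_iff e)

lemma GTa_map:
  assumes "f \<in> graph_maps U C"
  shows "farr (graph_functor (mfun T)) f \<in> graph_maps U C"
  unfolding graph_maps_iff[of "farr _ _"] using assms graph_map_ext[OF assms] by simp

lemma graph_nat_simps [simp]:
  "gdom (graph_nat F G a X) = graph_fobj F X" "gcod (graph_nat F G a X) = graph_fobj G X"
  "gver (graph_nat F G a X) = (\<lambda>v\<in>verts X. v)"
  "garr (graph_nat F G a X) = (\<lambda>p\<in>verts X \<times> verts X. a (ghom X p))"
  by (simp_all add: graph_nat_def)

lemma graph_ext: "X \<in> graphs U C \<Longrightarrow> ghom X \<in> extensional (verts X \<times> verts X)"
  unfolding graphs_iff by blast

lemma graph_fobj_id: "X \<in> graphs U C \<Longrightarrow> graph_fobj id_functor X = X"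
  by (intro graph_eqI extensionalityI[of _ "verts X \<times> verts X"]) (simp_all add: graph_ext)

lemma graph_fobj_comp: "graph_fobj (G \<circ>\<circ> F) X = graph_fobj G (graph_fobj F X)"
  by (intro graph_eqI) (auto simp: restrict_def)

lemma map_restrict [simp]: "set xs \<subseteq> A \<Longrightarrow> map (\<lambda>v. if v \<in> A then v else undefined) xs = xs"
  by (rule map_idI) auto

lemma graph_monad_simps [simp]:
  "mfun (graph_monad T) = graph_functor (mfun T)"
  "munit (graph_monad T) = graph_nat id_functor (mfun T) \<eta>"
  "mmult (graph_monad T) = graph_nat (mfun T \<circ>\<circ> mfun T) (mfun T) \<mu>"
  by (simp_all add: graph_monad_def)

lemma Gamma_monad_simps [simp]:
  "fobj (mfun (Gamma_monad C E)) = \<Gamma>" "farr (mfun (Gamma_monad C E)) = \<Gamma>a"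
  "munit (Gamma_monad C E) = Gamma_unit C E" "mmult (Gamma_monad C E) = Gamma_mult C E"
  by (simp_all add: Gamma_monad_def)

lemma Gamma_unit_simps [simp]:
  "gdom (Gamma_unit C E X) = X" "gcod (Gamma_unit C E X) = \<Gamma> X"
  "gver (Gamma_unit C E X) = (\<lambda>a\<in>verts X. a)"
  "garr (Gamma_unit C E X) \<in> extensional (verts X \<times> verts X)"
  "gdom (Gamma_mult C E X) = \<Gamma> (\<Gamma> X)" "gcod (Gamma_mult C E X) = \<Gamma> X"
  "gver (Gamma_mult C E X) = (\<lambda>a\<in>verts X. a)"
  "garr (Gamma_mult C E X) \<in> extensional (verts X \<times> verts X)"
  by (simp_all add: Gamma_unit_def Gamma_mult_def)

text \<open>In the axioms below both sides have the same source, target and action on vertices, so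
  only the arrows between homs have to be compared.\<close>

lemma graph_map_eq_iff:
  fixes f g :: "('x, 'o, 'a) graph_map"
  assumes "gdom f = gdom g" "gcod f = gcod g" "gver f = gver g"
    "garr f \<in> extensional S" "garr g \<in> extensional S"
  shows "f = g \<longleftrightarrow> (\<forall>p. p \<in> S \<longrightarrow> garr f p = garr g p)"
  using assms by (metis extensionalityI graph_map_eqI)

end

section \<open>The axioms of a distributive law at a pair of vertices\<close>

locale graph_transformation = gamma C T E U
  for C :: "('o, 'a) category" (structure) and T E and U :: "'x set set" +
  fixes l :: "('x, 'o) graph \<Rightarrow> ('x, 'o, 'a) graph_map"
  assumes l_map: "X \<in> graphs U C \<Longrightarrow> l X \<in> graph_maps U C"
    and l_simps [simp]: "X \<in> graphs U C \<Longrightarrow> gdom (l X) = GT (\<Gamma> X)"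
      "X \<in> graphs U C \<Longrightarrow> gcod (l X) = \<Gamma> (GT X)"
      "X \<in> graphs U C \<Longrightarrow> gver (l X) = (\<lambda>a\<in>verts X. a)"
begin

lemma l_garr [simp]:
  assumes "X \<in> graphs U C" "p \<in> verts X \<times> verts X"
  shows "garr (l X) p \<in> Arr C" "Dom C (garr (l X) p) = To (ghom (\<Gamma> X) p)"
    "Cod C (garr (l X) p) = ghom (\<Gamma> (GT X)) p"
  using graph_map_simps(4-6)[OF l_map[OF assms(1)], of p] assms by simp_all

text \<open>At one pair of vertices an axiom is an equation in \<open>C\<close> between arrows out
  of a coproduct, or out of its image under \<open>T\<close>.\<close>

definition "law_nat f p \<longleftrightarrow> garr (l (gcod f)) (gver f (fst p), gver f (snd p)) \<cdot> Ta (garr (\<Gamma>a f) p) =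
  garr (\<Gamma>a (farr (graph_functor (mfun T)) f)) p \<cdot> garr (l (gdom f)) p"

definition "law_\<eta> X p \<longleftrightarrow> garr (l X) p \<cdot> \<eta> (ghom (\<Gamma> X) p) = garr (\<Gamma>a (munit (graph_monad T) X)) p"

definition "law_u X p \<longleftrightarrow> garr (l X) p \<cdot> Ta (garr (Gamma_unit C E X) p) = garr (Gamma_unit C E (GT X)) p"

definition "law_\<mu> X p \<longleftrightarrow> garr (l X) p \<cdot> \<mu> (ghom (\<Gamma> X) p) =
  garr (\<Gamma>a (mmult (graph_monad T) X)) p \<cdot> garr (l (GT X)) p \<cdot> Ta (garr (l X) p)"

definition "law_\<sigma> X p \<longleftrightarrow> garr (l X) p \<cdot> Ta (garr (Gamma_mult C E X) p) =
  garr (Gamma_mult C E (GT X)) p \<cdot> garr (\<Gamma>a (l X)) p \<cdot> garr (l (\<Gamma> X)) p"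

lemma law_nat_iff:
  assumes f: "f \<in> graph_maps U C"
  shows "l (gcod f) \<cdot>\<^bsub>graph_cat U C\<^esub> farr (graph_functor (mfun T)) (\<Gamma>a f) =
      \<Gamma>a (farr (graph_functor (mfun T)) f) \<cdot>\<^bsub>graph_cat U C\<^esub> l (gdom f) \<longleftrightarrow>
    (\<forall>p. p \<in> verts (gdom f) \<times> verts (gdom f) \<longrightarrow> law_nat f p)"
  unfolding law_nat_def
  by (subst graph_map_eq_iff[where S = "verts (gdom f) \<times> verts (gdom f)"])
    (use f in \<open>auto simp: restrict_def extensional_def\<close>)

lemma law_\<eta>_iff:
  assumes X: "X \<in> graphs U C"
  shows "l X \<cdot>\<^bsub>graph_cat U C\<^esub> munit (graph_monad T) (\<Gamma> X) = \<Gamma>a (munit (graph_monad T) X) \<longleftrightarrow>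
    (\<forall>p. p \<in> verts X \<times> verts X \<longrightarrow> law_\<eta> X p)"
  unfolding law_\<eta>_def
  by (subst graph_map_eq_iff[where S = "verts X \<times> verts X"])
    (use X \<Gamma>a_simps(4)[of "graph_nat id_functor (mfun T) \<eta> X"] in \<open>auto simp: restrict_def extensional_def graph_fobj_id\<close>)

lemma law_u_iff:
  assumes X: "X \<in> graphs U C"
  shows "l X \<cdot>\<^bsub>graph_cat U C\<^esub> farr (graph_functor (mfun T)) (Gamma_unit C E X) = Gamma_unit C E (GT X) \<longleftrightarrow>
    (\<forall>p. p \<in> verts X \<times> verts X \<longrightarrow> law_u X p)"
  unfolding law_u_def
  by (subst graph_map_eq_iff[where S = "verts X \<times> verts X"])
    (use X Gamma_unit_simps(4)[of "GT X"] in \<open>auto simp: restrict_def extensional_def\<close>)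

lemma law_\<mu>_iff:
  assumes X: "X \<in> graphs U C"
  shows "l X \<cdot>\<^bsub>graph_cat U C\<^esub> mmult (graph_monad T) (\<Gamma> X) =
      \<Gamma>a (mmult (graph_monad T) X) \<cdot>\<^bsub>graph_cat U C\<^esub> l (GT X) \<cdot>\<^bsub>graph_cat U C\<^esub>
        farr (graph_functor (mfun T)) (l X) \<longleftrightarrow>
    (\<forall>p. p \<in> verts X \<times> verts X \<longrightarrow> law_\<mu> X p)"
  unfolding law_\<mu>_def
  by (subst graph_map_eq_iff[where S = "verts X \<times> verts X"])
    (use X in \<open>auto simp: restrict_def extensional_def graph_fobj_comp\<close>)

lemma law_\<sigma>_iff:
  assumes X: "X \<in> graphs U C"
  shows "l X \<cdot>\<^bsub>graph_cat U C\<^esub> farr (graph_functor (mfun T)) (Gamma_mult C E X) =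
      Gamma_mult C E (GT X) \<cdot>\<^bsub>graph_cat U C\<^esub> \<Gamma>a (l X) \<cdot>\<^bsub>graph_cat U C\<^esub> l (\<Gamma> X) \<longleftrightarrow>
    (\<forall>p. p \<in> verts X \<times> verts X \<longrightarrow> law_\<sigma> X p)"
  unfolding law_\<sigma>_def
  by (subst graph_map_eq_iff[where S = "verts X \<times> verts X"])
    (use X in \<open>auto simp: restrict_def extensional_def\<close>)

lemma distributive_law_iff:
  "is_distributive_law (graph_cat U C) (Gamma_monad C E) (graph_monad T) l \<longleftrightarrow>
    (\<forall>f\<in>graph_maps U C. \<forall>p. p \<in> verts (gdom f) \<times> verts (gdom f) \<longrightarrow> law_nat f p) \<and>
    (\<forall>X\<in>graphs U C. \<forall>p. p \<in> verts X \<times> verts X \<longrightarrow>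
      law_\<eta> X p \<and> law_u X p \<and> law_\<mu> X p \<and> law_\<sigma> X p)"
proof -
  have "is_natural (graph_cat U C) (graph_cat U C) (mfun (graph_monad T) \<circ>\<circ> mfun (Gamma_monad C E))
      (mfun (Gamma_monad C E) \<circ>\<circ> mfun (graph_monad T)) l \<longleftrightarrow>
    (\<forall>f\<in>graph_maps U C. \<forall>p. p \<in> verts (gdom f) \<times> verts (gdom f) \<longrightarrow> law_nat f p)"
    unfolding is_natural_def using law_nat_iff l_map by auto
  then show ?thesis unfolding is_distributive_law_def
    using law_\<eta>_iff law_u_iff law_\<mu>_iff law_\<sigma>_iff by auto
qed

end

text \<open>On the summand indexed by a path, the two sides of each axiom of a distributive law are an
  injection after the two sides of an axiom of \<open>\<tau>\<close>.\<close>

locale gamma_law = graph_transformation C T E U l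
  for C :: "('o, 'a) category" (structure) and T E and U :: "'x set set" and l +
  fixes \<tau> :: "'o list \<Rightarrow> 'a"
  assumes \<tau>_simps [simp]: "objs Xs \<Longrightarrow> \<tau> Xs \<in> Arr C"
      "objs Xs \<Longrightarrow> Dom C (\<tau> Xs) = To (Eo Xs)"
      "objs Xs \<Longrightarrow> Cod C (\<tau> Xs) = Eo (map To Xs)"
    and l_inc: "X \<in> graphs U C \<Longrightarrow> xs \<noteq> [] \<Longrightarrow> set xs \<subseteq> verts X \<Longrightarrow>
      garr (l X) (ends xs) \<cdot> Ta (inc X xs) = inc (GT X) xs \<cdot> \<tau> (map (ghom X) (steps xs))"
begin

lemma nat_left:
  assumes f: "f \<in> graph_maps U C" and xs: "xs \<noteq> []" "set xs \<subseteq> verts (gdom f)"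
  shows "garr (l (gcod f)) (gver f (fst (ends xs)), gver f (snd (ends xs))) \<cdot> Ta (garr (\<Gamma>a f) (ends xs)) \<cdot>
      Ta (inc (gdom f) xs) = inc (GT (gcod f)) (map (gver f) xs) \<cdot>
      (\<tau> (map (\<lambda>p. ghom (gcod f) (gver f (fst p), gver f (snd p))) (steps xs)) \<cdot> Ta (Ea (map (garr f) (steps xs))))"
proof -
  let ?e = "(gver f (fst (ends xs)), gver f (snd (ends xs)))" and ?ys = "map (gver f) xs"
  have ys: "?ys \<noteq> []" "set ?ys \<subseteq> verts (gcod f)" using xs f by simp_all
  have e: "?e = ends ?ys" using xs by (simp add: ends_map)
  have "garr (l (gcod f)) ?e \<cdot> Ta (garr (\<Gamma>a f) (ends xs)) \<cdot> Ta (inc (gdom f) xs) =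
      garr (l (gcod f)) ?e \<cdot> Ta (garr (\<Gamma>a f) (ends xs) \<cdot> inc (gdom f) xs)"
    using f xs by simp
  also have "\<dots> = (garr (l (gcod f)) (ends ?ys) \<cdot> Ta (inc (gcod f) ?ys)) \<cdot> Ta (Ea (map (garr f) (steps xs)))"
    unfolding \<Gamma>a_inc[OF f xs] e using f xs ys by (simp add: steps_map ends_map)
  also have "\<dots> = inc (GT (gcod f)) ?ys \<cdot>
      (\<tau> (map (\<lambda>p. ghom (gcod f) (gver f (fst p), gver f (snd p))) (steps xs)) \<cdot> Ta (Ea (map (garr f) (steps xs))))"
    unfolding l_inc[OF graph_map_simps(2)[OF f] ys] using f xs ys by (simp add: steps_map)
  finally show ?thesis .
qed

lemma nat_right:
  assumes f: "f \<in> graph_maps U C" and xs: "xs \<noteq> []" "set xs \<subseteq> verts (gdom f)"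
  shows "garr (\<Gamma>a (farr (graph_functor (mfun T)) f)) (ends xs) \<cdot> garr (l (gdom f)) (ends xs) \<cdot> Ta (inc (gdom f) xs) =
    inc (GT (gcod f)) (map (gver f) xs) \<cdot>
      (Ea (map (\<lambda>p. Ta (garr f p)) (steps xs)) \<cdot> \<tau> (map (ghom (gdom f)) (steps xs)))"
proof -
  let ?f = "farr (graph_functor (mfun T)) f"
  have "garr (\<Gamma>a ?f) (ends xs) \<cdot> garr (l (gdom f)) (ends xs) \<cdot> Ta (inc (gdom f) xs) =
      garr (\<Gamma>a ?f) (ends xs) \<cdot> (garr (l (gdom f)) (ends xs) \<cdot> Ta (inc (gdom f) xs))"
    using f xs GTa_map[OF f] by simp
  also have "\<dots> = (garr (\<Gamma>a ?f) (ends xs) \<cdot> inc (gdom ?f) xs) \<cdot> \<tau> (map (ghom (gdom f)) (steps xs))"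
    unfolding l_inc[OF graph_map_simps(1)[OF f] xs] using f xs GTa_map[OF f] by simp
  also have "\<dots> = inc (GT (gcod f)) (map (gver f) xs) \<cdot>
      (Ea (map (\<lambda>p. Ta (garr f p)) (steps xs)) \<cdot> \<tau> (map (ghom (gdom f)) (steps xs)))"
    using f xs \<Gamma>a_inc[OF GTa_map[OF f], of xs] by (simp add: steps_map ends_map)
  finally show ?thesis .
qed

lemma unit_left:
  assumes X: "X \<in> graphs U C" and p: "p \<in> verts X \<times> verts X"
  shows "garr (l X) p \<cdot> Ta (garr (Gamma_unit C E X) p) =
    inc (GT X) [fst p, snd p] \<cdot> (\<tau> [ghom X p] \<cdot> Ta (u (ghom X p)))"
proof -
  have li: "garr (l X) p \<cdot> Ta (inc X [fst p, snd p]) = inc (GT X) [fst p, snd p] \<cdot> \<tau> [ghom X p]"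
    using l_inc[OF X, of "[fst p, snd p]"] p by simp
  have "garr (l X) p \<cdot> Ta (garr (Gamma_unit C E X) p) =
      (garr (l X) p \<cdot> Ta (inc X [fst p, snd p])) \<cdot> Ta (u (ghom X p))"
    using X p by (simp add: unit_garr)
  then show ?thesis unfolding li using X p by simp
qed

lemma \<eta>_left:
  assumes X: "X \<in> graphs U C" and xs: "xs \<noteq> []" "set xs \<subseteq> verts X"
  shows "garr (l X) (ends xs) \<cdot> \<eta> (ghom (\<Gamma> X) (ends xs)) \<cdot> inc X xs =
    inc (GT X) xs \<cdot> (\<tau> (map (ghom X) (steps xs)) \<cdot> \<eta> (Eo (map (ghom X) (steps xs))))"
proof -
  have "garr (l X) (ends xs) \<cdot> \<eta> (ghom (\<Gamma> X) (ends xs)) \<cdot> inc X xs =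
      (garr (l X) (ends xs) \<cdot> Ta (inc X xs)) \<cdot> \<eta> (Eo (map (ghom X) (steps xs)))"
    using X xs by (simp add: \<eta>_nat)
  then show ?thesis unfolding l_inc[OF X xs] using X xs by simp
qed

lemma \<eta>_right:
  assumes X: "X \<in> graphs U C" and xs: "xs \<noteq> []" "set xs \<subseteq> verts X"
  shows "garr (\<Gamma>a (munit (graph_monad T) X)) (ends xs) \<cdot> inc X xs =
    inc (GT X) xs \<cdot> Ea (map (\<lambda>p. \<eta> (ghom X p)) (steps xs))"
  using \<Gamma>a_inc[OF \<eta>_map[OF X], of xs] X xs by (simp add: graph_fobj_id)

lemma \<mu>_left:
  assumes X: "X \<in> graphs U C" and xs: "xs \<noteq> []" "set xs \<subseteq> verts X"
  shows "garr (l X) (ends xs) \<cdot> \<mu> (ghom (\<Gamma> X) (ends xs)) \<cdot> Ta (Ta (inc X xs)) =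
    inc (GT X) xs \<cdot> (\<tau> (map (ghom X) (steps xs)) \<cdot> \<mu> (Eo (map (ghom X) (steps xs))))"
proof -
  have "garr (l X) (ends xs) \<cdot> \<mu> (ghom (\<Gamma> X) (ends xs)) \<cdot> Ta (Ta (inc X xs)) =
      (garr (l X) (ends xs) \<cdot> Ta (inc X xs)) \<cdot> \<mu> (Eo (map (ghom X) (steps xs)))"
    using X xs by (simp add: \<mu>_nat)
  then show ?thesis unfolding l_inc[OF X xs] using X xs by simp
qed

lemma \<mu>_right:
  assumes X: "X \<in> graphs U C" and xs: "xs \<noteq> []" "set xs \<subseteq> verts X"
  shows "garr (\<Gamma>a (mmult (graph_monad T) X)) (ends xs) \<cdot> garr (l (GT X)) (ends xs) \<cdot>
      Ta (garr (l X) (ends xs)) \<cdot> Ta (Ta (inc X xs)) =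
    inc (GT X) xs \<cdot> (Ea (map (\<lambda>p. \<mu> (ghom X p)) (steps xs)) \<cdot>
      (\<tau> (map (\<lambda>p. To (ghom X p)) (steps xs)) \<cdot> Ta (\<tau> (map (ghom X) (steps xs)))))"
proof -
  let ?m = "garr (\<Gamma>a (mmult (graph_monad T) X)) (ends xs)"
  have m: "?m \<cdot> inc (GT (GT X)) xs = inc (GT X) xs \<cdot> Ea (map (\<lambda>p. \<mu> (ghom X p)) (steps xs))"
    using \<Gamma>a_inc[OF \<mu>_map[OF X], of xs] X xs by (simp add: graph_fobj_comp)
  have ms: "?m \<in> Arr C" "Dom C ?m = ghom (\<Gamma> (GT (GT X))) (ends xs)" "Cod C ?m = ghom (\<Gamma> (GT X)) (ends xs)"
    using \<Gamma>a_garr[OF \<mu>_map[OF X], of "ends xs"] X xs by (simp_all add: graph_fobj_comp)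
  have "?m \<cdot> garr (l (GT X)) (ends xs) \<cdot> Ta (garr (l X) (ends xs)) \<cdot> Ta (Ta (inc X xs)) =
      ?m \<cdot> (garr (l (GT X)) (ends xs) \<cdot> Ta (garr (l X) (ends xs) \<cdot> Ta (inc X xs)))"
    using X xs ms by simp
  also have "\<dots> = ?m \<cdot> ((garr (l (GT X)) (ends xs) \<cdot> Ta (inc (GT X) xs)) \<cdot> Ta (\<tau> (map (ghom X) (steps xs))))"
    unfolding l_inc[OF X xs] using X xs ms by simp
  also have "\<dots> = (?m \<cdot> inc (GT (GT X)) xs) \<cdot> (\<tau> (map (\<lambda>p. To (ghom X p)) (steps xs)) \<cdot> Ta (\<tau> (map (ghom X) (steps xs))))"
    using X xs ms l_inc[of "GT X" xs] by simp
  finally show ?thesis unfolding m using X xs by simp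
qed

lemma \<sigma>_left:
  assumes X: "X \<in> graphs U C" and n: "(ys, pss) \<in> nested_paths (verts X)"
  shows "garr (l X) (ends ys) \<cdot> Ta (garr (Gamma_mult C E X) (ends ys)) \<cdot>
      Ta (inc (\<Gamma> X) ys \<cdot> Ea (map (inc X) pss)) =
    inc (GT X) (join ys pss) \<cdot> (\<tau> (concat (map (\<lambda>ps. map (ghom X) (steps ps)) pss)) \<cdot>
      Ta (\<sigma> (map (\<lambda>ps. map (ghom X) (steps ps)) pss)))"
proof -
  note nD = nested_pathsD[OF n]
  have ps: "\<And>ps. ps \<in> set pss \<Longrightarrow> ps \<noteq> []" "\<And>ps. ps \<in> set pss \<Longrightarrow> set ps \<subseteq> verts X" using nD(8) by auto
  have e: "ends ys \<in> verts X \<times> verts X" using nD by simp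
  let ?m = "garr (Gamma_mult C E X) (ends ys)" and ?i = "inc (\<Gamma> X) ys \<cdot> Ea (map (inc X) pss)"
  note m = mult_garr(1-3)[OF X e]
  have i: "?i \<in> Arr C" "Cod C ?i = ghom (\<Gamma> (\<Gamma> X)) (ends ys)"
    using X ps nD(1,2) by (simp_all add: nD(7))
  have mi: "?m \<cdot> ?i = inc X (join ys pss) \<cdot> \<sigma> (map (\<lambda>ps. map (ghom X) (steps ps)) pss)"
    using mult_garr(4)[OF X e, of "(ys, pss)"] n by simp
  have "garr (l X) (ends ys) \<cdot> Ta ?m \<cdot> Ta ?i = garr (l X) (ends ys) \<cdot> Ta (?m \<cdot> ?i)"
    using X e m i by (simp del: comp_simps(2) Ta_comp add: Ta_comp[OF i(1) m(1)])
  also have "\<dots> = (garr (l X) (ends (join ys pss)) \<cdot> Ta (inc X (join ys pss))) \<cdot>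
      Ta (\<sigma> (map (\<lambda>ps. map (ghom X) (steps ps)) pss))"
    unfolding mi using X ps nD(3,4) e by (simp add: nD(5,6))
  also have "\<dots> = inc (GT X) (join ys pss) \<cdot> (\<tau> (concat (map (\<lambda>ps. map (ghom X) (steps ps)) pss)) \<cdot>
      Ta (\<sigma> (map (\<lambda>ps. map (ghom X) (steps ps)) pss)))"
    unfolding l_inc[OF X nD(3,4)] using X ps nD(3,4) by (simp add: nD(5,6))
  finally show ?thesis .
qed

text \<open>Naturality of \<tau> is a hypothesis here because \<open>gamma_law\<close> serves both
  directions: in one it is given, in the other it must first be derived from naturality of the law.
  It is applied at the injections of the blocks.\<close>

lemma \<sigma>_right:
  assumes X: "X \<in> graphs U C" and n: "(ys, pss) \<in> nested_paths (verts X)"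
    and nat: "\<And>f a b (is :: 'x list list). (\<forall>i\<in>set is. f i \<in> Arr C \<and> Dom C (f i) = a i \<and> Cod C (f i) = b i) \<Longrightarrow>
      \<tau> (map b is) \<cdot> Ta (Ea (map f is)) = Ea (map (\<lambda>i. Ta (f i)) is) \<cdot> \<tau> (map a is)"
  shows "garr (Gamma_mult C E (GT X)) (ends ys) \<cdot> garr (\<Gamma>a (l X)) (ends ys) \<cdot> garr (l (\<Gamma> X)) (ends ys) \<cdot>
      Ta (inc (\<Gamma> X) ys \<cdot> Ea (map (inc X) pss)) =
    inc (GT X) (join ys pss) \<cdot> (\<sigma> (map (\<lambda>ps. map (\<lambda>p. To (ghom X p)) (steps ps)) pss) \<cdot>
      (Ea (map (\<lambda>ps. \<tau> (map (ghom X) (steps ps))) pss) \<cdot>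
       \<tau> (map (\<lambda>ps. Eo (map (ghom X) (steps ps))) pss)))"
proof -
  note nD = nested_pathsD[OF n]
  have ps: "\<And>ps. ps \<in> set pss \<Longrightarrow> ps \<noteq> []" "\<And>ps. ps \<in> set pss \<Longrightarrow> set ps \<subseteq> verts X" using nD(8) by auto
  have e: "ends ys \<in> verts X \<times> verts X" using nD by simp
  let ?m = "garr (Gamma_mult C E (GT X)) (ends ys)" and ?l = "garr (\<Gamma>a (l X)) (ends ys)"
  let ?\<tau> = "\<tau> (map (\<lambda>ps. Eo (map (ghom X) (steps ps))) pss)"
  let ?E\<tau> = "Ea (map (\<lambda>ps. \<tau> (map (ghom X) (steps ps))) pss)"
  have m: "?m \<in> Arr C" "Dom C ?m = ghom (\<Gamma> (\<Gamma> (GT X))) (ends ys)" "Cod C ?m = ghom (\<Gamma> (GT X)) (ends ys)"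
    using mult_garr(1-3)[of "GT X" "ends ys"] X e by simp_all
  have l: "?l \<in> Arr C" "Dom C ?l = ghom (\<Gamma> (GT (\<Gamma> X))) (ends ys)" "Cod C ?l = ghom (\<Gamma> (\<Gamma> (GT X))) (ends ys)"
    using \<Gamma>a_garr[OF l_map[OF X], of "ends ys"] X e by simp_all
  have mi: "?m \<cdot> (inc (\<Gamma> (GT X)) ys \<cdot> Ea (map (inc (GT X)) pss)) =
      inc (GT X) (join ys pss) \<cdot> \<sigma> (map (\<lambda>ps. map (\<lambda>p. To (ghom X p)) (steps ps)) pss)"
    using mult_garr(4)[of "GT X" "ends ys" "(ys, pss)"] n e X ps by simp
  have li: "?l \<cdot> inc (GT (\<Gamma> X)) ys = inc (\<Gamma> (GT X)) ys \<cdot> Ea (map (\<lambda>ps. garr (l X) (ends ps)) pss)"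
    using \<Gamma>a_inc[OF l_map[OF X], of ys] X nD(1,2) by (simp add: nD(7))
  have inner: "map (\<lambda>ps. garr (l X) (ends ps) \<cdot> Ta (inc X ps)) pss =
      map (\<lambda>ps. inc (GT X) ps \<cdot> \<tau> (map (ghom X) (steps ps))) pss"
    using ps by (intro list.map_cong0) (simp add: l_inc[OF X])
  have n1: "\<tau> (map (\<lambda>ps. ghom (\<Gamma> X) (ends ps)) pss) \<cdot> Ta (Ea (map (inc X) pss)) = Ea (map (\<lambda>ps. Ta (inc X ps)) pss) \<cdot> ?\<tau>"
    using X ps by (intro nat) simp
  have i: "Ea (map (inc X) pss) \<in> Arr C" "Cod C (Ea (map (inc X) pss)) = Eo (map (\<lambda>ps. ghom (\<Gamma> X) (ends ps)) pss)"
    using X ps by simp_all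
  have "?m \<cdot> ?l \<cdot> garr (l (\<Gamma> X)) (ends ys) \<cdot> Ta (inc (\<Gamma> X) ys \<cdot> Ea (map (inc X) pss)) =
     ?m \<cdot> (?l \<cdot> ((garr (l (\<Gamma> X)) (ends ys) \<cdot> Ta (inc (\<Gamma> X) ys)) \<cdot> Ta (Ea (map (inc X) pss))))"
    using X nD(1,2) e m l i ps by (simp add: nD(7))
  also have "\<dots> = ?m \<cdot> ((?l \<cdot> inc (GT (\<Gamma> X)) ys) \<cdot> (\<tau> (map (\<lambda>ps. ghom (\<Gamma> X) (ends ps)) pss) \<cdot> Ta (Ea (map (inc X) pss))))"
    using l_inc[of "\<Gamma> X" ys] X nD(1,2) e m l ps by (simp add: nD(7))
  also have "\<dots> = ?m \<cdot> (inc (\<Gamma> (GT X)) ys \<cdot> (Ea (map (\<lambda>ps. garr (l X) (ends ps) \<cdot> Ta (inc X ps)) pss) \<cdot> ?\<tau>))"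
    unfolding li n1 using X nD(1,2) e m l ps by (simp add: nD(7) Ea_comp)
  also have "\<dots> = (?m \<cdot> (inc (\<Gamma> (GT X)) ys \<cdot> Ea (map (inc (GT X)) pss))) \<cdot> (?E\<tau> \<cdot> ?\<tau>)"
    unfolding inner using X nD(1,2) e m l ps by (simp add: nD(7) Ea_comp)
  also have "\<dots> = inc (GT X) (join ys pss) \<cdot> (\<sigma> (map (\<lambda>ps. map (\<lambda>p. To (ghom X p)) (steps ps)) pss) \<cdot> (?E\<tau> \<cdot> ?\<tau>))"
    unfolding mi using X ps nD(3,4) by (simp add: nD(5,6))
  finally show ?thesis .
qed

end

section \<open>From an opmonoidal structure to a distributive law\<close>

locale opmon_gamma = opmon C T E \<tau> + gamma C T E U
  for C :: "('o, 'a) category" (structure) and T E \<tau> and U :: "'x set set"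
begin

abbreviation "l \<equiv> distributive_law_of U C E T \<tau>"

lemma law_simps:
  assumes "X \<in> graphs U C"
  shows "gdom (l X) = GT (\<Gamma> X)" "gcod (l X) = \<Gamma> (GT X)" "gver (l X) = (\<lambda>a\<in>verts X. a)"
    "garr (l X) \<in> extensional (verts X \<times> verts X)"
  using assms by (simp_all add: distributive_law_of_def)

lemma law_garr:
  assumes X: "X \<in> graphs U C" and p: "p \<in> verts X \<times> verts X"
  shows "garr (l X) p \<in> Arr C" "Dom C (garr (l X) p) = To (ghom (\<Gamma> X) p)"
    "Cod C (garr (l X) p) = ghom (\<Gamma> (GT X)) p"
    "\<And>xs. xs \<in> paths (verts X) (fst p) (snd p) \<Longrightarrow> garr (l X) p \<cdot> Ta (inc X xs) =
      inc (GT X) xs \<cdot> \<tau> (map (ghom X) (steps xs))"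
proof -
  let ?g = "\<lambda>xs. inc (GT X) xs \<cdot> \<tau> (map (ghom X) (steps xs))"
  have d: "ghom (\<Gamma> (GT X)) p \<in> Obj C" using X p by simp
  have g: "?g xs \<in> Arr C \<and> Dom C (?g xs) = To (Eo (map (ghom X) (steps xs))) \<and> Cod C (?g xs) = ghom (\<Gamma> (GT X)) p"
    if "xs \<in> paths (verts X) (fst p) (snd p)" for xs
  proof -
    have xs: "xs \<noteq> []" "set xs \<subseteq> verts X" "ends xs = p" using that by (simp_all add: paths_iff)
    then show ?thesis using X by simp
  qed
  have "garr (l X) p = (THE h. h \<in> hom C (To (ghom (\<Gamma> X) p)) (ghom (\<Gamma> (GT X)) p) \<and>
      (\<forall>xs\<in>paths (verts X) (fst p) (snd p). h \<cdot> Ta (inc X xs) = ?g xs))"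
    using X p by (simp add: distributive_law_of_def case_prod_unfold)
  note the = the_coproduct[OF T_coproduct[OF small_ends[OF X] \<Gamma>_coproduct[OF X p]] d g this]
  show "garr (l X) p \<in> Arr C" "Dom C (garr (l X) p) = To (ghom (\<Gamma> X) p)"
    "Cod C (garr (l X) p) = ghom (\<Gamma> (GT X)) p" by (rule the; assumption)+
  show "garr (l X) p \<cdot> Ta (inc X xs) = ?g xs"
    if "xs \<in> paths (verts X) (fst p) (snd p)" for xs using that by (rule the(4)[rotated])
qed

end

sublocale opmon_gamma \<subseteq> law: gamma_law C T E U "distributive_law_of U C E T \<tau>" \<tau>
proof unfold_locales
  fix X :: "('x, 'o) graph" assume X: "X \<in> graphs U C"
  show "l X \<in> graph_maps U C"
    unfolding graph_maps_iff[of "l X"] law_simps[OF X] using X law_garr[OF X] law_simps(4)[OF X] by simp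
  show "gdom (l X) = GT (\<Gamma> X)" "gcod (l X) = \<Gamma> (GT X)" "gver (l X) = (\<lambda>a\<in>verts X. a)"
    by (rule law_simps[OF X])+
next
  fix X xs assume X: "X \<in> graphs U C" and xs: "xs \<noteq> []" "set xs \<subseteq> verts X"
  show "garr (l X) (ends xs) \<cdot> Ta (inc X xs) = inc (GT X) xs \<cdot> \<tau> (map (ghom X) (steps xs))"
    using law_garr(4)[OF X ends_mem[OF xs] ends_paths[OF xs]] .
qed simp_all

context opmon_gamma
begin

lemma law_nat:
  assumes f: "f \<in> graph_maps U C" and p: "p \<in> verts (gdom f) \<times> verts (gdom f)"
  shows "law.law_nat f p"
  unfolding law.law_nat_def
proof (rule T_\<Gamma>_eq[OF graph_map_simps(1)[OF f] p])
  fix xs assume xs: "xs \<noteq> []" "set xs \<subseteq> verts (gdom f)" and e: "ends xs = p"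
  have "Ea (map (\<lambda>i. Ta (garr f i)) (steps xs)) \<cdot> \<tau> (map (ghom (gdom f)) (steps xs)) =
      \<tau> (map (\<lambda>p. ghom (gcod f) (gver f (fst p), gver f (snd p))) (steps xs)) \<cdot> Ta (Ea (map (garr f) (steps xs)))"
    using f xs by (intro \<tau>_nat) simp
  then show "garr (l (gcod f)) (gver f (fst p), gver f (snd p)) \<cdot> Ta (garr (\<Gamma>a f) p) \<cdot> Ta (inc (gdom f) xs) =
      garr (\<Gamma>a (farr (graph_functor (mfun T)) f)) p \<cdot> garr (l (gdom f)) p \<cdot> Ta (inc (gdom f) xs)"
    unfolding e[symmetric] law.nat_left[OF f xs] law.nat_right[OF f xs] by simp
qed (use f p GTa_map[OF f] in simp_all)

text \<open>The unit of \<Gamma> factors through the summand of a one-step path, so the axiom is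
  \<open>\<tau>_u\<close> followed by that injection.\<close>

lemma law_u:
  assumes X: "X \<in> graphs U C" and p: "p \<in> verts X \<times> verts X"
  shows "law.law_u X p"
  unfolding law.law_u_def law.unit_left[OF X p] using X p by (simp add: unit_garr \<tau>_u)

lemma law_\<eta>:
  assumes X: "X \<in> graphs U C" and p: "p \<in> verts X \<times> verts X"
  shows "law.law_\<eta> X p"
  unfolding law.law_\<eta>_def
proof (rule coproduct_eq[OF \<Gamma>_coproduct[OF X p]])
  fix xs assume "xs \<in> paths (verts X) (fst p) (snd p)"
  then have xs: "xs \<noteq> []" "set xs \<subseteq> verts X" and e: "ends xs = p" by (simp_all add: paths_iff)
  show "garr (l X) p \<cdot> \<eta> (ghom (\<Gamma> X) p) \<cdot> inc X xs = garr (\<Gamma>a (munit (graph_monad T) X)) p \<cdot> inc X xs"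
    unfolding e[symmetric] law.\<eta>_left[OF X xs] law.\<eta>_right[OF X xs]
    using X xs \<tau>_\<eta>[of "map (ghom X) (steps xs)"] by simp
qed (use X p \<Gamma>a_garr_simps[OF \<eta>_map[OF X], of p] in \<open>simp_all add: graph_fobj_id\<close>)

text \<open>The common source is \<open>TT\<close> of a coproduct; preservation applied twice
  permits testing on \<open>TT\<close> of the injections.\<close>

lemma law_\<mu>:
  assumes X: "X \<in> graphs U C" and p: "p \<in> verts X \<times> verts X"
  shows "law.law_\<mu> X p"
  unfolding law.law_\<mu>_def
proof (rule coproduct_eq[OF T_coproduct[OF small_ends[OF X] T_coproduct[OF small_ends[OF X] \<Gamma>_coproduct[OF X p]]]])
  fix xs assume "xs \<in> paths (verts X) (fst p) (snd p)"
  then have xs: "xs \<noteq> []" "set xs \<subseteq> verts X" and e: "ends xs = p" by (simp_all add: paths_iff)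
  show "garr (l X) p \<cdot> \<mu> (ghom (\<Gamma> X) p) \<cdot> Ta (Ta (inc X xs)) =
      garr (\<Gamma>a (mmult (graph_monad T) X)) p \<cdot> garr (l (GT X)) p \<cdot> Ta (garr (l X) p) \<cdot> Ta (Ta (inc X xs))"
    unfolding e[symmetric] law.\<mu>_left[OF X xs] law.\<mu>_right[OF X xs]
    using X xs \<tau>_\<mu>[of "map (ghom X) (steps xs)"] by simp
qed (use X p \<Gamma>a_garr_simps[OF \<mu>_map[OF X], of p] in \<open>simp_all add: graph_fobj_comp\<close>)

text \<open>Testing on \<open>T\<close> of the injections indexed by nested paths uses
  distributivity of \<open>E\<close> and preservation by \<open>T\<close> together.\<close>

lemma law_\<sigma>:
  assumes X: "X \<in> graphs U C" and p: "p \<in> verts X \<times> verts X"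
  shows "law.law_\<sigma> X p"
  unfolding law.law_\<sigma>_def
proof (rule coproduct_eq[OF T_coproduct[OF small_nested[OF X] nested_coproduct[OF X p]]])
  fix n assume "n \<in> nested X p"
  then have n: "(fst n, snd n) \<in> nested_paths (verts X)" and e: "ends (fst n) = p" by simp_all
  have ps: "\<And>ps. ps \<in> set (snd n) \<Longrightarrow> set ps \<subseteq> verts X" using nested_pathsD(8)[OF n] by blast
  have nat: "\<tau> (map b is) \<cdot> Ta (Ea (map f is)) = Ea (map (\<lambda>i. Ta (f i)) is) \<cdot> \<tau> (map a is)"
    if "\<forall>i\<in>set is. f i \<in> Arr C \<and> Dom C (f i) = a i \<and> Cod C (f i) = b i"
    for f a b and "is" :: "'x list list" using \<tau>_nat[OF that] by simp
  show "garr (l X) p \<cdot> Ta (garr (Gamma_mult C E X) p) \<cdot> Ta (inc (\<Gamma> X) (fst n) \<cdot> Ea (map (inc X) (snd n))) =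
      garr (Gamma_mult C E (GT X)) p \<cdot> garr (\<Gamma>a (l X)) p \<cdot> garr (l (\<Gamma> X)) p \<cdot>
      Ta (inc (\<Gamma> X) (fst n) \<cdot> Ea (map (inc X) (snd n)))"
    unfolding e[symmetric] law.\<sigma>_left[OF X n]
    by (subst law.\<sigma>_right[OF X n], erule nat)
      (use X ps \<tau>_\<sigma>[of "map (\<lambda>ps. map (ghom X) (steps ps)) (snd n)"] in simp)
qed (use X p \<Gamma>a_garr_simps[OF law.l_map[OF X], of p] mult_garr(1-3)[OF X p] mult_garr(1-3)[OF GT_graph[OF X], of p] in simp_all)

lemma distributive_law_of_law: "distributive_law_of U C E T \<tau> \<in> graph_distributive_laws U C E T"
  unfolding graph_distributive_laws_def
  by (simp add: law.distributive_law_iff law_nat law_u law_\<eta> law_\<mu> law_\<sigma> law_simps del: split_paired_All)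
    (simp add: distributive_law_of_def)

end

section \<open>Recovering an opmonoidal structure from a distributive law\<close>

context cat
begin

definition "initial z \<longleftrightarrow> z \<in> Obj C \<and> (\<forall>d\<in>Obj C. \<exists>!h. h \<in> hom C z d)"

text \<open>An empty coproduct, whatever family is attached to the empty index set. Preservation of
  coproducts thus becomes preservation of initial objects.\<close>

lemma initial_iff: "initial z \<longleftrightarrow> is_coproduct C {} X z \<iota>"
  by (auto simp: initial_def is_coproduct_def)

lemma initial_eq:
  assumes "initial z" "h \<in> Arr C" "h' \<in> Arr C" "Dom C h = z" "Dom C h' = z" "Cod C h = Cod C h'"
  shows "h = h'"
proof -
  have "\<exists>!k. k \<in> hom C z (Cod C h)" using assms(1,2) unfolding initial_def by simp
  moreover have "h \<in> hom C z (Cod C h)" "h' \<in> hom C z (Cod C h)" using assms by simp_all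
  ultimately show ?thesis by blast
qed

definition "from_initial z d = (SOME h. h \<in> hom C z d)"

lemma from_initial [simp]:
  assumes "initial z" "d \<in> Obj C"
  shows "from_initial z d \<in> Arr C" "Dom C (from_initial z d) = z" "Cod C (from_initial z d) = d"
proof -
  have "\<exists>h. h \<in> hom C z d" using assms unfolding initial_def by blast
  then have "from_initial z d \<in> hom C z d" unfolding from_initial_def by (rule someI_ex)
  then show "from_initial z d \<in> Arr C" "Dom C (from_initial z d) = z" "Cod C (from_initial z d) = d" by simp_all
qed

definition "zero = (SOME z. initial z)"

end

context distrib
begin

lemma small_empty: "small U {}"
proof -
  have "{} \<in> U" using universe by (simp add: is_universe_def)
  then show ?thesis by (auto simp: small_def bij_betw_def)
qed

lemma zero_initial [simp]: "initial zero"
proof -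
  have "\<exists>c \<iota>. is_coproduct C ({} :: 'x list set) (\<lambda>_. undefined) c \<iota>"
    using coproducts[unfolded has_small_coproducts_def, rule_format, of "{}"] small_empty by simp
  then have "\<exists>z. initial z" by (elim exE) (rule exI, erule initial_iff[THEN iffD2])
  then show ?thesis unfolding zero_def by (rule someI_ex)
qed

lemma zero_obj [simp]: "zero \<in> Obj C"
  using zero_initial unfolding initial_def by blast

text \<open>Distributivity for the empty family, in the slot holding the initial object.\<close>

lemma E_initial:
  assumes "objs Xs" "d \<in> set Xs" "initial d"
  shows "initial (Eo Xs)"
proof -
  obtain Ys Zs where Xs: "Xs = Ys @ d # Zs" using assms(2) by (meson split_list)
  have "preserves_small_coproducts U C C (slot_functor C E Ys Zs)"
    using distributive assms(1) unfolding Xs by (simp add: is_distributive_def in_lists_conv_set)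
  moreover have "is_coproduct C ({} :: 'x list set) (\<lambda>_. d) d (\<lambda>_. undefined)"
    using assms(3) by (rule initial_iff[THEN iffD1])
  ultimately have "is_coproduct C ({} :: 'x list set) (\<lambda>_. fobj (slot_functor C E Ys Zs) d)
      (fobj (slot_functor C E Ys Zs) d) (\<lambda>_. farr (slot_functor C E Ys Zs) undefined)"
    using small_empty unfolding preserves_small_coproducts_def by blast
  then have "initial (fobj (slot_functor C E Ys Zs) d)" by (rule initial_iff[THEN iffD2])
  then show ?thesis unfolding Xs by (simp add: slot_functor_def)
qed

text \<open>Lists over a single vertex are infinitely many, yet closure of the universe puts them in
  bijection with a set of vertices. This provides room for lines of every length.\<close>

lemma infinite_vertices: "infinite (UNIV :: 'x set)"
proof
  assume fin: "finite (UNIV :: 'x set)"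
  have "small U (lists {undefined :: 'x})"
    using small_lists[OF universe small_member] universe by (simp add: is_universe_def)
  then obtain A f where "A \<in> U" "bij_betw f (lists {undefined :: 'x}) A" by (auto simp: small_def)
  then have "finite (lists {undefined :: 'x})"
    using fin by (meson bij_betw_finite finite_subset subset_UNIV)
  moreover have "inj (\<lambda>n. replicate n (undefined :: 'x))"
    by (metis injI length_replicate)
  moreover have "range (\<lambda>n. replicate n (undefined :: 'x)) \<subseteq> lists {undefined}"
    by (auto simp: in_lists_conv_set)
  ultimately show False by (meson finite_imageD finite_subset infinite_UNIV_nat)
qed

end

section \<open>Lines of vertices and straight paths\<close>

definition vertex :: "nat \<Rightarrow> 'x" where "vertex = (SOME f. inj f)"

text \<open>The position on the line at which the pair p starts; p is a step of the line when it
  ends one position later.\<close>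

definition index :: "'x \<times> 'x \<Rightarrow> nat" where "index p = inv vertex (fst p)"

text \<open>Both end points belong to the path, hence \<open>Suc b\<close>: there is one vertex more
  than the \<open>b - a\<close> steps.\<close>

definition straight :: "nat \<Rightarrow> nat \<Rightarrow> 'x list" where "straight a b = map vertex [a..<Suc b]"

lemma straight_simps [simp]:
  "a \<le> b \<Longrightarrow> straight a b \<noteq> []" "a \<le> b \<Longrightarrow> ends (straight a b) = (vertex a, vertex b)"
  "set (straight a b) = vertex ` {a..<Suc b}"
  by (auto simp: straight_def ends_def hd_map last_map hd_append simp del: upt_Suc)

lemma steps_straight: "steps (straight a b :: 'x list) = map (\<lambda>i. (vertex i, vertex (Suc i))) [a..<b]"
proof (induction b)
  case 0
  then show ?case by (cases a) (simp_all add: straight_def)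
next
  case (Suc b)
  show ?case
  proof (cases "a \<le> b")
    case True
    then have "straight a (Suc b) = (straight a b :: 'x list) @ [vertex (Suc b)]" by (simp add: straight_def)
    moreover have "last (straight a b :: 'x list) = vertex b" using True by (simp add: straight_def)
    ultimately show ?thesis using Suc True steps_append_tl[of "straight a b :: 'x list" "[vertex (Suc b)]"] by simp
  next
    case False
    then show ?thesis by (cases "a = Suc b") (simp_all add: straight_def)
  qed
qed

context distrib
begin

lemma inj_vertex: "inj (vertex :: nat \<Rightarrow> 'x)"
proof -
  have "\<exists>f :: nat \<Rightarrow> 'x. inj f"
    using infinite_countable_subset[OF infinite_vertices] by blast
  then show ?thesis unfolding vertex_def by (rule someI_ex)
qed

lemma vertex_eq [simp]: "(vertex i :: 'x) = vertex j \<longleftrightarrow> i = j"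
  using inj_vertex by (auto dest: injD)

lemma inv_vertex [simp]: "inv vertex (vertex i :: 'x) = i"
  using inj_vertex by simp

lemma index_vertex [simp]: "index (vertex i :: 'x, b) = i"
  by (simp add: index_def)

lemma straight_path:
  assumes "xs \<noteq> []" "hd xs = (vertex k :: 'x)" "\<forall>p\<in>set (steps xs). snd p = vertex (Suc (index p))"
  shows "xs = map vertex [k..<k + length xs]"
  using assms
proof (induction xs arbitrary: k rule: induct_list012)
  case (3 x y zs)
  have x: "x = vertex k" and y: "y = vertex (Suc k)" using "3.prems" by auto
  have IH: "y # zs = map vertex [Suc k..<Suc k + length (y # zs)]"
    using "3.prems" y by (intro "3.IH"(2)) simp_all
  have eq: "[k..<k + length (x # y # zs)] = k # [Suc k..<Suc k + length (y # zs)]"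
    by (simp add: upt_conv_Cons del: upt_Suc)
  show ?case unfolding eq list.map using x by (intro arg_cong2[where f = Cons] IH)
qed simp_all

text \<open>When each step leads to the next position, the start fixes the vertices and the end
  fixes the length. Any other path between these ends therefore has a step that leaves the
  line.\<close>

lemma straight_unique:
  assumes xs: "xs \<noteq> []" "ends xs = (vertex 0 :: 'x, vertex n)" "\<forall>p\<in>set (steps xs). snd p = vertex (Suc (index p))"
  shows "xs = straight 0 n"
proof -
  have eq: "xs = map vertex [0..<length xs]"
    using straight_path[of xs 0] assms by (simp add: ends_def)
  have "last xs = vertex (length xs - 1)" using xs(1) by (subst eq) (simp add: last_map)
  then have "length xs = Suc n" using xs(1,2) by (cases xs) (auto simp: ends_def)
  then show ?thesis using eq by (simp add: straight_def)
qed

text \<open>The graph that is \<open>X\<^sub>1, \<dots>, X\<^sub>n\<close> along a line of vertices and initial elsewhere. By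
  distributivity only the straight path contributes to \<open>\<Gamma>E\<close> between its ends.\<close>

definition line :: "'o list \<Rightarrow> ('x, 'o) graph" where
  "line Xs = \<lparr>verts = vertex ` {..length Xs}, ghom = (\<lambda>p\<in>vertex ` {..length Xs} \<times> vertex ` {..length Xs}.
     if snd p = vertex (Suc (index p)) then Xs ! index p else zero)\<rparr>"

lemma line_simps:
  "verts (line Xs) = vertex ` {..length Xs}"
  "p \<in> verts (line Xs) \<times> verts (line Xs) \<Longrightarrow>
    ghom (line Xs) p = (if snd p = vertex (Suc (index p)) then Xs ! index p else zero)"
  by (simp_all add: line_def)

lemma line_index:
  assumes "p \<in> verts (line Xs) \<times> verts (line Xs)"
  shows "fst p = vertex (index p)" "index p \<le> length Xs" "snd p = vertex (Suc (index p)) \<Longrightarrow> index p < length Xs"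
  using assms by (auto simp: line_simps)

lemma line_graph [simp]:
  assumes "objs Xs"
  shows "line Xs \<in> graphs U C"
  unfolding graphs_iff
proof (intro conjI allI impI)
  show "verts (line Xs) \<in> U" using universe by (simp add: line_simps is_universe_def)
  show "ghom (line Xs) \<in> extensional (verts (line Xs) \<times> verts (line Xs))" by (simp add: line_def)
  show "ghom (line Xs) p \<in> Obj C" if "p \<in> verts (line Xs) \<times> verts (line Xs)" for p
    using assms line_index(3)[OF that] by (simp add: line_simps(2)[OF that])
qed

abbreviation "st Xs \<equiv> (straight 0 (length Xs) :: 'x list)"

lemma st_path [simp]: "st Xs \<noteq> []" "set (st Xs) \<subseteq> verts (line Xs)"
  "ends (st Xs) = (vertex 0, vertex (length Xs))"
  by (auto simp: line_simps)

lemma line_straight: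
  assumes "b \<le> length Xs"
  shows "map (ghom (line Xs)) (steps (straight a b)) = map ((!) Xs) [a..<b]"
  unfolding steps_straight using assms by (auto simp: line_simps)

lemma line_st: "map (ghom (line Xs)) (steps (st Xs)) = Xs"
  by (simp add: line_straight map_nth del: map_fusion)

end

context gamma
begin

lemma T_initial: "initial d \<Longrightarrow> initial (To d)"
  by (rule initial_iff[THEN iffD2], rule T_coproduct[OF small_empty]) (rule initial_iff[THEN iffD1])

lemma GT_line_st: 
  assumes "objs Xs"
  shows "map (ghom (GT (line Xs))) (steps (st Xs)) = map To Xs"
proof -
  have "map (ghom (GT (line Xs))) (steps (st Xs)) = map To (map (ghom (line Xs)) (steps (st Xs)))"
    using st_path(2)[of Xs] by simp
  then show ?thesis unfolding line_st .
qed

text \<open>A path other than the straight one has a step whose hom is \<open>To zero\<close>, hence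
  an initial summand. A coproduct in which all summands but one are initial is isomorphic to that
  one through its injection.\<close>

lemma ex_retraction:
  assumes Xs: "objs Xs"
  shows "\<exists>r. r \<in> Arr C \<and> Dom C r = ghom (\<Gamma> (GT (line Xs))) (vertex 0, vertex (length Xs)) \<and>
    Cod C r = Eo (map To Xs) \<and> r \<cdot> inc (GT (line Xs)) (st Xs) = Ident C (Eo (map To Xs)) \<and>
    inc (GT (line Xs)) (st Xs) \<cdot> r = Ident C (ghom (\<Gamma> (GT (line Xs))) (vertex 0, vertex (length Xs)))"
proof -
  let ?Y = "GT (line Xs)" and ?p = "(vertex 0, vertex (length Xs)) :: 'x \<times> 'x" and ?d = "Eo (map To Xs)"
  have Y: "?Y \<in> graphs U C" using Xs by simp
  have p: "?p \<in> verts ?Y \<times> verts ?Y" by (auto simp: line_simps)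
  have vY: "verts ?Y = verts (line Xs)" by simp
  have cop: "is_coproduct C (paths (verts ?Y) (fst ?p) (snd ?p)) (\<lambda>xs. Eo (map (ghom ?Y) (steps xs)))
      (ghom (\<Gamma> ?Y) ?p) (inc ?Y)" by (rule \<Gamma>_coproduct[OF Y p])
  have init: "initial (Eo (map (ghom ?Y) (steps xs)))"
    if path: "xs \<in> paths (verts ?Y) (fst ?p) (snd ?p)" and ne: "xs \<noteq> st Xs" for xs
  proof -
    have xs: "xs \<noteq> []" "set xs \<subseteq> verts (line Xs)" "ends xs = ?p" using path by (simp_all add: paths_iff)
    obtain q where q: "q \<in> set (steps xs)" "snd q \<noteq> vertex (Suc (index q))"
      using straight_unique[OF xs(1,3)] ne by blast
    have "q \<in> verts (line Xs) \<times> verts (line Xs)" using set_steps[OF q(1) xs(2)] .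
    then have "ghom ?Y q = To zero" using q(2) by (simp add: line_simps(2))
    moreover have "ghom ?Y q \<in> set (map (ghom ?Y) (steps xs))" using q(1) by simp
    moreover have "\<forall>Z\<in>set (map (ghom ?Y) (steps xs)). Z \<in> Obj C" using Xs xs(2) by simp
    ultimately show ?thesis using E_initial T_initial[OF zero_initial] by metis
  qed
  have st: "st Xs \<in> paths (verts ?Y) (fst ?p) (snd ?p)" unfolding vY paths_iff fst_conv snd_conv by (intro conjI st_path)
  have d: "?d \<in> Obj C" using Xs by simp
  \<comment> \<open>The inverse is the identity on the straight summand and the only possible arrow
    on every other one.\<close>
  let ?g = "\<lambda>xs. if xs = st Xs then Ident C ?d else from_initial (Eo (map (ghom ?Y) (steps xs))) ?d"
  have g: "?g xs \<in> Arr C \<and> Dom C (?g xs) = Eo (map (ghom ?Y) (steps xs)) \<and> Cod C (?g xs) = ?d"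
    if "xs \<in> paths (verts ?Y) (fst ?p) (snd ?p)" for xs
    using init[OF that] d GT_line_st[OF Xs] by (cases "xs = st Xs") (simp_all del: graph_fobj_simps)
  obtain r where r: "r \<in> hom C (ghom (\<Gamma> ?Y) ?p) ?d"
    "\<forall>xs\<in>paths (verts ?Y) (fst ?p) (snd ?p). r \<cdot> inc ?Y xs = ?g xs"
    using coproduct_ex1[OF cop d g] by blast
  have i: "inc ?Y (st Xs) \<in> Arr C" "Dom C (inc ?Y (st Xs)) = ?d" "Cod C (inc ?Y (st Xs)) = ghom (\<Gamma> ?Y) ?p"
    using coproduct_simps(3-5)[OF cop st] GT_line_st[OF Xs] by simp_all
  have ri: "r \<cdot> inc ?Y (st Xs) = Ident C ?d" using r(2) st by simp
  have "inc ?Y (st Xs) \<cdot> r = Ident C (ghom (\<Gamma> ?Y) ?p)"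
  proof (rule coproduct_eq[OF cop])
    fix xs assume xs: "xs \<in> paths (verts ?Y) (fst ?p) (snd ?p)"
    note xi = coproduct_simps(3-5)[OF cop xs]
    have "inc ?Y (st Xs) \<cdot> r \<cdot> inc ?Y xs = inc ?Y xs"
    proof (cases "xs = st Xs")
      case True
      then show ?thesis using ri i r(1) by simp
    next
      case False
      show ?thesis
        by (rule initial_eq[OF init[OF xs False]]) (use i r(1) xi in simp_all)
    qed
    then show "inc ?Y (st Xs) \<cdot> r \<cdot> inc ?Y xs = Ident C (ghom (\<Gamma> ?Y) ?p) \<cdot> inc ?Y xs"
      using xi by simp
  qed (use i r(1) coproduct_simps(1)[OF cop] in simp_all)
  then show ?thesis using r(1) ri by auto
qed

definition "retraction Xs = (SOME r. r \<in> Arr C \<and> Dom C r = ghom (\<Gamma> (GT (line Xs))) (vertex 0, vertex (length Xs)) \<and>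
    Cod C r = Eo (map To Xs) \<and> r \<cdot> inc (GT (line Xs)) (st Xs) = Ident C (Eo (map To Xs)) \<and>
    inc (GT (line Xs)) (st Xs) \<cdot> r = Ident C (ghom (\<Gamma> (GT (line Xs))) (vertex 0, vertex (length Xs))))"

lemma retraction:
  assumes Xs: "objs Xs"
  shows "retraction Xs \<in> Arr C" "Dom C (retraction Xs) = ghom (\<Gamma> (GT (line Xs))) (vertex 0, vertex (length Xs))"
    "Cod C (retraction Xs) = Eo (map To Xs)" "retraction Xs \<cdot> inc (GT (line Xs)) (st Xs) = Ident C (Eo (map To Xs))"
    "inc (GT (line Xs)) (st Xs) \<cdot> retraction Xs = Ident C (ghom (\<Gamma> (GT (line Xs))) (vertex 0, vertex (length Xs)))"
  using someI_ex[OF ex_retraction[OF Xs]] unfolding retraction_def[symmetric] by blast+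

lemma inc_st:
  assumes Xs: "objs Xs"
  shows "inc (GT (line Xs)) (st Xs) \<in> Arr C" "Dom C (inc (GT (line Xs)) (st Xs)) = Eo (map To Xs)"
    "Cod C (inc (GT (line Xs)) (st Xs)) = ghom (\<Gamma> (GT (line Xs))) (vertex 0, vertex (length Xs))"
    "inc (line Xs) (st Xs) \<in> Arr C" "Dom C (inc (line Xs) (st Xs)) = Eo Xs"
    "Cod C (inc (line Xs) (st Xs)) = ghom (\<Gamma> (line Xs)) (vertex 0, vertex (length Xs))"
proof -
  have p: "set (st Xs) \<subseteq> verts (GT (line Xs))" unfolding graph_fobj_simps(1) by (rule st_path(2))
  have Y: "GT (line Xs) \<in> graphs U C" "line Xs \<in> graphs U C" using Xs by simp_all
  show "inc (GT (line Xs)) (st Xs) \<in> Arr C" "Dom C (inc (GT (line Xs)) (st Xs)) = Eo (map To Xs)"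
    "Cod C (inc (GT (line Xs)) (st Xs)) = ghom (\<Gamma> (GT (line Xs))) (vertex 0, vertex (length Xs))"
    using inc_simps[OF Y(1) st_path(1) p] unfolding GT_line_st[OF Xs] st_path(3) by blast+
  show "inc (line Xs) (st Xs) \<in> Arr C" "Dom C (inc (line Xs) (st Xs)) = Eo Xs"
    "Cod C (inc (line Xs) (st Xs)) = ghom (\<Gamma> (line Xs)) (vertex 0, vertex (length Xs))"
    using inc_simps[OF Y(2) st_path(1,2)] unfolding line_st st_path(3) by blast+
qed

text \<open>The retraction makes the straight injection monic; this turns axioms on summands back
  into axioms of \<tau>.\<close>

lemma inc_cancel:
  assumes Xs: "objs Xs" and h: "h \<in> Arr C" "h' \<in> Arr C" "Cod C h = Eo (map To Xs)" "Cod C h' = Eo (map To Xs)"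
    and e: "inc (GT (line Xs)) (st Xs) \<cdot> h = inc (GT (line Xs)) (st Xs) \<cdot> h'"
  shows "h = h'"
proof -
  have "retraction Xs \<cdot> inc (GT (line Xs)) (st Xs) \<cdot> k = retraction Xs \<cdot> (inc (GT (line Xs)) (st Xs) \<cdot> k)"
    if "k \<in> Arr C" "Cod C k = Eo (map To Xs)" for k
    using that retraction[OF Xs] inc_st[OF Xs] by (intro assoc) simp_all
  from this[of h] this[of h'] show ?thesis
    unfolding retraction(4)[OF Xs] e using h by simp
qed

end

lemma length_steps: "length (steps xs) = length xs - 1"
  by (simp add: steps_def)

lemma nth_steps: "i < length (steps xs) \<Longrightarrow> steps xs ! i = (xs ! i, xs ! Suc i)"
  by (auto simp: steps_def nth_tl)

lemma steps_upt: "steps [0..<Suc m] = map (\<lambda>k. (k, Suc k)) [0..<m]"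
  by (rule nth_equalityI) (simp_all add: length_steps nth_steps del: upt_Suc)

section \<open>From a distributive law to an opmonoidal structure\<close>

locale graph_law = graph_transformation C T E U l
  for C :: "('o, 'a) category" (structure) and T E and U :: "'x set set" and l +
  assumes law: "is_distributive_law (graph_cat U C) (Gamma_monad C E) (graph_monad T) l"
begin

lemma laws:
  shows "f \<in> graph_maps U C \<Longrightarrow> p \<in> verts (gdom f) \<times> verts (gdom f) \<Longrightarrow> law_nat f p"
    "X \<in> graphs U C \<Longrightarrow> p \<in> verts X \<times> verts X \<Longrightarrow> law_\<eta> X p"
    "X \<in> graphs U C \<Longrightarrow> p \<in> verts X \<times> verts X \<Longrightarrow> law_u X p"
    "X \<in> graphs U C \<Longrightarrow> p \<in> verts X \<times> verts X \<Longrightarrow> law_\<mu> X p"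
    "X \<in> graphs U C \<Longrightarrow> p \<in> verts X \<times> verts X \<Longrightarrow> law_\<sigma> X p"
  using law unfolding distributive_law_iff by blast+

lemma line_ends: "(vertex 0, vertex (length Xs)) \<in> verts (line Xs) \<times> verts (line Xs)"
  by (auto simp: line_simps)

text \<open>The restriction of the law to the straight summand, factored through the straight
  injection.\<close>

definition "tau Xs = retraction Xs \<cdot>
  (garr (l (line Xs)) (vertex 0, vertex (length Xs)) \<cdot> Ta (inc (line Xs) (st Xs)))"

lemma tau:
  assumes Xs: "objs Xs"
  shows "tau Xs \<in> Arr C" "Dom C (tau Xs) = To (Eo Xs)" "Cod C (tau Xs) = Eo (map To Xs)"
    "inc (GT (line Xs)) (st Xs) \<cdot> tau Xs =
      garr (l (line Xs)) (vertex 0, vertex (length Xs)) \<cdot> Ta (inc (line Xs) (st Xs))"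
proof -
  note r = retraction[OF Xs] and i = inc_st[OF Xs] and g = l_garr[OF line_graph[OF Xs] line_ends]
  show "tau Xs \<in> Arr C" "Dom C (tau Xs) = To (Eo Xs)" "Cod C (tau Xs) = Eo (map To Xs)"
    using r i g by (simp_all add: tau_def)
  have "inc (GT (line Xs)) (st Xs) \<cdot> tau Xs = (inc (GT (line Xs)) (st Xs) \<cdot> retraction Xs) \<cdot>
      (garr (l (line Xs)) (vertex 0, vertex (length Xs)) \<cdot> Ta (inc (line Xs) (st Xs)))"
    unfolding tau_def using r(1-3) i g by (intro assoc[symmetric]) simp_all
  then show "inc (GT (line Xs)) (st Xs) \<cdot> tau Xs =
      garr (l (line Xs)) (vertex 0, vertex (length Xs)) \<cdot> Ta (inc (line Xs) (st Xs))"
    unfolding r(5) using i g by simp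
qed

text \<open>The path may repeat vertices, so it is presented as the image of a line: the line on its
  homs maps to \<open>X\<close> by sending position i to \<open>xs ! i\<close>. Naturality of the
  law at this graph map carries the formula from the straight path to \<open>xs\<close>.\<close>

lemma tau_inc:
  assumes X: "X \<in> graphs U C" and xs: "xs \<noteq> []" "set xs \<subseteq> verts X"
  shows "garr (l X) (ends xs) \<cdot> Ta (inc X xs) = inc (GT X) xs \<cdot> tau (map (ghom X) (steps xs))"
proof -
  define Hs where "Hs = map (ghom X) (steps xs)"
  let ?V = "verts (line Hs)" and ?p = "(vertex 0, vertex (length Hs)) :: 'x \<times> 'x"
  \<comment> \<open>On the steps of the line the homs are those of the path and the arrows are
    identities; elsewhere the source is \<open>zero\<close>, which leaves one choice.\<close>
  define f where "f = \<lparr>gdom = line Hs, gcod = X, gver = (\<lambda>a\<in>?V. xs ! inv vertex a),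
    garr = (\<lambda>p\<in>?V \<times> ?V. if snd p = vertex (Suc (index p)) then Ident C (Hs ! index p)
      else from_initial zero (ghom X (xs ! inv vertex (fst p), xs ! inv vertex (snd p))))\<rparr>"
  have H: "objs Hs" using X xs(2) by (simp add: Hs_def)
  have len: "length xs = Suc (length Hs)" using xs(1) by (simp add: Hs_def length_steps)
  have f_simps: "gdom f = line Hs" "gcod f = X" by (simp_all add: f_def)
  have gv: "gver f (vertex i) = xs ! i" if "i \<le> length Hs" for i
    using that by (auto simp: f_def line_simps(1))
  have xsV: "xs ! i \<in> verts X" if "i \<le> length Hs" for i
    using that len by (intro subsetD[OF xs(2)] nth_mem) simp
  have f: "f \<in> graph_maps U C"
    unfolding graph_maps_iff f_simps
  proof (intro conjI ballI allI impI)
    show "gver f a \<in> verts X" if "a \<in> ?V" for a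
      using that gv xsV by (auto simp: line_simps(1))
    show "gver f \<in> extensional ?V" "garr f \<in> extensional (?V \<times> ?V)" by (simp_all add: f_def)
    fix p assume p: "p \<in> ?V \<times> ?V"
    then obtain i j where ij: "p = (vertex i, vertex j)" "i \<le> length Hs" "j \<le> length Hs"
      by (auto simp: line_simps(1))
    have e: "ghom X (xs ! i, xs ! j) \<in> Obj C" using X xsV ij by simp
    have s: "Hs ! i = ghom X (xs ! i, xs ! j) \<and> Hs ! i \<in> Obj C" if "j = Suc i"
      using that ij(3) e nth_steps[of i xs] by (simp add: Hs_def)
    show "garr f p \<in> Arr C" "Dom C (garr f p) = ghom (line Hs) p"
      "Cod C (garr f p) = ghom X (gver f (fst p), gver f (snd p))"
      using p e s unfolding ij(1) fst_conv snd_conv gv[OF ij(2)] gv[OF ij(3)]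
      by (auto simp: f_def line_simps(2))
  qed (use X H in simp_all)
  have mgv: "map (gver f) (st Hs) = xs"
    by (rule nth_equalityI) (simp_all add: straight_def len gv del: upt_Suc)
  have mga: "map (garr f) (steps (st Hs)) = map (Ident C) Hs"
    by (rule nth_equalityI) (auto simp: steps_straight f_def line_simps(1))
  have e: "(gver f (fst ?p), gver f (snd ?p)) = ends xs"
    using ends_map[of "st Hs" "gver f"] mgv by simp
  note i = inc_st[OF H] and t = tau[OF H]
  note xi = inc_simps[OF X xs]
  have ei: "ends xs \<in> verts X \<times> verts X" using xs by simp
  have p: "?p \<in> verts (gdom f) \<times> verts (gdom f)" unfolding f_simps by (rule line_ends)
  let ?Tf = "farr (graph_functor (mfun T)) f"
  have pT: "?p \<in> verts (gdom ?Tf) \<times> verts (gdom ?Tf)" using p by simp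
  note fg = \<Gamma>a_garr_simps[OF f p, unfolded f_simps e]
  note fT = \<Gamma>a_garr_simps[OF GTa_map[OF f] pT]
  have if1: "garr (\<Gamma>a f) ?p \<cdot> inc (line Hs) (st Hs) = inc X xs"
    using \<Gamma>a_inc[OF f, of "st Hs"] st_path[of Hs] H xi
    unfolding f_simps mgv mga st_path(3) by (simp add: Hs_def[symmetric])
  have if2: "garr (\<Gamma>a ?Tf) ?p \<cdot> inc (GT (line Hs)) (st Hs) = inc (GT X) xs"
  proof -
    have "map (garr ?Tf) (steps (st Hs)) = map Ta (map (garr f) (steps (st Hs)))"
      using st_path(2)[of Hs] by (simp add: f_simps)
    then have "map (garr ?Tf) (steps (st Hs)) = map (\<lambda>Y. Ident C (To Y)) Hs"
      unfolding mga using H by simp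
    moreover have "Dom C (inc (GT X) xs) = Eo (map To Hs)" using X xs by (simp add: Hs_def)
    moreover have "inc (GT X) xs \<in> Arr C" using X xs by simp
    ultimately show ?thesis using \<Gamma>a_inc[OF GTa_map[OF f], of "st Hs"] st_path[of Hs] H
      by (simp add: f_simps mgv del: straight_simps)
  qed
  have "garr (l X) (ends xs) \<cdot> Ta (inc X xs) =
      (garr (l X) (ends xs) \<cdot> Ta (garr (\<Gamma>a f) ?p)) \<cdot> Ta (inc (line Hs) (st Hs))"
    unfolding if1[symmetric] using fg i X ei by simp
  also have "\<dots> = garr (\<Gamma>a ?Tf) ?p \<cdot> garr (l (line Hs)) ?p \<cdot> Ta (inc (line Hs) (st Hs))"
    using laws(1)[OF f p] unfolding law_nat_def f_simps e by simp
  also have "\<dots> = garr (\<Gamma>a ?Tf) ?p \<cdot> (inc (GT (line Hs)) (st Hs) \<cdot> tau Hs)"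
    unfolding t(4) using fT i H l_garr[OF line_graph[OF H] line_ends] by (simp add: f_simps)
  also have "\<dots> = (garr (\<Gamma>a ?Tf) ?p \<cdot> inc (GT (line Hs)) (st Hs)) \<cdot> tau Hs"
    using fT i t by (simp add: f_simps)
  finally show ?thesis unfolding if2 unfolding Hs_def .
qed

end

sublocale graph_law \<subseteq> gamma_law C T E U l tau
  by unfold_locales (simp_all add: tau(1-3) tau_inc del: split_paired_All)

context graph_law
begin

text \<open>The arrows \<open>fs\<close> form a graph map from the line on their sources to the line
  on their targets, with identities of \<open>zero\<close> off the line; naturality of the law is
  used there.\<close>

lemma tau_nat:
  assumes fs: "\<forall>f\<in>set fs. f \<in> Arr C"
  shows "tau (map (Cod C) fs) \<cdot> Ta (Ea fs) = Ea (map Ta fs) \<cdot> tau (map (Dom C) fs)"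
proof -
  let ?X = "map (Dom C) fs" and ?Y = "map (Cod C) fs"
  let ?V = "verts (line ?X)" and ?p = "(vertex 0, vertex (length ?X)) :: 'x \<times> 'x"
  define g where "g = \<lparr>gdom = line ?X, gcod = line ?Y, gver = (\<lambda>a\<in>?V. a),
    garr = (\<lambda>p\<in>?V \<times> ?V. if snd p = vertex (Suc (index p)) then fs ! index p else Ident C zero)\<rparr>"
  have X: "objs ?X" and Y: "objs ?Y" using fs by simp_all
  have V: "verts (line ?Y) = ?V" by (simp add: line_simps(1))
  have g_simps: "gdom g = line ?X" "gcod g = line ?Y" by (simp_all add: g_def)
  have gv: "gver g a = a" if "a \<in> ?V" for a using that by (simp add: g_def)
  have g: "g \<in> graph_maps U C"
    unfolding graph_maps_iff g_simps
  proof (intro conjI ballI allI impI)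
    show "gver g a \<in> verts (line ?Y)" if "a \<in> ?V" for a using that gv V by simp
    show "gver g \<in> extensional ?V" "garr g \<in> extensional (?V \<times> ?V)" by (simp_all add: g_def)
    fix p assume p: "p \<in> ?V \<times> ?V"
    have pY: "p \<in> verts (line ?Y) \<times> verts (line ?Y)" using p unfolding V .
    have gp: "(gver g (fst p), gver g (snd p)) = p" using gv p by auto
    show "garr g p \<in> Arr C" "Dom C (garr g p) = ghom (line ?X) p"
      "Cod C (garr g p) = ghom (line ?Y) (gver g (fst p), gver g (snd p))"
      using p fs line_index(3)[OF p] unfolding gp line_simps(2)[OF p] line_simps(2)[OF pY]
      by (auto simp: g_def)
  qed (use X Y in \<open>simp_all del: set_map\<close>)
  have mgv: "map (gver g) (st ?X) = st ?X"
    using st_path(2)[of ?X] by (intro map_idI) (auto intro!: gv simp del: straight_simps)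
  have mga: "map (garr g) (steps (st ?X)) = fs"
    by (rule nth_equalityI) (auto simp: steps_straight g_def line_simps(1))
  have mgh: "map (\<lambda>p. ghom (line ?Y) (gver g (fst p), gver g (snd p))) (steps (st ?X)) = ?Y"
  proof -
    have "map (\<lambda>p. ghom (line ?Y) (gver g (fst p), gver g (snd p))) (steps (st ?X)) =
        map (ghom (line ?Y)) (steps (map (gver g) (st ?X)))" by (simp add: steps_map)
    then show ?thesis unfolding mgv using line_st[of ?Y] by simp
  qed
  have p: "?p \<in> verts (gdom g) \<times> verts (gdom g)" unfolding g_simps by (rule line_ends)
  have sp: "st ?X \<noteq> []" "set (st ?X) \<subseteq> verts (gdom g)" unfolding g_simps by (rule st_path)+
  have mT: "map (\<lambda>p. Ta (garr g p)) (steps (st ?X)) = map Ta fs"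
    using mga by (metis map_fusion)
  have "inc (GT (line ?Y)) (st ?Y) \<cdot> (tau ?Y \<cdot> Ta (Ea fs)) = inc (GT (line ?Y)) (st ?Y) \<cdot> (Ea (map Ta fs) \<cdot> tau ?X)"
    using laws(1)[OF g p] nat_left[OF g sp] nat_right[OF g sp]
    unfolding law_nat_def mgv mga mgh mT g_simps line_st st_path(3) by simp
  then show ?thesis by (rule inc_cancel[OF Y, rotated -1]) (use fs in simp_all)
qed

lemma tau_nat_family:
  assumes "\<forall>i\<in>set is. f i \<in> Arr C \<and> Dom C (f i) = a i \<and> Cod C (f i) = b i"
  shows "tau (map b is) \<cdot> Ta (Ea (map f is)) = Ea (map (\<lambda>i. Ta (f i)) is) \<cdot> tau (map a is)"
  using tau_nat[of "map f is"] assms by simp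

lemma map_line_st: "map (\<lambda>p. h (ghom (line Xs) p)) (steps (st Xs)) = map h Xs"
  using line_st[of Xs] by (metis map_fusion)

text \<open>As for the other axioms of \<tau>, the matching axiom of the law is taken at a line and
  the straight injection is cancelled.\<close>

lemma tau_\<eta>:
  assumes Xs: "objs Xs"
  shows "tau Xs \<cdot> \<eta> (Eo Xs) = Ea (map \<eta> Xs)"
proof -
  have "inc (GT (line Xs)) (st Xs) \<cdot> (tau Xs \<cdot> \<eta> (Eo Xs)) = inc (GT (line Xs)) (st Xs) \<cdot> Ea (map \<eta> Xs)"
    using laws(2)[OF line_graph[OF Xs] line_ends] \<eta>_left[OF line_graph[OF Xs] st_path(1,2)]
      \<eta>_right[OF line_graph[OF Xs] st_path(1,2)]
    unfolding law_\<eta>_def line_st map_line_st st_path(3) by simp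
  then show ?thesis by (rule inc_cancel[OF Xs, rotated -1]) (use Xs in simp_all)
qed

lemma tau_\<mu>:
  assumes Xs: "objs Xs"
  shows "tau Xs \<cdot> \<mu> (Eo Xs) = Ea (map \<mu> Xs) \<cdot> (tau (map To Xs) \<cdot> Ta (tau Xs))"
proof -
  have "inc (GT (line Xs)) (st Xs) \<cdot> (tau Xs \<cdot> \<mu> (Eo Xs)) =
      inc (GT (line Xs)) (st Xs) \<cdot> (Ea (map \<mu> Xs) \<cdot> (tau (map To Xs) \<cdot> Ta (tau Xs)))"
    using laws(4)[OF line_graph[OF Xs] line_ends] \<mu>_left[OF line_graph[OF Xs] st_path(1,2)]
      \<mu>_right[OF line_graph[OF Xs] st_path(1,2)]
    unfolding law_\<mu>_def line_st map_line_st st_path(3) by simp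
  then show ?thesis by (rule inc_cancel[OF Xs, rotated -1]) (use Xs in simp_all)
qed

lemma tau_u:
  assumes X: "X \<in> Obj C"
  shows "tau [X] \<cdot> Ta (u X) = u (To X)"
proof -
  have Xs: "objs [X]" using X by simp
  let ?p = "(vertex 0, vertex (length [X])) :: 'x \<times> 'x"
  have p: "?p \<in> verts (line [X]) \<times> verts (line [X])" by (rule line_ends)
  \<comment> \<open>The straight path on a one-object line is the single step through which the unit
    of \<Gamma> factors.\<close>
  have st: "[fst ?p, snd ?p] = st [X]" by (simp add: straight_def)
  have h: "ghom (line [X]) ?p = X" using line_simps(2)[OF p] by simp
  have hT: "ghom (GT (line [X])) ?p = To X" using p h by simp
  have pT: "?p \<in> verts (GT (line [X])) \<times> verts (GT (line [X]))" using p by simp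
  have "inc (GT (line [X])) (st [X]) \<cdot> (tau [X] \<cdot> Ta (u X)) = inc (GT (line [X])) (st [X]) \<cdot> u (To X)"
    using laws(3)[OF line_graph[OF Xs] p] unit_left[OF line_graph[OF Xs] p] unit_garr[OF pT]
    unfolding law_u_def h hT st by simp
  then show ?thesis by (rule inc_cancel[OF Xs, rotated -1]) (use X in simp_all)
qed

text \<open>The line on \<open>concat Xss\<close> is cut at the partial sums \<open>off k\<close> of
  the lengths, so that block k runs along \<open>Xss ! k\<close>. An empty inner list gives a
  repeated cut and a block consisting of one vertex.\<close>

lemma line_nested:
  fixes Xss
  defines "off \<equiv> \<lambda>k. length (concat (take k Xss))"
  defines "ys \<equiv> map (\<lambda>k. vertex (off k)) [0..<Suc (length Xss)]"
  defines "pss \<equiv> map (\<lambda>k. straight (off k) (off (Suc k))) [0..<length Xss]"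
  shows "(ys, pss) \<in> nested_paths (verts (line (concat Xss)))" "join ys pss = st (concat Xss)"
    "ends ys = (vertex 0, vertex (length (concat Xss)))"
    "map (\<lambda>ps. map (ghom (line (concat Xss))) (steps ps)) pss = Xss"
proof -
  let ?X = "concat Xss" and ?m = "length Xss"
  have oS: "off (Suc k) = off k + length (Xss ! k)" if "k < ?m" for k
    using that by (simp add: off_def take_Suc_conv_app_nth)
  have ole: "off k \<le> length ?X" for k
  proof -
    have "length ?X = length (concat (take k Xss @ drop k Xss))" by simp
    also have "\<dots> = off k + length (concat (drop k Xss))" unfolding off_def concat_append by simp
    finally show ?thesis by simp
  qed
  have steps_ys: "steps ys = map (\<lambda>k. (vertex (off k), vertex (off (Suc k)))) [0..<?m]"
    unfolding ys_def steps_map steps_upt by simp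
  have "straight (off k) (off (Suc k)) \<in> paths (verts (line ?X)) (vertex (off k)) (vertex (off (Suc k)))"
    if "k < ?m" for k
    using oS[OF that] ole[of "Suc k"] unfolding paths_iff line_simps(1) by auto
  then have "list_all2 (\<lambda>(a, b) ps. ps \<in> paths (verts (line ?X)) a b) (steps ys) pss"
    unfolding steps_ys pss_def by (auto simp: list.rel_map list_all2_same)
  moreover have "set ys \<subseteq> verts (line ?X)" using ole unfolding ys_def line_simps(1) by (auto simp del: upt_Suc)
  moreover have ys: "ys \<noteq> []" by (simp add: ys_def)
  ultimately show n: "(ys, pss) \<in> nested_paths (verts (line ?X))" by (simp add: nested_paths_def)
  have "hd ys = vertex (off 0)" unfolding ys_def by (simp add: hd_map del: upt_Suc)
  moreover have "last ys = vertex (off ?m)" unfolding ys_def by simp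
  ultimately show e: "ends ys = (vertex 0, vertex (length ?X))" by (simp add: ends_def off_def)
  note nD = nested_pathsD[OF n]
  \<comment> \<open>All steps of the join are straight because those of the blocks are, and
    uniqueness of the straight path replaces a computation of the concatenation.\<close>
  show "join ys pss = st ?X"
  proof (rule straight_unique)
    show "join ys pss \<noteq> []" "ends (join ys pss) = (vertex 0, vertex (length ?X))"
      using nD(3,5) e by simp_all
    show "\<forall>p\<in>set (steps (join ys pss)). snd p = vertex (Suc (index p))"
      unfolding nD(6) unfolding pss_def by (auto simp: steps_straight)
  qed
  have "map ((!) ?X) [off k..<off (Suc k)] = Xss ! k" if k: "k < ?m" for k
  proof -
    have "?X = concat (take k Xss @ Xss ! k # drop (Suc k) Xss)" using id_take_nth_drop[OF k] by simp
    then have "?X = concat (take k Xss) @ Xss ! k @ concat (drop (Suc k) Xss)" by simp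
    then have "?X ! (off k + i) = Xss ! k ! i" if "i < length (Xss ! k)" for i
      using that by (simp add: nth_append off_def)
    then show ?thesis unfolding oS[OF k] by (intro nth_equalityI) simp_all
  qed
  then have "map (\<lambda>k. map ((!) ?X) [off k..<off (Suc k)]) [0..<?m] = map ((!) Xss) [0..<?m]"
    by (intro map_cong) simp_all
  then show "map (\<lambda>ps. map (ghom (line ?X)) (steps ps)) pss = Xss"
    unfolding pss_def map_fusion line_straight[OF ole] map_nth .
qed

text \<open>The axiom of the law at the line on \<open>concat Xss\<close>, tested on the nesting of
  \<open>line_nested\<close>. Its join is the straight path, so the injection in front cancels;
  \<open>tau_nat_family\<close> supplies the naturality that \<open>\<sigma>_right\<close> asks
  for.\<close>

lemma tau_\<sigma>:
  assumes X: "\<forall>Xs\<in>set Xss. objs Xs"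
  shows "tau (concat Xss) \<cdot> Ta (\<sigma> Xss) =
    \<sigma> (map (map To) Xss) \<cdot> (Ea (map tau Xss) \<cdot> tau (map Eo Xss))"
proof -
  define ys :: "'x list" where "ys = map (\<lambda>k. vertex (length (concat (take k Xss)))) [0..<Suc (length Xss)]"
  define pss :: "'x list list" where "pss = map (\<lambda>k. straight (length (concat (take k Xss))) (length (concat (take (Suc k) Xss)))) [0..<length Xss]"
  note n = line_nested[of Xss, folded ys_def pss_def]
  have Xs: "objs (concat Xss)" using X by simp
  have m: "map (\<lambda>ps. h (map (ghom (line (concat Xss))) (steps ps))) pss = map h Xss" for h :: "'o list \<Rightarrow> 'y"
    using n(4) by (metis map_fusion)
  have mT: "map (\<lambda>ps. map (\<lambda>p. To (ghom (line (concat Xss)) p)) (steps ps)) pss = map (map To) Xss"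
    using m[of "map To"] by simp
  have right: "garr (Gamma_mult C E (GT (line (concat Xss)))) (ends ys) \<cdot> garr (\<Gamma>a (l (line (concat Xss)))) (ends ys) \<cdot>
      garr (l (\<Gamma> (line (concat Xss)))) (ends ys) \<cdot> Ta (inc (\<Gamma> (line (concat Xss))) ys \<cdot> Ea (map (inc (line (concat Xss))) pss)) =
    inc (GT (line (concat Xss))) (st (concat Xss)) \<cdot> (\<sigma> (map (map To) Xss) \<cdot> (Ea (map tau Xss) \<cdot> tau (map Eo Xss)))"
    using \<sigma>_right[OF line_graph[OF Xs] n(1) tau_nat_family] unfolding mT m n(2) by blast
  have "inc (GT (line (concat Xss))) (st (concat Xss)) \<cdot> (tau (concat Xss) \<cdot> Ta (\<sigma> Xss)) =
    inc (GT (line (concat Xss))) (st (concat Xss)) \<cdot> (\<sigma> (map (map To) Xss) \<cdot> (Ea (map tau Xss) \<cdot> tau (map Eo Xss)))"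
    using laws(5)[OF line_graph[OF Xs] line_ends] \<sigma>_left[OF line_graph[OF Xs] n(1)] right
    unfolding law_\<sigma>_def n(2-4) by simp
  then show ?thesis by (rule inc_cancel[OF Xs, rotated -1]) (use X tau(1-3) in simp_all)
qed

lemma tau_opmonoidal: "restrict tau (lists (Obj C)) \<in> opmonoidal_structures C E T"
proof -
  have [simp]: "restrict tau (lists (Obj C)) Xs = tau Xs" if "objs Xs" for Xs
    using that by (simp add: in_lists_conv_set)
  have "is_natural (seq_cat C) C (mfun T \<circ>\<circ> tensor E) (tensor E \<circ>\<circ> seq_functor (mfun T))
      (restrict tau (lists (Obj C)))"
    unfolding is_natural_def
    by (intro conjI allI impI ballI) (auto simp: in_lists_conv_set tau_nat simp del: restrict_apply)
  then show ?thesis unfolding opmonoidal_structures_def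
    by (simp add: in_lists_conv_set tau_u tau_\<eta> tau_\<mu> tau_\<sigma> del: restrict_apply)
qed

text \<open>By \<open>tau_inc\<close> both laws have the same composite with \<open>T\<close> of
  every injection, and these are jointly epic.\<close>

lemma distributive_law_of_tau:
  assumes ext: "l \<in> extensional (graphs U C)"
  shows "distributive_law_of U C E T (restrict tau (lists (Obj C))) = l"
proof -
  interpret t: opmon_gamma C T E "restrict tau (lists (Obj C))" U
    by unfold_locales (rule tau_opmonoidal)
  have "t.l X = l X" if X: "X \<in> graphs U C" for X
  proof (subst graph_map_eq_iff[where S = "verts X \<times> verts X"])
    show "garr (l X) \<in> extensional (verts X \<times> verts X)"
      using graph_map_ext(2)[OF l_map[OF X]] X by simp
    show "\<forall>p. p \<in> verts X \<times> verts X \<longrightarrow> garr (t.l X) p = garr (l X) p"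
    proof (intro allI impI)
      fix p assume p: "p \<in> verts X \<times> verts X"
      show "garr (t.l X) p = garr (l X) p"
      proof (rule T_\<Gamma>_eq[OF X p])
        fix xs assume xs: "xs \<noteq> []" "set xs \<subseteq> verts X" and e: "ends xs = p"
        have "map (ghom X) (steps xs) \<in> lists (Obj C)" using X xs by (simp add: in_lists_conv_set)
        then show "garr (t.l X) p \<cdot> Ta (inc X xs) = garr (l X) p \<cdot> Ta (inc X xs)"
          unfolding e[symmetric] t.law.l_inc[OF X xs] tau_inc[OF X xs] by simp
      qed (use t.law_garr[OF X p] X p in simp_all)
    qed
  qed (use t.law_simps[OF X] X in simp_all)
  moreover have "distributive_law_of U C E T t \<in> extensional (graphs U C)" for t
    by (simp add: distributive_law_of_def)
  ultimately show ?thesis using ext by (intro extensionalityI[of _ "graphs U C"]) simp_all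
qed

end

lemma (in gamma) distributive_law_of_bij:
  "bij_betw (distributive_law_of U C E T) (opmonoidal_structures C E T) (graph_distributive_laws U C E T)"
  unfolding bij_betw_def
proof (intro conjI equalityI subsetI inj_onI)
  fix t t' assume t: "t \<in> opmonoidal_structures C E T" and t': "t' \<in> opmonoidal_structures C E T"
    and eq: "distributive_law_of U C E T t = distributive_law_of U C E T t'"
  interpret a: opmon_gamma C T E t U by unfold_locales (rule t)
  interpret b: opmon_gamma C T E t' U by unfold_locales (rule t')
  have "t Xs = t' Xs" if "Xs \<in> lists (Obj C)" for Xs
  proof -
    have Xs: "objs Xs" using that by (simp add: in_lists_conv_set)
    have "inc (GT (line Xs)) (st Xs) \<cdot> t Xs = inc (GT (line Xs)) (st Xs) \<cdot> t' Xs"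
      using a.law.l_inc[OF line_graph[OF Xs] st_path(1,2)] b.law.l_inc[OF line_graph[OF Xs] st_path(1,2)]
      unfolding line_st eq by simp
    then show ?thesis
      by (rule inc_cancel[OF Xs, rotated -1]) (use Xs a.\<tau>_simps[OF Xs] b.\<tau>_simps[OF Xs] in simp_all)
  qed
  moreover have "t \<in> extensional (lists (Obj C))" "t' \<in> extensional (lists (Obj C))"
    using t t' by (auto simp: opmonoidal_structures_def)
  ultimately show "t = t'" by (metis extensionalityI)
next
  fix l assume "l \<in> distributive_law_of U C E T ` opmonoidal_structures C E T"
  then obtain t where t: "t \<in> opmonoidal_structures C E T" "l = distributive_law_of U C E T t" by blast
  interpret opmon_gamma C T E t U by unfold_locales (rule t)
  show "l \<in> graph_distributive_laws U C E T" unfolding t(2) by (rule distributive_law_of_law)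
next
  fix l assume l: "l \<in> graph_distributive_laws U C E T"
  have law: "is_distributive_law (graph_cat U C) (Gamma_monad C E) (graph_monad T) l"
    and ext: "l \<in> extensional (graphs U C)" and ver: "\<forall>X\<in>graphs U C. \<forall>a\<in>verts X. gver (l X) a = a"
    using l unfolding graph_distributive_laws_def by blast+
  have hom: "l X \<in> graph_maps U C \<and> gdom (l X) = GT (\<Gamma> X) \<and> gcod (l X) = \<Gamma> (GT X)" if "X \<in> graphs U C" for X
    using law that unfolding is_distributive_law_def is_natural_def by simp
  interpret graph_law C T E U l
  proof unfold_locales
    \<comment> \<open>The hypothesis fixes the map on the vertices of \<open>X\<close>; outside them
      graph maps are extensional.\<close>
    show "gver (l X) = (\<lambda>a\<in>verts X. a)" if X: "X \<in> graphs U C" for X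
      using graph_map_ext(1)[of "l X"] hom[OF X] ver X
      by (intro extensionalityI[of _ "verts X"]) simp_all
  qed (use hom law in blast)+
  show "l \<in> distributive_law_of U C E T ` opmonoidal_structures C E T"
    using distributive_law_of_tau[OF ext] tau_opmonoidal by (metis imageI)
qed

theorem theorem5p2p1:
  fixes V :: "('o, 'a) category"
    and E :: "('o, 'a) multitensor"
    and T :: "('o, 'a) monad"
    and U :: "'x set set"
  assumes "is_category V"
    and "is_multitensor V E"
    and "is_monad V T"
    and "is_universe U"
  shows "bij_betw (substitution_of V E T) (opmonoidal_structures V E T) (EM_substitutions V E T) \<and>
    bij_betw (lifting_of V E T) (opmonoidal_structures V E T) (liftings V E T) \<and>
    (\<forall>\<tau>\<in>opmonoidal_structures V E T.
       let EMT = EM_multitensor V E T (substitution_of V E T \<tau>);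
           E' = lifting_of V E T \<tau>
       in \<exists>F. is_iso_functor (ecat_cat U V EMT) (ecat_cat U (alg_cat V T) E') F \<and>
              functors_agree (ecat_cat U V EMT)
                ((graph_functor alg_forget \<circ>\<circ> ecat_forget) \<circ>\<circ> F) ecat_forget) \<and>
    (has_small_coproducts U V \<and> preserves_small_coproducts U V V (mfun T) \<and>
       is_distributive U V E \<longrightarrow>
     bij_betw (distributive_law_of U V E T) (opmonoidal_structures V E T)
       (graph_distributive_laws U V E T))"
proof -
  interpret setting V T E by unfold_locales (rule assms)+
  show ?thesis unfolding Let_def
  proof (intro conjI ballI impI)
    fix \<tau> assume "\<tau> \<in> opmonoidal_structures V E T"
    then interpret opmon V T E \<tau> by unfold_locales
    show "\<exists>F. is_iso_functor (ecat_cat U V (EM_multitensor V E T (substitution_of V E T \<tau>)))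
          (ecat_cat U (alg_cat V T) (lifting_of V E T \<tau>)) F \<and>
        functors_agree (ecat_cat U V (EM_multitensor V E T (substitution_of V E T \<tau>)))
          ((graph_functor alg_forget \<circ>\<circ> ecat_forget) \<circ>\<circ> F) ecat_forget"
      by (rule ecat_iso)
  next
    assume "has_small_coproducts U V \<and> preserves_small_coproducts U V V (mfun T) \<and> is_distributive U V E"
    then interpret gamma V T E U by unfold_locales (use assms in blast)+
    show "bij_betw (distributive_law_of U V E T) (opmonoidal_structures V E T) (graph_distributive_laws U V E T)"
      by (rule distributive_law_of_bij)
  qed (rule substitution_of_bij lifting_of_bij)+
qed

end
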